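(* Let $\Omega\subset\mathbb{C}^n$ ($n\ge2$) be a bounded $m$-convex domain with Dini-smooth boundary. Then there exists a constant $C>0$ such that $$L([x,y])\le C|x-y|^{1/m}$$ for every $x,y\in\Omega$, where $[x,y]$ denotes a Kobayashi geodesic connecting $x$ and $y$. Moreover, suppose that $(\Omega,d_K)$ is Gromov hyperbolic and let $\lambda\ge1$. Then there exists a constant $C'>0$ such that for every $x,y\in\Omega$ and every Kobayashi $\lambda$-quasi-geodesic $\gamma$ connecting $x$ and $y$, $$L(\gamma)\le C'|x-y|^{1/m}.$$
   Context: $L(\cdot)$ is Euclidean length. $\delta_\Omega(x)=\inf\{|x-\xi|:\xi\in\partial\Omega\}$ and, for $v\in\mathbb{C}^n\setminus\{0\}$, $\delta_\Omega(x;v)=\inf\{|x-\xi|:\xi\in\partial\Omega\cap(x+\mathbb{C}v)\}$. A bounded convex domain $\Omega\subset\mathbb{C}^n$, $n\ge2$, is $m$-convex ($m>1$) if for some $C>0$, $\delta_\Omega(z;v)\le C\,\delta_\Omega(z)^{1/m}$ for all $z\in\Omega$ and all nonzero $v\in\mathbb{C}^n$. A $C^1$-smooth boundary point $p$ of $\Omega$ is Dini-smooth if there is a neighborhood $U$ of $p$ with $\int_0^1\frac{\omega(t)}{t}dt<+\infty$, where $\omega(t)=\sup\{|\vec n(x)-\vec n(y)|:|x-y|<t,\ x,y\in\partial\Omega\cap U\}$ and $\vec n$ is the outer unit normal to $\partial\Omega$. The boundary is Dini-smooth if each boundary point is. Kobayashi metric: $K_\Omega(x;v)=\inf\{|\xi|: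 f:\mathbb{D}\to\Omega \text{ holomorphic}, f(0)=x, df_0(\xi)=v\}$, with $\mathbb{D}$ the unit disc; the Kobayashi distance $d_K(x,y)$ is the infimum of $\int_0^1K_\Omega(\gamma(t);\dot\gamma(t))\,dt$ over piecewise $C^1$ curves from $x$ to $y$. A Kobayashi geodesic connecting $x$ and $y$ is the image of an isometric embedding of $[0,d_K(x,y)]$ into $(\Omega,d_K)$ sending endpoints to $x,y$. A Kobayashi $\lambda$-quasi-geodesic connecting $x$ and $y$ is a map $\gamma:[a,b]\to\Omega$ with $\gamma(a)=x$, $\gamma(b)=y$ and $\lambda^{-1}|s-t|\le d_K(\gamma(s),\gamma(t))\le\lambda|s-t|$ for all $s,t\in[a,b]$. Gromov hyperbolicity: with $(x|y)_\omega=\frac12(d(x,\omega)+d(y,\omega)-d(x,y))$, a proper geodesic metric space $(X,d)$ is Gromov hyperbolic if for some $\delta\ge0$, $(x|y)_\omega\ge\min\{(x|z)_\omega,(z|y)_\omega\}-\delta$ for all $x,y,z,\omega\in X$. *)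

theory Defs
  imports "HOL-Analysis.Analysis"
begin

section \<open>Distance to the boundary and \<open>m\<close>-convexity\<close>

definition bdist :: "(complex^'n) set \<Rightarrow> complex^'n \<Rightarrow> real" where
  "bdist \<Omega> x = infdist x (frontier \<Omega>)"

definition bdist_dir :: "(complex^'n) set \<Rightarrow> complex^'n \<Rightarrow> complex^'n \<Rightarrow> real" where
  "bdist_dir \<Omega> x v = infdist x (frontier \<Omega> \<inter> {x + c *s v | c. True})"

text \<open>\<open>infdist\<close> to the empty set is 0; this case does not occur for the bounded nonempty open sets
  considered here, because every complex line through a point of such a set meets its frontier.\<close>

definition m_convex :: "real \<Rightarrow> (complex^'n) set \<Rightarrow> bool" where
  "m_convex m \<Omega> \<longleftrightarrow>
     (\<exists>C>0. \<forall>z\<in>\<Omega>. \<forall>v. v \<noteq> 0 \<longrightarrow> bdist_dir \<Omega> z v \<le> C * bdist \<Omega> z powr (1 / m))"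


section \<open>Dini-smooth boundary\<close>

text \<open>\<open>\<rho>\<close> is a \<open>C\<^sup>1\<close> defining function of \<open>\<Omega>\<close> on the open set \<open>U\<close>, with nonvanishing gradient \<open>G\<close>
  with respect to the real inner product on \<open>complex^'n\<close>.\<close>

definition C1_defining_function ::
  "('a::euclidean_space) set \<Rightarrow> 'a set \<Rightarrow> ('a \<Rightarrow> real) \<Rightarrow> ('a \<Rightarrow> 'a) \<Rightarrow> bool" where
  "C1_defining_function \<Omega> U \<rho> G \<longleftrightarrow>
     open U \<and> (\<forall>x\<in>U. GDERIV \<rho> x :> G x) \<and> continuous_on U G \<and> (\<forall>x\<in>U. G x \<noteq> 0) \<and>
     \<Omega> \<inter> U = {x\<in>U. \<rho> x < 0} \<and> frontier \<Omega> \<inter> U = {x\<in>U. \<rho> x = 0}"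

definition C1_smooth_point :: "('a::euclidean_space) set \<Rightarrow> 'a \<Rightarrow> bool" where
  "C1_smooth_point \<Omega> p \<longleftrightarrow>
     p \<in> frontier \<Omega> \<and> (\<exists>U \<rho> G. C1_defining_function \<Omega> U \<rho> G \<and> p \<in> U)"

definition outer_unit_normal :: "('a::euclidean_space) set \<Rightarrow> 'a \<Rightarrow> 'a" where
  "outer_unit_normal \<Omega> x =
     (THE \<nu>. \<exists>U \<rho> G. C1_defining_function \<Omega> U \<rho> G \<and> x \<in> U \<and> \<nu> = sgn (G x))"

text \<open>The normal does not depend on the defining function, so the description above is proper.\<close>

lemma C1_defining_function_descent:
  assumes "C1_defining_function \<Omega> U \<rho> G" "x \<in> U" "\<rho> x = 0"
  shows "h \<bullet> G x < 0 \<Longrightarrow> \<forall>\<^sub>F t in at_right (0::real). x + t *\<^sub>R h \<in> \<Omega>"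
    and "h \<bullet> G x > 0 \<Longrightarrow> \<forall>\<^sub>F t in at_right (0::real). x + t *\<^sub>R h \<notin> \<Omega>"
proof -
  have U: "open U" and d: "(\<rho> has_derivative (\<lambda>h. h \<bullet> G x)) (at x)"
    and \<Omega>: "\<Omega> \<inter> U = {x\<in>U. \<rho> x < 0}"
    using assms by (auto simp: C1_defining_function_def gderiv_def)
  have l: "((\<lambda>t::real. x + t *\<^sub>R h) has_derivative (\<lambda>t. t *\<^sub>R h)) (at 0)"
    by (auto intro!: derivative_eq_intros)
  have "((\<lambda>t::real. \<rho> (x + t *\<^sub>R h)) has_derivative (\<lambda>t. (t *\<^sub>R h) \<bullet> G x)) (at 0)"
    using has_derivative_compose[OF l, of \<rho> "\<lambda>h. h \<bullet> G x"] d by simp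
  then have D: "((\<lambda>t::real. \<rho> (x + t *\<^sub>R h)) has_real_derivative (h \<bullet> G x)) (at 0)"
    by (simp add: has_field_derivative_def mult.commute[of _ "h \<bullet> G x"])
  have "((\<lambda>t::real. x + t *\<^sub>R h) \<longlongrightarrow> x + 0 *\<^sub>R h) (at_right 0)"
    by (intro tendsto_intros)
  then have inU: "\<forall>\<^sub>F t in at_right (0::real). x + t *\<^sub>R h \<in> U"
    using U assms(2) topological_tendstoD[of _ x "at_right 0" U] by simp
  show "\<forall>\<^sub>F t in at_right (0::real). x + t *\<^sub>R h \<in> \<Omega>" if "h \<bullet> G x < 0"
  proof -
    from DERIV_neg_dec_right[OF D that] assms(3)
    have "\<forall>\<^sub>F t in at_right (0::real). \<rho> (x + t *\<^sub>R h) < 0"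
      by (auto simp: eventually_at_right_field)
    with inU show ?thesis by eventually_elim (use \<Omega> in blast)
  qed
  show "\<forall>\<^sub>F t in at_right (0::real). x + t *\<^sub>R h \<notin> \<Omega>" if "h \<bullet> G x > 0"
  proof -
    from DERIV_pos_inc_right[OF D that] assms(3)
    have "\<forall>\<^sub>F t in at_right (0::real). \<rho> (x + t *\<^sub>R h) > 0"
      by (auto simp: eventually_at_right_field)
    with inU show ?thesis by eventually_elim (use \<Omega> in force)
  qed
qed

lemma outer_unit_normal_eq:
  assumes x: "x \<in> frontier \<Omega>" and 1: "C1_defining_function \<Omega> U \<rho> G" "x \<in> U"
  shows "outer_unit_normal \<Omega> x = sgn (G x)"
  unfolding outer_unit_normal_def
proof (rule the_equality)
  fix \<nu> assume "\<exists>U \<rho> G. C1_defining_function \<Omega> U \<rho> G \<and> x \<in> U \<and> \<nu> = sgn (G x)"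
  then obtain V \<sigma> H where 2: "C1_defining_function \<Omega> V \<sigma> H" "x \<in> V" and \<nu>: "\<nu> = sgn (H x)"
    by blast
  have "G x \<noteq> 0" "H x \<noteq> 0" "\<rho> x = 0" "\<sigma> x = 0"
    using 1 2 x by (auto simp: C1_defining_function_def)
  show "\<nu> = sgn (G x)"
  proof (rule ccontr)
    assume ne: "\<nu> \<noteq> sgn (G x)"
    define a where "a = sgn (G x)"
    define b where "b = sgn (H x)"
    have n: "a \<bullet> a = 1" "b \<bullet> b = 1"
      using \<open>G x \<noteq> 0\<close> \<open>H x \<noteq> 0\<close> by (simp_all add: a_def b_def norm_sgn dot_square_norm)
    have "0 < (b - a) \<bullet> (b - a)"
      using ne \<nu> by (simp add: a_def b_def)
    then have ab: "a \<bullet> b < 1"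
      using n by (simp add: inner_diff inner_commute)
    have G: "G x = norm (G x) *\<^sub>R a" and H: "H x = norm (H x) *\<^sub>R b"
      using \<open>G x \<noteq> 0\<close> \<open>H x \<noteq> 0\<close> by (simp_all add: a_def b_def sgn_div_norm)
    have "(b - a) \<bullet> G x < 0"
      by (subst G) (use \<open>G x \<noteq> 0\<close> ab n in \<open>simp add: inner_diff inner_commute mult_less_0_iff\<close>)
    then have e1: "\<forall>\<^sub>F t in at_right (0::real). x + t *\<^sub>R (b - a) \<in> \<Omega>"
      using C1_defining_function_descent(1)[OF 1 \<open>\<rho> x = 0\<close>] by blast
    have "(b - a) \<bullet> H x > 0"
      by (subst H) (use \<open>H x \<noteq> 0\<close> ab n in \<open>simp add: inner_diff inner_commute\<close>)
    then have e2: "\<forall>\<^sub>F t in at_right (0::real). x + t *\<^sub>R (b - a) \<notin> \<Omega>"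
      using C1_defining_function_descent(2)[OF 2 \<open>\<sigma> x = 0\<close>] by blast
    have "\<forall>\<^sub>F t in at_right (0::real). False"
      using e1 e2 by eventually_elim simp
    then show False by simp
  qed
qed (use 1 in blast)

definition normal_modulus :: "('a::euclidean_space) set \<Rightarrow> 'a set \<Rightarrow> real \<Rightarrow> real" where
  "normal_modulus \<Omega> U t =
     Sup {norm (outer_unit_normal \<Omega> x - outer_unit_normal \<Omega> y) | x y.
            x \<in> frontier \<Omega> \<inter> U \<and> y \<in> frontier \<Omega> \<inter> U \<and> norm (x - y) < t}"

text \<open>The frontier is required to be \<open>C\<^sup>1\<close> throughout \<open>U\<close>, so that the normals entering the modulus
  of continuity are meaningful. The integral is an extended nonnegative one.\<close>

definition dini_smooth_point :: "('a::euclidean_space) set \<Rightarrow> 'a \<Rightarrow> bool" where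
  "dini_smooth_point \<Omega> p \<longleftrightarrow> C1_smooth_point \<Omega> p \<and>
     (\<exists>U. open U \<and> p \<in> U \<and> (\<forall>x\<in>frontier \<Omega> \<inter> U. C1_smooth_point \<Omega> x) \<and>
        (\<integral>\<^sup>+t\<in>{0<..<1}. ennreal (normal_modulus \<Omega> U t / t) \<partial>lborel) < \<infinity>)"

definition dini_smooth_boundary :: "('a::euclidean_space) set \<Rightarrow> bool" where
  "dini_smooth_boundary \<Omega> \<longleftrightarrow> (\<forall>p\<in>frontier \<Omega>. dini_smooth_point \<Omega> p)"


section \<open>The Kobayashi metric and distance\<close>

text \<open>Maps from the unit disc to \<open>complex^'n\<close> are holomorphic iff their components are.\<close>

definition kobayashi_metric :: "(complex^'n) set \<Rightarrow> complex^'n \<Rightarrow> complex^'n \<Rightarrow> real" where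
  "kobayashi_metric \<Omega> x v =
     Inf {cmod \<xi> | \<xi>. \<exists>f :: complex \<Rightarrow> complex^'n.
            (\<forall>i. (\<lambda>z. f z $ i) holomorphic_on ball 0 1) \<and> f ` ball 0 1 \<subseteq> \<Omega> \<and> f 0 = x \<and>
            (\<forall>i. deriv (\<lambda>z. f z $ i) 0 * \<xi> = v $ i)}"

text \<open>\<open>valid_path\<close> is piecewise continuous differentiability on \<open>[0,1]\<close>, where the derivative is not
  required to have one-sided limits at the finitely many exceptional parameters. Using
  \<open>has_integral\<close> rather than \<open>integral\<close> discards those paths whose derivative blows up there so
  badly that the length integral diverges (\<open>integral\<close> would give them length 0). The other
  additional paths do not lower the infimum, since the Kobayashi distance is continuous. For paths
  with bounded derivative the integral always exists, the Kobayashi metric being upper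
  semicontinuous.\<close>

definition kobayashi_dist :: "(complex^'n) set \<Rightarrow> complex^'n \<Rightarrow> complex^'n \<Rightarrow> real" where
  "kobayashi_dist \<Omega> x y =
     Inf {l. \<exists>\<gamma>. valid_path \<gamma> \<and> path_image \<gamma> \<subseteq> \<Omega> \<and> pathstart \<gamma> = x \<and> pathfinish \<gamma> = y \<and>
            ((\<lambda>t. kobayashi_metric \<Omega> (\<gamma> t) (vector_derivative \<gamma> (at t))) has_integral l) {0..1}}"


section \<open>Geodesics, quasi-geodesics, length\<close>

text \<open>A Kobayashi geodesic is the image of such a \<open>\<sigma>\<close>, which is a parametrization of it on
  \<open>[0, kobayashi_dist \<Omega> x y]\<close>.\<close>

definition kobayashi_geodesic ::
  "(complex^'n) set \<Rightarrow> complex^'n \<Rightarrow> complex^'n \<Rightarrow> (real \<Rightarrow> complex^'n) \<Rightarrow> bool" where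
  "kobayashi_geodesic \<Omega> x y \<sigma> \<longleftrightarrow>
     \<sigma> ` {0..kobayashi_dist \<Omega> x y} \<subseteq> \<Omega> \<and> \<sigma> 0 = x \<and> \<sigma> (kobayashi_dist \<Omega> x y) = y \<and>
     (\<forall>s\<in>{0..kobayashi_dist \<Omega> x y}. \<forall>t\<in>{0..kobayashi_dist \<Omega> x y}.
        kobayashi_dist \<Omega> (\<sigma> s) (\<sigma> t) = \<bar>s - t\<bar>)"

definition kobayashi_quasi_geodesic ::
  "(complex^'n) set \<Rightarrow> real \<Rightarrow> complex^'n \<Rightarrow> complex^'n \<Rightarrow> real \<Rightarrow> real \<Rightarrow> (real \<Rightarrow> complex^'n) \<Rightarrow> bool"
  where
  "kobayashi_quasi_geodesic \<Omega> \<Lambda> x y a b \<gamma> \<longleftrightarrow>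
     a \<le> b \<and> \<gamma> ` {a..b} \<subseteq> \<Omega> \<and> \<gamma> a = x \<and> \<gamma> b = y \<and>
     (\<forall>s\<in>{a..b}. \<forall>t\<in>{a..b}.
        \<bar>s - t\<bar> / \<Lambda> \<le> kobayashi_dist \<Omega> (\<gamma> s) (\<gamma> t) \<and>
        kobayashi_dist \<Omega> (\<gamma> s) (\<gamma> t) \<le> \<Lambda> * \<bar>s - t\<bar>)"

text \<open>Supremum over all finite subdivisions; infinite for non-rectifiable curves.\<close>

definition curve_length :: "(real \<Rightarrow> 'a::metric_space) \<Rightarrow> real \<Rightarrow> real \<Rightarrow> ennreal" where
  "curve_length \<gamma> a b =
     (SUP ts \<in> {ts. sorted ts \<and> set ts \<subseteq> {a..b}}.
        \<Sum>i<length ts - 1. ennreal (dist (\<gamma> (ts ! i)) (\<gamma> (ts ! Suc i))))"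


section \<open>Gromov hyperbolicity\<close>

definition gromov_product :: "('a \<Rightarrow> 'a \<Rightarrow> real) \<Rightarrow> 'a \<Rightarrow> 'a \<Rightarrow> 'a \<Rightarrow> real" where
  "gromov_product d w x y = (d x w + d y w - d x y) / 2"

text \<open>Stated for an arbitrary distance function on a carrier; a bounded convex domain with its
  Kobayashi distance is a proper geodesic metric space.\<close>

definition gromov_hyperbolic :: "'a set \<Rightarrow> ('a \<Rightarrow> 'a \<Rightarrow> real) \<Rightarrow> bool" where
  "gromov_hyperbolic X d \<longleftrightarrow>
     (\<exists>\<delta>\<ge>0. \<forall>x\<in>X. \<forall>y\<in>X. \<forall>z\<in>X. \<forall>w\<in>X.
        gromov_product d w x y \<ge> min (gromov_product d w x z) (gromov_product d w z y) - \<delta>)"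

end

(* On a convex domain the Kobayashi metric is bounded below by comparing a disc with a supporting
   half-space (Schwarz lemma). This gives |v| <= 2 delta(z;v) K(z;v), and d_K(x,y) >= 1/2 |log(delta(x)/delta(y))|.
   Conversely, a Dini-smooth convex domain contains, near each boundary point p and for each small
   eps, a ball of radius eps/eta that passes p at distance eps*eta, where eta = eta(eps) is summable over
   dyadic eps; moving along the normals up to height |x-y| and then across gives
   sqrt(delta(x) delta(y)) exp(d_K(x,y)) <= C|x-y| for points whose mutual distance is not small compared
   with their distance to the boundary.

   If t -> g(t) is a geodesic from x to y, the lower bound for d_K shows that delta(g(t)) is at most
   delta(x) exp(2t) and delta(y) exp(2(d_K(x,y)-t)). These bounds cross at the height
   sqrt(delta(x) delta(y)) exp(d_K(x,y)) <= C|x-y|, so that delta(g(t)) decays exponentially on both sides of the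
   crossing parameter, and m-convexity bounds the Euclidean speed by a multiple of delta(g(t))^(1/m), whose
   integral is at most C|x-y|^(1/m). For a quasi-geodesic in a Gromov hyperbolic domain the same argument
   applies, because the Morse lemma makes d_K additive along it up to a bounded error. *)

theory Submission
  imports Defs "HOL-Complex_Analysis.Riemann_Mapping"
begin

section \<open>Discs, the Kobayashi metric and path lengths\<close>

text \<open>The upper and lower bounds for the distance must have the same coefficient 1/2 in front
  of the logarithm, because they are exponentiated: a larger coefficient in the upper bound would
  leave negative powers of the boundary distances in the crossing height. This is what the Dini
  condition provides. Crossing one dyadic scale costs (log 2)/2 plus an error of the size of eta at
  that scale, and summability keeps the total error bounded. It also explains why the balls must be
  much larger than eps: in a ball whose radius is comparable to the depth, the far side contributes
  as much to the metric as the near side, and the coefficient exceeds 1/2.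

  Pairs that are close compared with their depth are a separate case, since the crossing height is
  then no longer bounded by a multiple of |x-y|.

  Curves come without a derivative. Their Euclidean length is bounded by comparing increments over
  parameter steps of at most 1 with increments of an explicit increasing function, which is logistic
  where the depth decays on both sides.\<close>

definition kobayashi_disc ::
  "(complex^'n) set \<Rightarrow> complex^'n \<Rightarrow> complex^'n \<Rightarrow> complex \<Rightarrow> (complex \<Rightarrow> complex^'n) \<Rightarrow> bool" where
  "kobayashi_disc \<Omega> x v \<xi> f \<longleftrightarrow>
     (\<forall>i. (\<lambda>z. f z $ i) holomorphic_on ball 0 1) \<and> f ` ball 0 1 \<subseteq> \<Omega> \<and> f 0 = x \<and>
     (\<forall>i. deriv (\<lambda>z. f z $ i) 0 * \<xi> = v $ i)"

lemma kobayashi_metric_alt: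
  "kobayashi_metric \<Omega> x v = Inf {cmod \<xi> | \<xi>. \<exists>f. kobayashi_disc \<Omega> x v \<xi> f}"
  by (simp add: kobayashi_metric_def kobayashi_disc_def)

lemma kobayashi_metric_le: "kobayashi_disc \<Omega> x v \<xi> f \<Longrightarrow> kobayashi_metric \<Omega> x v \<le> cmod \<xi>"
  unfolding kobayashi_metric_alt by (rule cInf_lower) (auto intro: bdd_belowI[of _ 0])

lemma kobayashi_discI:
  assumes "\<And>i. (\<lambda>z. f z $ i) holomorphic_on ball 0 1" "f ` ball 0 1 \<subseteq> \<Omega>" "f 0 = x"
    and "\<And>i. ((\<lambda>z. f z $ i) has_field_derivative D i) (at 0)" "\<And>i. D i * \<xi> = v $ i"
  shows "kobayashi_disc \<Omega> x v \<xi> f"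
  using assms by (simp add: kobayashi_disc_def DERIV_imp_deriv[OF assms(4)])

lemma kobayashi_disc_has_derivative:
  assumes "kobayashi_disc \<Omega> x v \<xi> f"
  shows "((\<lambda>z. f z $ i) has_field_derivative deriv (\<lambda>z. f z $ i) 0) (at 0)"
  using assms by (intro holomorphic_derivI[where S = "ball 0 1"]) (auto simp: kobayashi_disc_def)

lemma vec_scaleR_of_real: "(r *\<^sub>R v) $ i = of_real r * v $ i" for v :: "complex^'n"
  by (simp add: scaleR_conv_of_real[of r "v $ i"])

lemma norm_smult: "norm (c *s v) = cmod c * norm v" for v :: "complex^'n"
  by (simp add: norm_vec_def L2_set_def norm_mult power_mult_distrib real_sqrt_mult
      flip: sum_distrib_left)

lemma kobayashi_disc_ball:
  assumes "ball x r \<subseteq> \<Omega>" "0 < r" "v \<noteq> 0"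
  shows "\<exists>f. kobayashi_disc \<Omega> x v (of_real (norm v / r)) f"
proof (intro exI kobayashi_discI)
  let ?f = "\<lambda>z. x + (z * of_real (r / norm v)) *s v"
  show "?f ` ball 0 1 \<subseteq> \<Omega>"
    by (intro image_subsetI subsetD[OF assms(1)])
      (use assms(2,3) in \<open>auto simp: dist_norm norm_smult norm_mult norm_divide\<close>)
  show "((\<lambda>z. ?f z $ i) has_field_derivative of_real (r / norm v) * v $ i) (at 0)" for i
    using assms(3) by (auto intro!: derivative_eq_intros)
  show "complex_of_real (r / norm v) * v $ i * complex_of_real (norm v / r) = v $ i" for i
    using assms by simp
qed (auto intro!: holomorphic_intros)

lemma kobayashi_metric_le_ball:
  assumes "ball x r \<subseteq> \<Omega>" "0 < r" "v \<noteq> 0"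
  shows "kobayashi_metric \<Omega> x v \<le> norm v / r"
  using kobayashi_disc_ball[OF assms] kobayashi_metric_le assms(2)
  by (metis norm_of_real abs_of_nonneg divide_nonneg_pos norm_ge_zero)

lemma kobayashi_disc_const: "x \<in> \<Omega> \<Longrightarrow> kobayashi_disc \<Omega> x 0 0 (\<lambda>_. x)"
  by (auto simp: kobayashi_disc_def)

text \<open>An affine disc in a small ball, or a constant one for \<open>v = 0\<close>, keeps the
  infimum defining the metric off the empty set, where \<open>Inf\<close> on the reals is
  unspecified.\<close>

lemma kobayashi_disc_exists:
  assumes "open \<Omega>" "x \<in> \<Omega>"
  shows "\<exists>\<xi> f. kobayashi_disc \<Omega> x v \<xi> f"
proof (cases "v = 0")
  case True
  then show ?thesis using kobayashi_disc_const assms by blast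
next
  case False
  obtain r where "r > 0" "ball x r \<subseteq> \<Omega>"
    using assms openE by blast
  then show ?thesis using kobayashi_disc_ball False by blast
qed

lemma kobayashi_metric_ge:
  assumes "open \<Omega>" "x \<in> \<Omega>" "\<And>\<xi> f. kobayashi_disc \<Omega> x v \<xi> f \<Longrightarrow> B \<le> cmod \<xi>"
  shows "B \<le> kobayashi_metric \<Omega> x v"
  unfolding kobayashi_metric_alt
  using kobayashi_disc_exists[OF assms(1,2)] assms(3) by (intro cInf_greatest) blast+

lemma kobayashi_metric_nonneg: "open \<Omega> \<Longrightarrow> x \<in> \<Omega> \<Longrightarrow> 0 \<le> kobayashi_metric \<Omega> x v"
  by (rule kobayashi_metric_ge) auto

lemma kobayashi_disc_scale:
  "kobayashi_disc \<Omega> x v \<xi> f \<Longrightarrow> kobayashi_disc \<Omega> x (r *\<^sub>R v) (of_real r * \<xi>) f"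
  unfolding kobayashi_disc_def vec_scaleR_of_real mult.left_commute[of _ "of_real r"] by simp

lemma kobayashi_metric_scale_le:
  assumes "open \<Omega>" "x \<in> \<Omega>"
  shows "kobayashi_metric \<Omega> x (r *\<^sub>R v) \<le> \<bar>r\<bar> * kobayashi_metric \<Omega> x v"
proof (cases "r = 0")
  case True
  then show ?thesis using kobayashi_metric_le[OF kobayashi_disc_const] assms by fastforce
next
  case False
  have "kobayashi_metric \<Omega> x (r *\<^sub>R v) / \<bar>r\<bar> \<le> kobayashi_metric \<Omega> x v"
  proof (rule kobayashi_metric_ge[OF assms])
    fix \<xi> f assume "kobayashi_disc \<Omega> x v \<xi> f"
    from kobayashi_metric_le[OF kobayashi_disc_scale[OF this, of r]]
    show "kobayashi_metric \<Omega> x (r *\<^sub>R v) / \<bar>r\<bar> \<le> cmod \<xi>"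
      using False by (simp add: norm_mult field_simps)
  qed
  then show ?thesis using False by (simp add: field_simps)
qed

lemma kobayashi_metric_scale:
  assumes "open \<Omega>" "x \<in> \<Omega>"
  shows "kobayashi_metric \<Omega> x (r *\<^sub>R v) = \<bar>r\<bar> * kobayashi_metric \<Omega> x v"
proof (cases "r = 0")
  case True
  then show ?thesis
    using kobayashi_metric_scale_le[OF assms, of 0 v] kobayashi_metric_nonneg[OF assms, of 0] by simp
next
  case False
  have "kobayashi_metric \<Omega> x v \<le> \<bar>1 / r\<bar> * kobayashi_metric \<Omega> x (r *\<^sub>R v)"
    using kobayashi_metric_scale_le[OF assms, of "1 / r" "r *\<^sub>R v"] False by simp
  then show ?thesis
    using kobayashi_metric_scale_le[OF assms, of r v] False by (simp add: field_simps)
qed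

text \<open>Contracting a disc towards a point \<open>w\<close> of a convex set and choosing \<open>w\<close> so that the centre
  moves from \<open>x\<close> to \<open>y\<close>.\<close>

lemma kobayashi_metric_shift:
  assumes "open \<Omega>" "convex \<Omega>" "ball x r \<subseteq> \<Omega>" "x \<in> \<Omega>" "dist x y < \<eta> * r" "0 < \<eta>" "\<eta> < 1"
  shows "(1 - \<eta>) * kobayashi_metric \<Omega> y v \<le> kobayashi_metric \<Omega> x v"
proof (rule kobayashi_metric_ge[OF assms(1) \<open>x \<in> \<Omega>\<close>])
  fix \<xi> f assume f: "kobayashi_disc \<Omega> x v \<xi> f"
  define w where "w = x + (1 / \<eta>) *\<^sub>R (y - x)"
  have "dist x w = dist x y / \<eta>"
    using \<open>0 < \<eta>\<close> by (simp add: w_def dist_norm norm_minus_commute)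
  then have w: "w \<in> \<Omega>"
    using assms(5,6) by (intro subsetD[OF assms(3)]) (simp add: pos_divide_less_eq mult.commute)
  let ?g = "\<lambda>z. (1 - \<eta>) *\<^sub>R f z + \<eta> *\<^sub>R w"
  have "kobayashi_disc \<Omega> y v (\<xi> / of_real (1 - \<eta>)) ?g"
  proof (rule kobayashi_discI)
    show "?g 0 = y"
      using f \<open>0 < \<eta>\<close> by (simp add: kobayashi_disc_def w_def algebra_simps)
    show "?g ` ball 0 1 \<subseteq> \<Omega>"
      using f w assms by (auto simp: kobayashi_disc_def image_subset_iff intro!: convexD)
    show "(\<lambda>z. ?g z $ i) holomorphic_on ball 0 1" for i
      unfolding vector_add_component vec_scaleR_of_real using f
      by (auto simp: kobayashi_disc_def intro!: holomorphic_intros)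
    show "((\<lambda>z. ?g z $ i) has_field_derivative of_real (1 - \<eta>) * deriv (\<lambda>z. f z $ i) 0) (at 0)" for i
      unfolding vector_add_component vec_scaleR_of_real using kobayashi_disc_has_derivative[OF f, of i]
      by (auto intro!: derivative_eq_intros)
    show "of_real (1 - \<eta>) * deriv (\<lambda>z. f z $ i) 0 * (\<xi> / of_real (1 - \<eta>)) = v $ i" for i
    proof -
      have "complex_of_real (1 - \<eta>) \<noteq> 0" using \<open>\<eta> < 1\<close> by (simp only: of_real_eq_0_iff)
      moreover have "deriv (\<lambda>z. f z $ i) 0 * \<xi> = v $ i" using f by (simp add: kobayashi_disc_def)
      ultimately show ?thesis by (simp add: mult.assoc del: of_real_diff)
    qed
  qed
  from kobayashi_metric_le[OF this] show "(1 - \<eta>) * kobayashi_metric \<Omega> y v \<le> cmod \<xi>"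
    using \<open>\<eta> < 1\<close> by (simp add: norm_divide field_simps del: of_real_diff)
qed

text \<open>\<open>kobayashi_metric_shift\<close> works in both directions between nearby points and
  costs only a factor \<open>1 - \<eta>\<close>. Continuity is what makes the speed along a segment
  integrable.\<close>

lemma continuous_on_kobayashi_metric:
  assumes "open \<Omega>" "convex \<Omega>"
  shows "continuous_on \<Omega> (\<lambda>x. kobayashi_metric \<Omega> x v)"
  unfolding continuous_on_iff
proof (intro ballI allI impI)
  fix x and e :: real assume x: "x \<in> \<Omega>" and e: "0 < e"
  obtain r where r: "0 < r" "ball x r \<subseteq> \<Omega>"
    using assms x openE by blast
  define k where "k = kobayashi_metric \<Omega> x v"
  have k: "0 \<le> k" using kobayashi_metric_nonneg assms x by (auto simp: k_def)
  \<comment> \<open>For \<open>\<eta> \<le> 1/2\<close> the value at the nearby point is at most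
    \<open>2 * k\<close>, so the two values differ by at most \<open>2 * \<eta> * k\<close>.\<close>
  define \<eta> where "\<eta> = min (1/2) (e / (4 * (k + 1)))"
  have \<eta>: "0 < \<eta>" "\<eta> \<le> 1/2" "\<eta> \<le> e / (4 * (k + 1))"
    unfolding \<eta>_def by (use k e in simp, rule min.cobounded1, rule min.cobounded2)
  have \<eta>k: "2 * \<eta> * k < e"
  proof -
    have "2 * \<eta> * k \<le> 2 * (e / (4 * (k + 1))) * k"
      using \<eta> k by (intro mult_mono) auto
    also have "\<dots> < e" using k e by (simp add: field_simps add_pos_nonneg)
    finally show ?thesis .
  qed
  show "\<exists>d>0. \<forall>x'\<in>\<Omega>. dist x' x < d \<longrightarrow> dist (kobayashi_metric \<Omega> x' v) (kobayashi_metric \<Omega> x v) < e"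
  proof (intro exI conjI ballI impI)
    \<comment> \<open>Halving the radius keeps a ball about the nearby point inside
      \<open>\<Omega>\<close>, so that the two points can exchange roles.\<close>
    show "0 < \<eta> * (r / 2)" using \<eta> r by simp
    fix y assume y: "y \<in> \<Omega>" "dist y x < \<eta> * (r / 2)"
    have "\<eta> * (r / 2) \<le> 1/2 * (r / 2)" using \<eta> r by (intro mult_right_mono) auto
    then have dy: "dist y x < r / 2" using y r by linarith
    have "ball y (r / 2) \<subseteq> ball x r"
      using dy by (simp add: ball_subset_ball_iff)
    then have "ball y (r / 2) \<subseteq> \<Omega>" using r by blast
    then have 1: "(1 - \<eta>) * k \<le> kobayashi_metric \<Omega> y v"
      using kobayashi_metric_shift[OF assms, of y "r/2" x \<eta> v] y \<eta> by (auto simp: k_def)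
    have "\<eta> * (r/2) < \<eta> * r" using \<eta> r by simp
    then have "dist x y < \<eta> * r" using y(2) by (simp only: dist_commute)
    then have 2: "(1 - \<eta>) * kobayashi_metric \<Omega> y v \<le> k"
      using kobayashi_metric_shift[OF assms, of x r y \<eta> v] x y r \<eta> by (auto simp: k_def dist_commute)
    have "1/2 * kobayashi_metric \<Omega> y v \<le> (1 - \<eta>) * kobayashi_metric \<Omega> y v"
      using \<eta> kobayashi_metric_nonneg[OF assms(1) y(1)] by (intro mult_right_mono) auto
    then have "kobayashi_metric \<Omega> y v \<le> 2 * k" using 2 by linarith
    then have "\<eta> * kobayashi_metric \<Omega> y v \<le> \<eta> * (2 * k)"
      using \<eta> by (intro mult_left_mono) auto
    moreover have "kobayashi_metric \<Omega> y v - k \<le> \<eta> * kobayashi_metric \<Omega> y v" "k - kobayashi_metric \<Omega> y v \<le> \<eta> * k"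
      using 1 2 by (auto simp: algebra_simps)
    moreover have "\<eta> * k \<le> 2 * \<eta> * k" using \<eta> k by simp
    ultimately show "dist (kobayashi_metric \<Omega> y v) (kobayashi_metric \<Omega> x v) < e"
      using \<eta>k unfolding dist_real_def k_def[symmetric] by linarith
  qed
qed

section \<open>Kobayashi length of piecewise differentiable paths\<close>

definition kobayashi_speed :: "(complex^'n) set \<Rightarrow> (real \<Rightarrow> complex^'n) \<Rightarrow> real \<Rightarrow> real" where
  "kobayashi_speed \<Omega> \<gamma> t = kobayashi_metric \<Omega> (\<gamma> t) (vector_derivative \<gamma> (at t))"

definition has_kobayashi_length :: "(complex^'n) set \<Rightarrow> (real \<Rightarrow> complex^'n) \<Rightarrow> real \<Rightarrow> bool" where
  "has_kobayashi_length \<Omega> \<gamma> l \<longleftrightarrow>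
     valid_path \<gamma> \<and> path_image \<gamma> \<subseteq> \<Omega> \<and> (kobayashi_speed \<Omega> \<gamma> has_integral l) {0..1}"

lemma kobayashi_dist_alt:
  "kobayashi_dist \<Omega> x y = Inf {l. \<exists>\<gamma>. has_kobayashi_length \<Omega> \<gamma> l \<and> pathstart \<gamma> = x \<and> pathfinish \<gamma> = y}"
  unfolding kobayashi_dist_def has_kobayashi_length_def kobayashi_speed_def
  by (rule arg_cong[where f = Inf]) blast

lemma kobayashi_speed_nonneg:
  "open \<Omega> \<Longrightarrow> path_image \<gamma> \<subseteq> \<Omega> \<Longrightarrow> t \<in> {0..1} \<Longrightarrow> 0 \<le> kobayashi_speed \<Omega> \<gamma> t"
  unfolding kobayashi_speed_def by (rule kobayashi_metric_nonneg) (auto simp: path_image_def)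

lemma kobayashi_length_nonneg: "open \<Omega> \<Longrightarrow> has_kobayashi_length \<Omega> \<gamma> l \<Longrightarrow> 0 \<le> l"
  unfolding has_kobayashi_length_def
  using has_integral_nonneg[of "kobayashi_speed \<Omega> \<gamma>" l "{0..1}"] kobayashi_speed_nonneg by blast

lemma kobayashi_dist_le:
  assumes "open \<Omega>" "has_kobayashi_length \<Omega> \<gamma> l"
  shows "kobayashi_dist \<Omega> (pathstart \<gamma>) (pathfinish \<gamma>) \<le> l"
  unfolding kobayashi_dist_alt
  by (rule cInf_lower) (use assms kobayashi_length_nonneg in \<open>auto intro!: bdd_belowI[of _ 0]\<close>)

lemma valid_path_differentiable:
  assumes "valid_path \<gamma>"
  obtains S where "finite S" "\<And>t. t \<in> {0..1} - S \<Longrightarrow> \<gamma> differentiable at t"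
  using assms by (auto simp: valid_path_def piecewise_C1_differentiable_on_def C1_differentiable_on_eq)

lemma kobayashi_speed_affine:
  assumes "open \<Omega>" "\<gamma> (m * t + c) \<in> \<Omega>" "\<gamma> differentiable at (m * t + c)"
  shows "kobayashi_speed \<Omega> (\<lambda>t. \<gamma> (m * t + c)) t = \<bar>m\<bar> * kobayashi_speed \<Omega> \<gamma> (m * t + c)"
proof -
  have "((\<lambda>t. m * t + c) has_vector_derivative m) (at t)"
    by (auto intro!: derivative_eq_intros simp: has_vector_derivative_def)
  moreover have "(\<gamma> has_vector_derivative vector_derivative \<gamma> (at (m * t + c))) (at (m * t + c))"
    using assms by (simp add: vector_derivative_works)
  ultimately have "((\<lambda>t. \<gamma> (m * t + c)) has_vector_derivative m *\<^sub>R vector_derivative \<gamma> (at (m * t + c))) (at t)"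
    by (intro vector_diff_chain_at [simplified o_def])
  then show ?thesis
    using assms by (simp add: kobayashi_speed_def vector_derivative_at kobayashi_metric_scale)
qed

text \<open>The single change of variables behind reversal, restriction and concatenation of paths.
  The parameters that map into \<open>S\<close>, where the chain rule may fail, are finitely many
  and negligible for the integral.\<close>

lemma has_integral_kobayashi_speed_affine:
  assumes "open \<Omega>" "finite S" "\<And>t. t \<in> {u..v} - S \<Longrightarrow> \<gamma> differentiable at t"
    and "(kobayashi_speed \<Omega> \<gamma> has_integral l) {u..v}" "\<gamma> ` {u..v} \<subseteq> \<Omega>" "m \<noteq> 0" "u \<le> v"
  shows "(kobayashi_speed \<Omega> (\<lambda>t. \<gamma> (m * t + c)) has_integral l) ((\<lambda>x. (x - c) / m) ` {u..v})"
proof (rule has_integral_spike_finite)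
  let ?S = "(\<lambda>x. (x - c) / m) ` S"
  show "finite ?S" using assms by simp
  have im: "(\<lambda>x. (1 / m) *\<^sub>R x + - ((1 / m) *\<^sub>R c)) = (\<lambda>x. (x - c) / m)"
    using assms by (auto simp: field_simps)
  have "((\<lambda>t. kobayashi_speed \<Omega> \<gamma> (m * t + c)) has_integral l / \<bar>m\<bar>) ((\<lambda>x. (x - c) / m) ` {u..v})"
    using has_integral_affinity[of "kobayashi_speed \<Omega> \<gamma>" l u v m c] assms(4,6)
    unfolding im by simp
  from has_integral_mult_right[OF this, of "\<bar>m\<bar>"]
  show "((\<lambda>t. \<bar>m\<bar> * kobayashi_speed \<Omega> \<gamma> (m * t + c)) has_integral l) ((\<lambda>x. (x - c) / m) ` {u..v})"
    using assms by simp
  fix t assume t: "t \<in> (\<lambda>x. (x - c) / m) ` {u..v} - ?S"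
  then obtain x where x: "x \<in> {u..v}" "t = (x - c) / m" by blast
  then have "m * t + c = x" using assms by simp
  moreover have "x \<notin> S" using t x by blast
  ultimately show "kobayashi_speed \<Omega> (\<lambda>t. \<gamma> (m * t + c)) t = \<bar>m\<bar> * kobayashi_speed \<Omega> \<gamma> (m * t + c)"
    using assms x by (intro kobayashi_speed_affine) auto
qed

lemma kobayashi_speed_cong:
  assumes "\<forall>\<^sub>F s in nhds t. \<gamma> s = \<gamma>' s"
  shows "kobayashi_speed \<Omega> \<gamma> t = kobayashi_speed \<Omega> \<gamma>' t"
proof -
  have "vector_derivative \<gamma> (at t) = vector_derivative \<gamma>' (at t)"
    by (rule vector_derivative_cong_eq) (use assms in auto)
  then show ?thesis
    using eventually_nhds_x_imp_x[OF assms] by (simp add: kobayashi_speed_def)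
qed

lemma has_kobayashi_length_reversepath:
  assumes "open \<Omega>" "has_kobayashi_length \<Omega> \<gamma> l"
  shows "has_kobayashi_length \<Omega> (reversepath \<gamma>) l"
proof -
  obtain S where S: "finite S" "\<And>t. t \<in> {0..1} - S \<Longrightarrow> \<gamma> differentiable at t"
    using assms valid_path_differentiable unfolding has_kobayashi_length_def by metis
  have r: "reversepath \<gamma> = (\<lambda>t. \<gamma> (-1 * t + 1))" by (auto simp: reversepath_def)
  have "(\<lambda>x::real. (x - 1) / -1) ` {0..1} = {0..1}"
    using image_affinity_atLeastAtMost[of "-1" 1 0 "1::real"] by simp
  with has_integral_kobayashi_speed_affine[OF assms(1) S, where u = 0 and v = 1 and l = l and m = "-1" and c = 1] assms(2)
  have "(kobayashi_speed \<Omega> (reversepath \<gamma>) has_integral l) {0..1}"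
    unfolding r by (simp add: has_kobayashi_length_def path_image_def)
  then show ?thesis
    using assms(2) by (simp add: has_kobayashi_length_def valid_path_imp_reverse)
qed

lemma has_kobayashi_length_subpath:
  assumes "open \<Omega>" "has_kobayashi_length \<Omega> \<gamma> L" "(kobayashi_speed \<Omega> \<gamma> has_integral l) {u..v}"
    and "u < v" "0 \<le> u" "v \<le> 1"
  shows "has_kobayashi_length \<Omega> (subpath u v \<gamma>) l"
proof -
  obtain S where S: "finite S" "\<And>t. t \<in> {0..1} - S \<Longrightarrow> \<gamma> differentiable at t"
    using assms valid_path_differentiable unfolding has_kobayashi_length_def by metis
  have "\<gamma> ` {u..v} \<subseteq> \<Omega>"
    using assms(2,4-) by (force simp: has_kobayashi_length_def path_image_def)
  moreover have "(\<lambda>x. (x - u) / (v - u)) ` {u..v} = {0..1}"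
    using image_affinity_atLeastAtMost_div_diff[of "v - u" "u / (v - u)" u v] \<open>u < v\<close>
    by (simp flip: diff_divide_distrib)
  ultimately have "(kobayashi_speed \<Omega> (subpath u v \<gamma>) has_integral l) {0..1}"
    using has_integral_kobayashi_speed_affine[OF assms(1) S(1) _ assms(3), where m = "v - u" and c = u] S(2) assms(4-)
    unfolding subpath_def by simp
  moreover have "path_image (subpath u v \<gamma>) \<subseteq> \<Omega>"
    using \<open>\<gamma> ` {u..v} \<subseteq> \<Omega>\<close> assms(4) by (simp add: path_image_subpath)
  ultimately show ?thesis
    using assms unfolding has_kobayashi_length_def by (auto intro: valid_path_subpath)
qed

lemma has_kobayashi_length_join:
  assumes "open \<Omega>" "has_kobayashi_length \<Omega> \<gamma>1 l1" "has_kobayashi_length \<Omega> \<gamma>2 l2"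
    and "pathfinish \<gamma>1 = pathstart \<gamma>2"
  shows "has_kobayashi_length \<Omega> (\<gamma>1 +++ \<gamma>2) (l1 + l2)"
proof -
  note D = assms(2,3)[unfolded has_kobayashi_length_def]
  obtain S1 where S1: "finite S1" "\<And>t. t \<in> {0..1} - S1 \<Longrightarrow> \<gamma>1 differentiable at t"
    using D valid_path_differentiable by metis
  obtain S2 where S2: "finite S2" "\<And>t. t \<in> {0..1} - S2 \<Longrightarrow> \<gamma>2 differentiable at t"
    using D valid_path_differentiable by metis
  have i1: "(\<lambda>x::real. (x - 0) / 2) ` {0..1} = {0..1/2}"
    by (simp add: image_divide_atLeastAtMost)
  have i2: "(\<lambda>x::real. (x - (-1)) / 2) ` {0..1} = {1/2..1}"
    using image_affinity_atLeastAtMost_div[of 2 "1/2" 0 "1::real"] by (auto simp: add_divide_distrib)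
  have 1: "(kobayashi_speed \<Omega> (\<lambda>t. \<gamma>1 (2 * t + 0)) has_integral l1) {0..1/2}"
    using has_integral_kobayashi_speed_affine[OF assms(1) S1, where u = 0 and v = 1 and l = l1 and m = 2 and c = 0] D unfolding i1
    by (simp add: path_image_def)
  have 2: "(kobayashi_speed \<Omega> (\<lambda>t. \<gamma>2 (2 * t + (-1))) has_integral l2) {1/2..1}"
    using has_integral_kobayashi_speed_affine[OF assms(1) S2, where u = 0 and v = 1 and l = l2 and m = 2 and c = "-1"] D unfolding i2
    by (simp add: path_image_def)
  have "(kobayashi_speed \<Omega> (\<gamma>1 +++ \<gamma>2) has_integral l1) {0..1/2}"
  \<comment> \<open>Speeds agree only where the paths agree on a neighbourhood, so the junction
    parameter 1/2 is dropped.\<close>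
  proof (rule has_integral_spike_finite[OF _ _ 1])
    fix t :: real assume "t \<in> {0..1/2} - {1/2}"
    then have t: "t < 1/2" by auto
    show "kobayashi_speed \<Omega> (\<gamma>1 +++ \<gamma>2) t = kobayashi_speed \<Omega> (\<lambda>t. \<gamma>1 (2 * t + 0)) t"
      by (rule kobayashi_speed_cong, rule eventually_mono[OF eventually_nhds_in_open[of "{..<1/2}"]])
         (use t in \<open>auto simp: joinpaths_def\<close>)
  qed auto
  moreover have "(kobayashi_speed \<Omega> (\<gamma>1 +++ \<gamma>2) has_integral l2) {1/2..1}"
  proof (rule has_integral_spike_finite[OF _ _ 2])
    fix t :: real assume "t \<in> {1/2..1} - {1/2}"
    then have t: "t > 1/2" by auto
    show "kobayashi_speed \<Omega> (\<gamma>1 +++ \<gamma>2) t = kobayashi_speed \<Omega> (\<lambda>t. \<gamma>2 (2 * t + (-1))) t"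
      by (rule kobayashi_speed_cong, rule eventually_mono[OF eventually_nhds_in_open[of "{1/2<..}"]])
         (use t in \<open>auto simp: joinpaths_def\<close>)
  qed auto
  ultimately have "(kobayashi_speed \<Omega> (\<gamma>1 +++ \<gamma>2) has_integral (l1 + l2)) {0..1}"
    by (rule has_integral_combine[rotated 2]) auto
  then show ?thesis
    using D assms(4) path_image_join_subset[of \<gamma>1 \<gamma>2] unfolding has_kobayashi_length_def
    by (auto intro: valid_path_join)
qed

section \<open>Comparison with supporting half-spaces\<close>

text \<open>Complex linear in \<open>v\<close>, so that it preserves holomorphy of discs, while its
  real part is the inner product that describes half-spaces.\<close>

definition cinner :: "complex^'n \<Rightarrow> complex^'n \<Rightarrow> complex" where
  "cinner v w = (\<Sum>i\<in>UNIV. v $ i * cnj (w $ i))"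

lemma Re_cinner: "Re (cinner v w) = v \<bullet> w"
  by (simp add: cinner_def inner_vec_def inner_complex_def)

lemma cinner_scale: "cinner (c *s v) w = c * cinner v w"
  by (simp add: cinner_def sum_distrib_left mult.assoc)

text \<open>The Schwarz lemma after the Cayley transform that carries the right half-plane to the
  disc and \<open>g 0\<close> to 0.\<close>

lemma norm_deriv_le_Re:
  assumes g: "g holomorphic_on ball 0 1" and pos: "\<And>z. z \<in> ball 0 1 \<Longrightarrow> 0 < Re (g z)"
  shows "cmod (deriv g 0) \<le> 2 * Re (g 0)"
proof -
  define a where "a = g 0"
  have a: "0 < Re a" using pos[of 0] by (simp add: a_def)
  define h where "h = (\<lambda>z. (g z - a) / (g z + cnj a))"
  have nz: "g z + cnj a \<noteq> 0" if "z \<in> ball 0 1" for z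
    using pos[OF that] a by (auto simp: complex_eq_iff)
  have "h holomorphic_on ball 0 1"
    unfolding h_def using nz g by (auto intro!: holomorphic_intros)
  moreover have "h 0 = 0" by (simp add: h_def a_def)
  moreover have "cmod (h z) < 1" if "cmod z < 1" for z
  proof -
    have z: "z \<in> ball 0 1" using that by simp
    have "(cmod (g z - a))\<^sup>2 < (cmod (g z + cnj a))\<^sup>2"
      unfolding cmod_power2 using mult_pos_pos[OF pos[OF z] a] by (simp add: power2_eq_square algebra_simps)
    then have "cmod (g z - a) < cmod (g z + cnj a)"
      using power_less_imp_less_base by force
    then show ?thesis using nz[OF z] by (simp add: h_def norm_divide)
  qed
  ultimately have "cmod (deriv h 0) \<le> 1"
    using Schwarz_Lemma(2)[of h 0] by auto
  moreover have "(g has_field_derivative deriv g 0) (at 0)"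
    using g by (intro holomorphic_derivI[where S = "ball 0 1"]) auto
  then have "(h has_field_derivative deriv g 0 / (a + cnj a)) (at 0)"
    unfolding h_def using nz[of 0]
    by (auto intro!: derivative_eq_intros simp: a_def)
  then have "deriv h 0 = deriv g 0 / (a + cnj a)"
    by (rule DERIV_imp_deriv)
  moreover have "cmod (a + cnj a) = 2 * Re a"
    using a by (simp add: complex_add_cnj)
  ultimately show ?thesis
    using a by (simp add: norm_divide a_def)
qed

text \<open>For a disc \<open>f\<close> the function \<open>cinner (p - f w) \<nu>\<close> maps into
  the right half-plane and has real part \<open>(p - z) \<bullet> \<nu>\<close> at 0, so
  \<open>norm_deriv_le_Re\<close> limits its derivative.\<close>

lemma kobayashi_metric_ge_halfspace:
  assumes "open \<Omega>" "z \<in> \<Omega>" and supp: "\<And>w. w \<in> \<Omega> \<Longrightarrow> (w - p) \<bullet> \<nu> < 0"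
  shows "cmod (cinner v \<nu>) \<le> 2 * ((p - z) \<bullet> \<nu>) * kobayashi_metric \<Omega> z v"
proof -
  have u: "0 < (p - z) \<bullet> \<nu>" using supp[OF assms(2)] by (simp add: inner_diff_left)
  have "cmod (cinner v \<nu>) / (2 * ((p - z) \<bullet> \<nu>)) \<le> kobayashi_metric \<Omega> z v"
  proof (rule kobayashi_metric_ge[OF assms(1,2)])
    fix \<xi> f assume f: "kobayashi_disc \<Omega> z v \<xi> f"
    define g where "g = (\<lambda>w. cinner (p - f w) \<nu>)"
    have g: "g holomorphic_on ball 0 1"
      using f unfolding g_def cinner_def kobayashi_disc_def
      by (auto intro!: holomorphic_intros)
    have "0 < Re (g w)" if "w \<in> ball 0 1" for w
    proof -
      have "f w \<in> \<Omega>" using f that by (auto simp: kobayashi_disc_def)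
      from supp[OF this] show ?thesis by (simp add: g_def Re_cinner inner_diff_left)
    qed
    from norm_deriv_le_Re[OF g this] have le: "cmod (deriv g 0) \<le> 2 * ((p - z) \<bullet> \<nu>)"
      using f by (simp add: g_def Re_cinner kobayashi_disc_def)
    have "(g has_field_derivative (\<Sum>i\<in>UNIV. - deriv (\<lambda>z. f z $ i) 0 * cnj (\<nu> $ i))) (at 0)"
      unfolding g_def cinner_def using kobayashi_disc_has_derivative[OF f]
      by (auto intro!: derivative_eq_intros)
    then have "deriv g 0 = (\<Sum>i\<in>UNIV. - deriv (\<lambda>z. f z $ i) 0 * cnj (\<nu> $ i))"
      by (rule DERIV_imp_deriv)
    then have "deriv g 0 * \<xi> = - (\<Sum>i\<in>UNIV. (deriv (\<lambda>z. f z $ i) 0 * \<xi>) * cnj (\<nu> $ i))"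
      by (simp add: sum_distrib_left sum_negf mult_ac)
    also have "\<dots> = - cinner v \<nu>"
      using f by (simp add: cinner_def kobayashi_disc_def)
    finally have "cmod (cinner v \<nu>) = cmod (deriv g 0) * cmod \<xi>"
      by (metis norm_minus_cancel norm_mult)
    also have "\<dots> \<le> 2 * ((p - z) \<bullet> \<nu>) * cmod \<xi>"
      using le by (rule mult_right_mono) simp
    finally show "cmod (cinner v \<nu>) / (2 * ((p - z) \<bullet> \<nu>)) \<le> cmod \<xi>"
      using u by (simp add: field_simps)
  qed
  then show ?thesis using u by (simp add: field_simps)
qed

lemma kobayashi_speed_linepath:
  "kobayashi_speed \<Omega> (linepath a b) t = kobayashi_metric \<Omega> (linepath a b t) (b - a)"
  by (simp add: kobayashi_speed_def)

lemma has_kobayashi_length_norm_le: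
  assumes "open \<Omega>" "has_kobayashi_length \<Omega> \<gamma> l"
    and M: "\<And>t v. t \<in> {0..1} \<Longrightarrow> norm v \<le> M * kobayashi_metric \<Omega> (\<gamma> t) v"
  shows "dist (pathstart \<gamma>) (pathfinish \<gamma>) \<le> M * l"
proof -
  note D = assms(2)[unfolded has_kobayashi_length_def]
  obtain S where S: "finite S" "\<And>t. t \<in> {0..1} - S \<Longrightarrow> \<gamma> differentiable at t"
    using D valid_path_differentiable by metis
  define f where "f = (\<lambda>t. if t \<in> S then 0 else vector_derivative \<gamma> (at t))"
  have "(f has_integral (\<gamma> 1 - \<gamma> 0)) {0..1}"
  proof (rule fundamental_theorem_of_calculus_interior_strong[OF S(1)])
    show "continuous_on {0..1} \<gamma>"
      using D valid_path_imp_path unfolding path_def by blast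
  qed (use S(2) in \<open>auto simp: f_def vector_derivative_works\<close>)
  moreover have l: "((\<lambda>t. M * kobayashi_speed \<Omega> \<gamma> t) has_integral (M * l)) {0..1}"
    using D by (intro has_integral_mult_right) simp
  moreover have "norm (f t) \<le> M * kobayashi_speed \<Omega> \<gamma> t" if "t \<in> {0..1}" for t
    using order.trans[OF norm_ge_zero M[OF that]] M[OF that]
    by (auto simp: f_def kobayashi_speed_def)
  ultimately have "norm (\<gamma> 1 - \<gamma> 0) \<le> M * l"
    using integral_norm_bound_integral[of f "{0..1}" "\<lambda>t. M * kobayashi_speed \<Omega> \<gamma> t"]
    by (metis has_integral_integrable integral_unique)
  then show ?thesis by (simp add: dist_norm norm_minus_commute pathstart_def pathfinish_def)
qed

section \<open>Kobayashi distance and boundary distance in a bounded convex domain\<close>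

locale bounded_convex_domain =
  fixes \<Omega> :: "(complex^'n) set"
  assumes op: "open \<Omega>" and ne: "\<Omega> \<noteq> {}" and bd: "bounded \<Omega>" and cv: "convex \<Omega>"
begin

lemma linepath_in: "x \<in> \<Omega> \<Longrightarrow> y \<in> \<Omega> \<Longrightarrow> t \<in> {0..1} \<Longrightarrow> linepath x y t \<in> \<Omega>"
  using convex_contains_segment[THEN iffD1, OF cv] linepath_in_path by blast

text \<open>By continuity of the metric every segment has a length; hence the infimum defining the
  distance is over a nonempty set.\<close>

lemma has_kobayashi_length_linepath:
  assumes "x \<in> \<Omega>" "y \<in> \<Omega>"
  shows "has_kobayashi_length \<Omega> (linepath x y) (integral {0..1} (kobayashi_speed \<Omega> (linepath x y)))"
proof -
  have "continuous_on {0..1} (kobayashi_speed \<Omega> (linepath x y))"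
    unfolding kobayashi_speed_linepath[abs_def]
    by (rule continuous_on_compose2[OF continuous_on_kobayashi_metric[OF op cv]])
       (use linepath_in[OF assms] in \<open>auto intro!: continuous_intros\<close>)
  then show ?thesis
    using linepath_in[OF assms]
    by (auto simp: has_kobayashi_length_def path_image_def integrable_integral integrable_continuous_real)
qed

lemma kobayashi_dist_linepath_le:
  assumes "x \<in> \<Omega>" "y \<in> \<Omega>" "(g has_integral l) {0..1}"
    and "\<And>t. t \<in> {0..1} \<Longrightarrow> kobayashi_metric \<Omega> (linepath x y t) (y - x) \<le> g t"
  shows "kobayashi_dist \<Omega> x y \<le> l"
proof -
  note L = has_kobayashi_length_linepath[OF assms(1,2)]
  have "kobayashi_dist \<Omega> x y \<le> integral {0..1} (kobayashi_speed \<Omega> (linepath x y))"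
    using kobayashi_dist_le[OF op L] by simp
  also have "\<dots> \<le> l"
    using L unfolding has_kobayashi_length_def
    by (intro has_integral_le[OF _ assms(3)]) (auto simp: kobayashi_speed_linepath assms(4))
  finally show ?thesis .
qed

lemma kobayashi_dist_ge:
  assumes "x \<in> \<Omega>" "y \<in> \<Omega>"
    and "\<And>\<gamma> l. has_kobayashi_length \<Omega> \<gamma> l \<Longrightarrow> pathstart \<gamma> = x \<Longrightarrow> pathfinish \<gamma> = y \<Longrightarrow> B \<le> l"
  shows "B \<le> kobayashi_dist \<Omega> x y"
  unfolding kobayashi_dist_alt
proof (rule cInf_greatest)
  show "{l. \<exists>\<gamma>. has_kobayashi_length \<Omega> \<gamma> l \<and> pathstart \<gamma> = x \<and> pathfinish \<gamma> = y} \<noteq> {}"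
    using has_kobayashi_length_linepath[OF assms(1,2)] pathstart_linepath pathfinish_linepath by blast
qed (use assms(3) in blast)

lemma kobayashi_dist_nonneg: "x \<in> \<Omega> \<Longrightarrow> y \<in> \<Omega> \<Longrightarrow> 0 \<le> kobayashi_dist \<Omega> x y"
  by (rule kobayashi_dist_ge) (auto intro: kobayashi_length_nonneg[OF op])

lemma kobayashi_dist_self: "x \<in> \<Omega> \<Longrightarrow> kobayashi_dist \<Omega> x x = 0"
  using kobayashi_dist_linepath_le[of x x "\<lambda>_. 0" 0] kobayashi_dist_nonneg[of x x]
    kobayashi_metric_scale[OF op, of x 0]
  by (auto simp: linepath_refl intro: antisym)

lemma kobayashi_dist_commute_le:
  assumes "x \<in> \<Omega>" "y \<in> \<Omega>"
  shows "kobayashi_dist \<Omega> y x \<le> kobayashi_dist \<Omega> x y"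
proof (rule kobayashi_dist_ge[OF assms])
  fix \<gamma> l assume "has_kobayashi_length \<Omega> \<gamma> l" "pathstart \<gamma> = x" "pathfinish \<gamma> = y"
  then show "kobayashi_dist \<Omega> y x \<le> l"
    using kobayashi_dist_le[OF op has_kobayashi_length_reversepath[OF op]] by fastforce
qed

lemma kobayashi_dist_commute:
  "x \<in> \<Omega> \<Longrightarrow> y \<in> \<Omega> \<Longrightarrow> kobayashi_dist \<Omega> x y = kobayashi_dist \<Omega> y x"
  using kobayashi_dist_commute_le by (meson antisym)

lemma kobayashi_dist_triangle:
  assumes "x \<in> \<Omega>" "y \<in> \<Omega>" "z \<in> \<Omega>"
  shows "kobayashi_dist \<Omega> x z \<le> kobayashi_dist \<Omega> x y + kobayashi_dist \<Omega> y z"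
proof -
  have "kobayashi_dist \<Omega> x z - l1 \<le> kobayashi_dist \<Omega> y z"
    if 1: "has_kobayashi_length \<Omega> \<gamma>1 l1" "pathstart \<gamma>1 = x" "pathfinish \<gamma>1 = y" for \<gamma>1 l1
  proof (rule kobayashi_dist_ge[OF assms(2,3)])
    fix \<gamma>2 l2 assume 2: "has_kobayashi_length \<Omega> \<gamma>2 l2" "pathstart \<gamma>2 = y" "pathfinish \<gamma>2 = z"
    have "has_kobayashi_length \<Omega> (\<gamma>1 +++ \<gamma>2) (l1 + l2)"
      using 1 2 by (intro has_kobayashi_length_join[OF op]) auto
    from kobayashi_dist_le[OF op this] show "kobayashi_dist \<Omega> x z - l1 \<le> l2"
      using 1 2 by simp
  qed
  then have "kobayashi_dist \<Omega> x z - kobayashi_dist \<Omega> y z \<le> kobayashi_dist \<Omega> x y"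
    by (intro kobayashi_dist_ge[OF assms(1,2)]) (simp add: algebra_simps)
  then show ?thesis by simp
qed

lemma kobayashi_dist_approx:
  assumes "x \<in> \<Omega>" "y \<in> \<Omega>" "kobayashi_dist \<Omega> x y < B"
  obtains \<gamma> l where "has_kobayashi_length \<Omega> \<gamma> l" "pathstart \<gamma> = x" "pathfinish \<gamma> = y" "l < B"
  using kobayashi_dist_ge[OF assms(1,2), of B] assms(3) that by (meson not_le)

lemma kobayashi_dist_along_path:
  assumes \<gamma>: "has_kobayashi_length \<Omega> \<gamma> l" and st: "0 \<le> s" "s \<le> t" "t \<le> 1"
  shows "kobayashi_dist \<Omega> (\<gamma> s) (\<gamma> t) \<le> integral {s..t} (kobayashi_speed \<Omega> \<gamma>)"
proof (cases "s = t")
  case True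
  have "\<gamma> t \<in> \<Omega>" using \<gamma> st by (auto simp: has_kobayashi_length_def path_image_def)
  then show ?thesis using True kobayashi_dist_self by simp
next
  case False
  have "kobayashi_speed \<Omega> \<gamma> integrable_on {s..t}"
    using \<gamma> st integrable_subinterval_real[of "kobayashi_speed \<Omega> \<gamma>" 0 1 s t]
    by (auto simp: has_kobayashi_length_def dest: has_integral_integrable)
  from has_kobayashi_length_subpath[OF op \<gamma> integrable_integral[OF this]]
  have "has_kobayashi_length \<Omega> (subpath s t \<gamma>) (integral {s..t} (kobayashi_speed \<Omega> \<gamma>))"
    using False st by simp
  from kobayashi_dist_le[OF op this] show ?thesis by simp
qed

text \<open>The inequality is strict because an open set is its own relative interior.\<close>

lemma supporting_unit_normal:
  assumes "p \<in> frontier \<Omega>"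
  obtains \<nu> where "norm \<nu> = 1" "\<And>w. w \<in> \<Omega> \<Longrightarrow> (w - p) \<bullet> \<nu> < 0"
proof -
  have "p \<in> closure \<Omega>" "p \<notin> rel_interior \<Omega>"
    using assms op by (auto simp: frontier_def rel_interior_open interior_open)
  from supporting_hyperplane_relative_frontier[OF cv this] obtain a where
    a: "a \<noteq> 0" "\<And>y. y \<in> rel_interior \<Omega> \<Longrightarrow> a \<bullet> p < a \<bullet> y" by metis
  show ?thesis
  proof (rule that)
    show "norm (- sgn a) = 1" using a by (simp add: norm_sgn)
    fix w assume "w \<in> \<Omega>"
    then have "a \<bullet> p < a \<bullet> w" using a(2) op by (simp add: rel_interior_open)
    then have "(w - p) \<bullet> a > 0" by (simp add: inner_diff_left inner_diff_right inner_commute[of _ a])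
    then show "(w - p) \<bullet> (- sgn a) < 0"
      using a(1) by (simp add: sgn_div_norm)
  qed
qed

lemma frontier_not_in: "p \<in> frontier \<Omega> \<Longrightarrow> p \<notin> \<Omega>"
  using op by (auto simp: frontier_def interior_open)

lemma segment_meets_frontier:
  assumes "x \<in> \<Omega>" "y \<notin> \<Omega>"
  obtains q where "q \<in> frontier \<Omega>" "q \<in> closed_segment x y"
  using connected_Int_frontier[of "closed_segment x y" \<Omega>] assms by auto

lemma frontier_nonempty: "frontier \<Omega> \<noteq> {}"
  using ne bd not_bounded_UNIV frontier_eq_empty by blast

lemma bdist_attained:
  obtains p where "p \<in> frontier \<Omega>" "dist x p = bdist \<Omega> x"
  using infdist_attains_inf[OF frontier_closed frontier_nonempty, of x] unfolding bdist_def by metis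

lemma bdist_le: "p \<in> frontier \<Omega> \<Longrightarrow> bdist \<Omega> x \<le> dist x p"
  unfolding bdist_def by (rule infdist_le)

lemma bdist_pos: "x \<in> \<Omega> \<Longrightarrow> 0 < bdist \<Omega> x"
  by (metis bdist_attained frontier_not_in zero_less_dist_iff)

lemma ball_bdist: "x \<in> \<Omega> \<Longrightarrow> ball x (bdist \<Omega> x) \<subseteq> \<Omega>"
proof
  fix y assume x: "x \<in> \<Omega>" and y: "y \<in> ball x (bdist \<Omega> x)"
  show "y \<in> \<Omega>"
  proof (rule ccontr)
    assume "y \<notin> \<Omega>"
    with x obtain q where q: "q \<in> frontier \<Omega>" "q \<in> closed_segment x y"
      using segment_meets_frontier by blast
    then have "dist x q \<le> dist x y" using dist_in_closed_segment by (metis dist_commute)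
    then show False using bdist_le[OF q(1)] y by (meson mem_ball leD order.trans)
  qed
qed

text \<open>Otherwise \<open>y\<close> could be pushed along \<open>\<nu>\<close> onto the
  supporting hyperplane without leaving the ball of radius \<open>bdist \<Omega> y\<close>, hence
  without leaving \<open>\<Omega>\<close>.\<close>

lemma bdist_le_supporting:
  assumes "y \<in> \<Omega>" "norm \<nu> = 1" "\<And>w. w \<in> \<Omega> \<Longrightarrow> (w - p) \<bullet> \<nu> < 0"
  shows "bdist \<Omega> y \<le> (p - y) \<bullet> \<nu>"
proof (rule ccontr)
  assume "\<not> ?thesis"
  then have lt: "(p - y) \<bullet> \<nu> < bdist \<Omega> y" by simp
  define u where "u = (p - y) \<bullet> \<nu>"
  have "0 < u" using assms(1) assms(3)[of y] by (simp add: u_def inner_diff_left)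
  then have "y + u *\<^sub>R \<nu> \<in> ball y (bdist \<Omega> y)"
    using lt assms(2) by (simp add: dist_norm u_def)
  then have "y + u *\<^sub>R \<nu> \<in> \<Omega>" using ball_bdist assms(1) by blast
  from assms(3)[OF this] have "(y - p) \<bullet> \<nu> + u * (\<nu> \<bullet> \<nu>) < 0"
    by (simp add: inner_left_distrib inner_diff_left)
  moreover have "\<nu> \<bullet> \<nu> = 1" using assms(2) by (simp add: dot_square_norm)
  ultimately show False by (simp add: u_def inner_diff_left)
qed

text \<open>Let \<open>u\<close> be the distance to the supporting hyperplane at the boundary point
  nearest to \<open>x\<close>. Along any path \<open>ln u\<close> grows at most at twice the
  Kobayashi speed, while \<open>u\<close> is at most the boundary distance at \<open>x\<close> and
  at least the boundary distance at \<open>y\<close>.\<close>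

lemma bdist_exp_kobayashi_dist:
  assumes "x \<in> \<Omega>" "y \<in> \<Omega>"
  shows "bdist \<Omega> y \<le> bdist \<Omega> x * exp (2 * kobayashi_dist \<Omega> x y)"
proof -
  obtain p where p: "p \<in> frontier \<Omega>" "dist x p = bdist \<Omega> x" using bdist_attained .
  obtain \<nu> where \<nu>: "norm \<nu> = 1" "\<And>w. w \<in> \<Omega> \<Longrightarrow> (w - p) \<bullet> \<nu> < 0"
    using supporting_unit_normal[OF p(1)] by blast
  define u where "u = (\<lambda>z. (p - z) \<bullet> \<nu>)"
  have u: "0 < u w" if "w \<in> \<Omega>" for w using \<nu>(2)[OF that] by (simp add: u_def inner_diff_left)
  have "(ln (u y) - ln (u x)) / 2 \<le> kobayashi_dist \<Omega> x y"
  proof (rule kobayashi_dist_ge[OF assms])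
    fix \<gamma> l assume \<gamma>: "has_kobayashi_length \<Omega> \<gamma> l" "pathstart \<gamma> = x" "pathfinish \<gamma> = y"
    note D = \<gamma>(1)[unfolded has_kobayashi_length_def]
    obtain S where S: "finite S" "\<And>t. t \<in> {0..1} - S \<Longrightarrow> \<gamma> differentiable at t"
      using D valid_path_differentiable by metis
    have \<gamma>in: "\<gamma> t \<in> \<Omega>" if "t \<in> {0..1}" for t using D that by (auto simp: path_image_def)
    define f where "f = (\<lambda>t. if t \<in> S then 0 else - (vector_derivative \<gamma> (at t) \<bullet> \<nu>) / u (\<gamma> t))"
    have "(f has_integral (ln (u (\<gamma> 1)) - ln (u (\<gamma> 0)))) {0..1}"
    proof (rule fundamental_theorem_of_calculus_interior_strong[OF S(1)])
      have "continuous_on {0..1} \<gamma>"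
        using D valid_path_imp_path unfolding path_def by blast
      then show "continuous_on {0..1} (\<lambda>t. ln (u (\<gamma> t)))"
        using u[OF \<gamma>in] unfolding u_def by (intro continuous_intros ballI less_imp_neq[symmetric])
      fix t :: real assume t: "t \<in> {0<..<1} - S"
      then have "(\<gamma> has_vector_derivative vector_derivative \<gamma> (at t)) (at t)"
        using S(2)[of t] by (auto simp: vector_derivative_works)
      then have "((\<lambda>t. u (\<gamma> t)) has_real_derivative - (vector_derivative \<gamma> (at t) \<bullet> \<nu>)) (at t)"
        unfolding u_def has_real_derivative_iff_has_vector_derivative
        by (auto intro!: derivative_eq_intros simp: has_vector_derivative_def)
      from DERIV_ln_divide[THEN DERIV_chain2, OF _ this]
      show "((\<lambda>t. ln (u (\<gamma> t))) has_vector_derivative f t) (at t)"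
        using t u[OF \<gamma>in, of t] by (simp add: f_def has_real_derivative_iff_has_vector_derivative)
    qed simp
    moreover have "((\<lambda>t. 2 * kobayashi_speed \<Omega> \<gamma> t) has_integral (2 * l)) {0..1}"
      using D by (intro has_integral_mult_right) simp
    moreover have "f t \<le> 2 * kobayashi_speed \<Omega> \<gamma> t" if t: "t \<in> {0..1}" for t
    proof -
      have "- (vector_derivative \<gamma> (at t) \<bullet> \<nu>) \<le> cmod (cinner (vector_derivative \<gamma> (at t)) \<nu>)"
        by (metis Re_cinner abs_Re_le_cmod abs_le_D2)
      also have "\<dots> \<le> 2 * u (\<gamma> t) * kobayashi_speed \<Omega> \<gamma> t"
        unfolding u_def kobayashi_speed_def
        by (rule kobayashi_metric_ge_halfspace[OF op \<gamma>in[OF t] \<nu>(2)])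
      finally show ?thesis
        using u[OF \<gamma>in[OF t]] kobayashi_speed_nonneg[OF op _ t, of \<gamma>] D
        by (cases "t \<in> S") (auto simp: f_def minus_divide_left pos_divide_le_eq mult_ac simp del: divide_minus_left)
    qed
    ultimately have "ln (u (\<gamma> 1)) - ln (u (\<gamma> 0)) \<le> 2 * l" by (rule has_integral_le)
    then show "(ln (u y) - ln (u x)) / 2 \<le> l"
      using \<gamma> by (simp add: pathstart_def pathfinish_def)
  qed
  then have "ln (u y) \<le> ln (u x) + 2 * kobayashi_dist \<Omega> x y" by simp
  then have "u y \<le> u x * exp (2 * kobayashi_dist \<Omega> x y)"
    using u assms by (metis exp_add exp_le_cancel_iff exp_ln)
  moreover have "u x \<le> bdist \<Omega> x"
    using norm_cauchy_schwarz[of "p - x" \<nu>] \<nu>(1) p(2) by (simp add: u_def dist_norm norm_minus_commute)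
  then have "u x * exp (2 * kobayashi_dist \<Omega> x y) \<le> bdist \<Omega> x * exp (2 * kobayashi_dist \<Omega> x y)"
    by simp
  moreover have "bdist \<Omega> y \<le> u y"
    unfolding u_def using bdist_le_supporting[OF assms(2) \<nu>] .
  ultimately show ?thesis by linarith
qed

text \<open>The supporting half-space is taken at the boundary point \<open>q\<close> nearest to
  \<open>z\<close> inside the complex line through \<open>z\<close>. Since \<open>q - z\<close> is a
  complex multiple of \<open>v\<close>, the same factor \<open>cinner v \<nu>\<close> governs both
  the height of \<open>z\<close> and the lower bound for the metric.\<close>

lemma norm_le_kobayashi_metric:
  assumes "z \<in> \<Omega>" "v \<noteq> 0"
  shows "norm v \<le> 2 * bdist_dir \<Omega> z v * kobayashi_metric \<Omega> z v"
proof -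
  let ?L = "{z + c *s v | c. True}"
  have cl: "closed ?L"
  proof -
    have "?L = (+) z ` range (\<lambda>c. c *s v)" by auto
    moreover have "bounded_linear (\<lambda>c. c *s v)"
      by (rule bounded_linear_intro[where K = "norm v"]) (auto simp: norm_smult vec_eq_iff algebra_simps)
    then have "linear (\<lambda>c. c *s v)" by (rule bounded_linear.linear)
    then have "subspace (range (\<lambda>c. c *s v))" by (rule linear_subspace_image) simp
    ultimately show ?thesis by (metis closed_subspace closed_translation)
  qed
  \<comment> \<open>A far point of the line lies outside the bounded domain. Nonemptiness rules out
    the default value 0 of \<open>infdist\<close> on the empty set.\<close>
  have ne: "frontier \<Omega> \<inter> ?L \<noteq> {}"
  proof -
    obtain B where B: "\<And>w. w \<in> \<Omega> \<Longrightarrow> norm w \<le> B" using bd bounded_iff by metis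
    define c :: complex where "c = of_real ((\<bar>B\<bar> + norm z + 1) / norm v)"
    have "norm (c *s v) = \<bar>B\<bar> + norm z + 1" using assms(2) by (simp add: norm_smult c_def norm_divide del: of_real_add)
    then have "norm (z + c *s v) > B" using norm_diff_ineq[of "c *s v" z] by (simp add: add.commute)
    then have "z + c *s v \<notin> \<Omega>" using B by (meson not_le)
    with assms(1) obtain q where q: "q \<in> frontier \<Omega>" "q \<in> closed_segment z (z + c *s v)"
      using segment_meets_frontier by blast
    then obtain t where "q = z + t *\<^sub>R (c *s v)"
      by (auto simp: in_segment algebra_simps)
    then have "q = z + (of_real t * c) *s v" by (simp add: vec_eq_iff vec_scaleR_of_real del: vector_scaleR_component)
    then show ?thesis using q by blast
  qed
  from infdist_attains_inf[OF closed_Int[OF frontier_closed cl] ne, of z]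
  obtain q where q: "q \<in> frontier \<Omega> \<inter> ?L" "bdist_dir \<Omega> z v = dist z q"
    unfolding bdist_dir_def .
  from q(1) obtain c where c: "q = z + c *s v" by blast
  obtain \<nu> where \<nu>: "norm \<nu> = 1" "\<And>w. w \<in> \<Omega> \<Longrightarrow> (w - q) \<bullet> \<nu> < 0"
    using supporting_unit_normal q(1) by blast
  define k where "k = kobayashi_metric \<Omega> z v"
  have "0 \<le> k" using kobayashi_metric_nonneg[OF op assms(1)] by (simp add: k_def)
  have "0 < (q - z) \<bullet> \<nu>" using \<nu>(2)[OF assms(1)] by (simp add: inner_diff_left)
  moreover have le: "(q - z) \<bullet> \<nu> \<le> cmod c * cmod (cinner v \<nu>)"
    using abs_Re_le_cmod[of "cinner (q - z) \<nu>"] unfolding Re_cinner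
    by (simp add: c cinner_scale norm_mult)
  ultimately have pos: "0 < cmod (cinner v \<nu>)"
    by (cases "cinner v \<nu> = 0") auto
  have "cmod (cinner v \<nu>) \<le> 2 * ((q - z) \<bullet> \<nu>) * k"
    unfolding k_def by (rule kobayashi_metric_ge_halfspace[OF op assms(1) \<nu>(2)])
  also have "\<dots> \<le> 2 * (cmod c * cmod (cinner v \<nu>)) * k"
    using le \<open>0 \<le> k\<close> by (intro mult_right_mono mult_left_mono) auto
  \<comment> \<open>Dividing by the positive \<open>cmod (cinner v \<nu>)\<close> removes the
    unknown angle between \<open>v\<close> and the normal.\<close>
  finally have "1 \<le> 2 * cmod c * k" using pos by (simp add: mult.assoc mult.left_commute[of "cmod (cinner v \<nu>)"])
  then have "norm v * 1 \<le> norm v * (2 * cmod c * k)" by (intro mult_left_mono) auto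
  moreover have "bdist_dir \<Omega> z v = cmod c * norm v"
    using q(2) c by (simp add: dist_norm norm_smult)
  ultimately show ?thesis by (simp add: k_def mult_ac)
qed

end

section \<open>Dini-smooth convex domains: the upper bound\<close>

lemma norm_outer_unit_normal:
  assumes "C1_smooth_point \<Omega> x"
  shows "norm (outer_unit_normal \<Omega> x) = 1"
proof -
  from assms obtain U \<rho> G where "x \<in> frontier \<Omega>" "C1_defining_function \<Omega> U \<rho> G" "x \<in> U"
    by (auto simp: C1_smooth_point_def)
  then show ?thesis
    using outer_unit_normal_eq[of x \<Omega> U \<rho> G] by (simp add: C1_defining_function_def norm_sgn)
qed

text \<open>If \<open>\<nu>\<close> differed from the outer normal \<open>n\<close>, the direction
  \<open>\<nu> - n\<close> would decrease the defining function to first order and so enter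
  \<open>\<Omega>\<close>, yet it has positive product with \<open>\<nu>\<close>.\<close>

lemma outer_unit_normal_unique:
  assumes "C1_smooth_point \<Omega> x" "norm \<nu> = 1" "\<And>w. w \<in> \<Omega> \<Longrightarrow> (w - x) \<bullet> \<nu> \<le> 0"
  shows "outer_unit_normal \<Omega> x = \<nu>"
proof (rule ccontr)
  let ?n = "outer_unit_normal \<Omega> x"
  assume ne: "?n \<noteq> \<nu>"
  from assms(1) obtain U \<rho> G where x: "x \<in> frontier \<Omega>" and D: "C1_defining_function \<Omega> U \<rho> G" "x \<in> U"
    by (auto simp: C1_smooth_point_def)
  then have n: "?n = sgn (G x)" and G: "G x \<noteq> 0" and \<rho>: "\<rho> x = 0"
    using outer_unit_normal_eq[of x \<Omega> U \<rho> G] by (auto simp: C1_defining_function_def)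
  have nn: "?n \<bullet> ?n = 1" "\<nu> \<bullet> \<nu> = 1"
    using norm_outer_unit_normal[OF assms(1)] assms(2) by (simp_all add: dot_square_norm)
  have "0 < (?n - \<nu>) \<bullet> (?n - \<nu>)" using ne by simp
  then have lt: "?n \<bullet> \<nu> < 1" using nn by (simp add: inner_diff inner_commute)
  have "G x = norm (G x) *\<^sub>R ?n" using G by (simp add: n sgn_div_norm)
  then have "(\<nu> - ?n) \<bullet> G x = norm (G x) * ((\<nu> - ?n) \<bullet> ?n)" by (metis inner_scaleR_right)
  moreover have "(\<nu> - ?n) \<bullet> ?n < 0" using lt nn inner_commute[of \<nu> ?n] by (simp add: inner_diff_left)
  ultimately have "(\<nu> - ?n) \<bullet> G x < 0" using G by (simp add: mult_pos_neg)
  from C1_defining_function_descent(1)[OF D \<rho> this]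
  have "\<forall>\<^sub>F t in at_right (0::real). x + t *\<^sub>R (\<nu> - ?n) \<in> \<Omega> \<and> 0 < t"
    by (intro eventually_conj eventually_at_right_less)
  then obtain t :: real where "x + t *\<^sub>R (\<nu> - ?n) \<in> \<Omega>" "0 < t"
    using eventually_happens'[OF trivial_limit_at_right_real] by blast
  from assms(3)[OF this(1)] this(2) have "(\<nu> - ?n) \<bullet> \<nu> \<le> 0" by (simp add: mult_le_0_iff)
  then show False using lt nn by (simp add: inner_diff_left)
qed

text \<open>Unit vectors are at most 2 apart, so the supremum is that of a bounded set and really is
  an upper bound.\<close>

lemma normal_modulus_ge:
  assumes "\<And>x. x \<in> frontier \<Omega> \<inter> U \<Longrightarrow> C1_smooth_point \<Omega> x"
    and "x \<in> frontier \<Omega> \<inter> U" "y \<in> frontier \<Omega> \<inter> U" "norm (x - y) < t"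
  shows "norm (outer_unit_normal \<Omega> x - outer_unit_normal \<Omega> y) \<le> normal_modulus \<Omega> U t"
  unfolding normal_modulus_def
proof (rule cSup_upper)
  have "norm (outer_unit_normal \<Omega> x - outer_unit_normal \<Omega> y) \<le> 2"
    if "x \<in> frontier \<Omega> \<inter> U" "y \<in> frontier \<Omega> \<inter> U" for x y
    using norm_triangle_ineq4[of "outer_unit_normal \<Omega> x" "outer_unit_normal \<Omega> y"]
      norm_outer_unit_normal[OF assms(1)] that by simp
  then show "bdd_above {norm (outer_unit_normal \<Omega> x - outer_unit_normal \<Omega> y) | x y.
      x \<in> frontier \<Omega> \<inter> U \<and> y \<in> frontier \<Omega> \<inter> U \<and> norm (x - y) < t}"
    by (intro bdd_aboveI[of _ 2]) blast
qed (use assms in blast)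

lemma normal_modulus_mono:
  assumes "\<And>x. x \<in> frontier \<Omega> \<inter> U \<Longrightarrow> C1_smooth_point \<Omega> x"
    and "frontier \<Omega> \<inter> U \<noteq> {}" "0 < s" "s \<le> t"
  shows "normal_modulus \<Omega> U s \<le> normal_modulus \<Omega> U t"
proof -
  obtain p where p: "p \<in> frontier \<Omega> \<inter> U" using assms(2) by blast
  then have "norm (p - p) < s" using assms by simp
  then have ne: "{norm (outer_unit_normal \<Omega> x - outer_unit_normal \<Omega> y) | x y.
      x \<in> frontier \<Omega> \<inter> U \<and> y \<in> frontier \<Omega> \<inter> U \<and> norm (x - y) < s} \<noteq> {}" using p by blast
  show ?thesis
    unfolding normal_modulus_def[of _ _ s]
    by (rule cSup_least[OF ne]) (use normal_modulus_ge[of \<Omega> U] assms in force)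
qed

lemma normal_modulus_nonneg:
  assumes "\<And>x. x \<in> frontier \<Omega> \<inter> U \<Longrightarrow> C1_smooth_point \<Omega> x"
    and "frontier \<Omega> \<inter> U \<noteq> {}" "0 < t"
  shows "0 \<le> normal_modulus \<Omega> U t"
proof -
  obtain p where p: "p \<in> frontier \<Omega> \<inter> U" using assms(2) by blast
  then show ?thesis using normal_modulus_ge[OF assms(1) p p] assms(3) by fastforce
qed

section \<open>Dyadic form of the Dini condition\<close>

lemma ex_dyadic:
  fixes t :: real
  assumes "0 < t" "t \<le> (1/2) ^ j"
  obtains k where "j \<le> k" "(1/2) ^ Suc k < t" "t \<le> (1/2) ^ k"
proof -
  obtain n where "(1/2) ^ n < t" using real_arch_pow_inv[of t "1/2"] assms by auto
  then have ex: "(1/2) ^ Suc n < t"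
    using zero_less_power[of "1/2::real" n] unfolding power_Suc by linarith
  define k where "k = (LEAST k. (1/2) ^ Suc k < t)"
  have k: "(1/2) ^ Suc k < t" unfolding k_def by (rule LeastI, rule ex)
  have "j \<le> k"
  proof (rule ccontr)
    assume "\<not> j \<le> k"
    then have "(1/2::real) ^ j \<le> (1/2) ^ Suc k" by (intro power_decreasing) auto
    then show False using k assms by simp
  qed
  moreover have "t \<le> (1/2) ^ k"
  proof (cases "k = j")
    case False
    then obtain i where i: "k = Suc i" using \<open>j \<le> k\<close> by (cases k) auto
    then have "\<not> (1/2) ^ Suc i < t" using not_less_Least[of i "\<lambda>k. (1/2) ^ Suc k < t"] k_def by simp
    then show ?thesis using i by simp
  qed (use assms in simp)
  ultimately show ?thesis using that k by blast
qed

text \<open>The strict upper bound matches the strict inequality in \<open>normal_modulus\<close>.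
  An exact power of 1/2 belongs to the coarser of the two scales that it separates.\<close>

lemma ex_dyadic':
  fixes t :: real
  assumes "0 < t" "t < (1/2) ^ j"
  obtains k where "j \<le> k" "(1/2) ^ Suc k \<le> t" "t < (1/2) ^ k"
proof -
  obtain k where k: "j \<le> k" "(1/2) ^ Suc k < t" "t \<le> (1/2) ^ k"
    using ex_dyadic assms by (metis less_imp_le)
  show ?thesis
  proof (cases "t = (1/2) ^ k")
    case True
    then have "k \<noteq> j" using assms by auto
    then obtain i where "k = Suc i" "j \<le> i" using k(1) by (cases k) auto
    moreover have "(1/2::real) ^ k < (1/2) ^ i" using calculation by simp
    ultimately show ?thesis using that[of i] True by simp
  next
    case False
    then show ?thesis using that[of k] k by simp
  qed
qed

text \<open>The modulus is increasing, so on the dyadic interval from \<open>(1/2) ^ Suc k\<close>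
  to \<open>(1/2) ^ k\<close> the integrand is at least \<open>2 ^ k\<close> times the modulus at
  the left end. Multiplied by the length of the interval this is half that value, and the dyadic
  series is bounded by twice the Dini integral.\<close>

lemma summable_normal_modulus:
  assumes C1: "\<And>x. x \<in> frontier \<Omega> \<inter> U \<Longrightarrow> C1_smooth_point \<Omega> x"
    and ne: "frontier \<Omega> \<inter> U \<noteq> {}"
    and fin: "(\<integral>\<^sup>+t\<in>{0<..<1}. ennreal (normal_modulus \<Omega> U t / t) \<partial>lborel) < \<infinity>"
  shows "summable (\<lambda>k. normal_modulus \<Omega> U ((1/2) ^ k))"
proof -
  let ?w = "\<lambda>k. normal_modulus \<Omega> U ((1/2) ^ k)"
  let ?I = "\<lambda>k::nat. {(1/2) ^ Suc k..<(1/2::real) ^ k}"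
  have w0: "0 \<le> ?w k" for k by (rule normal_modulus_nonneg[OF C1 ne]) auto
  have "(\<integral>\<^sup>+t. ennreal (?w (Suc k) * 2 ^ k) * indicator (?I k) t \<partial>lborel) = ennreal (?w (Suc k) / 2)" for k
  proof -
    have "emeasure lborel (?I k) = ennreal ((1/2) ^ k / 2)"
      by (simp add: power_one_over field_simps)
    then show ?thesis
      using w0 by (simp add: nn_integral_cmult_indicator field_simps flip: ennreal_mult')
  qed
  then have "(\<Sum>k. ennreal (?w (Suc k) / 2)) =
      (\<integral>\<^sup>+t. (\<Sum>k. ennreal (?w (Suc k) * 2 ^ k) * indicator (?I k) t) \<partial>lborel)"
    by (subst nn_integral_suminf) auto
  also have "\<dots> \<le> (\<integral>\<^sup>+t\<in>{0<..<1}. ennreal (normal_modulus \<Omega> U t / t) \<partial>lborel)"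
  proof (rule nn_integral_mono)
    fix t :: real
    show "(\<Sum>k. ennreal (?w (Suc k) * 2 ^ k) * indicator (?I k) t)
        \<le> ennreal (normal_modulus \<Omega> U t / t) * indicator {0<..<1} t"
    proof (cases "0 < t \<and> t < 1")
      case False
      have "t \<notin> ?I k" for k
      proof
        assume "t \<in> ?I k"
        moreover have "(0::real) < (1/2) ^ Suc k" "(1/2::real) ^ k \<le> 1" by (auto intro: power_le_one)
        ultimately show False using False unfolding atLeastLessThan_iff by linarith
      qed
      then show ?thesis by simp
    next
      case True
      then obtain j where j: "(1/2) ^ Suc j \<le> t" "t < (1/2) ^ j"
        using ex_dyadic'[of t 0] by auto
      have uniq: "k = j" if k: "t \<in> ?I k" for k
      proof (rule ccontr)
        assume "k \<noteq> j"
        then consider "Suc k \<le> j" | "Suc j \<le> k" by linarith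
        then show False
        proof cases
          case 1
          then have "(1/2::real) ^ j \<le> (1/2) ^ Suc k" by (intro power_decreasing) auto
          then show False using j k by auto
        next
          case 2
          then have "(1/2::real) ^ k \<le> (1/2) ^ Suc j" by (intro power_decreasing) auto
          then show False using j k by auto
        qed
      qed
      have mem: "t \<in> ?I k \<longleftrightarrow> k = j" for k
        using uniq[of k] j unfolding atLeastLessThan_iff by blast
      have "(\<lambda>k. ennreal (?w (Suc k) * 2 ^ k) * indicator (?I k) t) =
          (\<lambda>k. if k = j then ennreal (?w (Suc j) * 2 ^ j) else 0)"
        unfolding indicator_def mem by (rule ext) simp
      then have "(\<Sum>k. ennreal (?w (Suc k) * 2 ^ k) * indicator (?I k) t) = ennreal (?w (Suc j) * 2 ^ j)"
        using sums_single[of j "\<lambda>_. ennreal (?w (Suc j) * 2 ^ j)"] by (simp add: sums_iff)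
      also have "?w (Suc j) * 2 ^ j \<le> normal_modulus \<Omega> U t / t"
      proof -
        have "?w (Suc j) \<le> normal_modulus \<Omega> U t"
          using normal_modulus_mono[OF C1 ne _ j(1)] by simp
        moreover have "t * 2 ^ j \<le> 1" using j(2) by (simp add: power_one_over field_simps)
        ultimately have "?w (Suc j) * (t * 2 ^ j) \<le> normal_modulus \<Omega> U t * 1"
          using w0 True normal_modulus_nonneg[OF C1 ne, of t] by (intro mult_mono) auto
        then show ?thesis using True by (simp add: field_simps)
      qed
      finally show ?thesis using True by (simp add: ennreal_leI)
    qed
  qed
  also have "\<dots> < \<infinity>" by (rule fin)
  finally have "(\<Sum>k. ennreal (?w (Suc k) / 2)) \<noteq> top" by simp
  then have "summable (\<lambda>k. ?w (Suc k) / 2)"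
    using w0 by (intro summable_suminf_not_top) (simp_all del: power_Suc)
  from summable_mult[OF this, of 2] have "summable (\<lambda>k. ?w (Suc k))" by simp
  then show ?thesis by (simp only: summable_Suc_iff[of ?w])
qed

section \<open>Boundary normals of a Dini-smooth convex domain\<close>

locale dini_convex_domain = bounded_convex_domain \<Omega> for \<Omega> :: "(complex^'n) set" +
  assumes dini: "dini_smooth_boundary \<Omega>"
begin

abbreviation \<n> :: "complex^'n \<Rightarrow> complex^'n" where "\<n> \<equiv> outer_unit_normal \<Omega>"

lemma C1_smooth_point_frontier: "p \<in> frontier \<Omega> \<Longrightarrow> C1_smooth_point \<Omega> p"
  using dini by (simp add: dini_smooth_boundary_def dini_smooth_point_def)

lemma norm_normal: "p \<in> frontier \<Omega> \<Longrightarrow> norm (\<n> p) = 1"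
  by (rule norm_outer_unit_normal[OF C1_smooth_point_frontier])

lemma normal_supporting:
  assumes "p \<in> frontier \<Omega>" "w \<in> \<Omega>"
  shows "(w - p) \<bullet> \<n> p < 0"
proof -
  obtain \<nu> where \<nu>: "norm \<nu> = 1" "\<And>w. w \<in> \<Omega> \<Longrightarrow> (w - p) \<bullet> \<nu> < 0"
    using supporting_unit_normal[OF assms(1)] by blast
  then have "\<n> p = \<nu>"
    by (intro outer_unit_normal_unique[OF C1_smooth_point_frontier[OF assms(1)]]) (auto intro: less_imp_le)
  then show ?thesis using \<nu>(2)[OF assms(2)] by simp
qed

lemma normal_supporting_closure:
  assumes "p \<in> frontier \<Omega>" "w \<in> closure \<Omega>"
  shows "(w - p) \<bullet> \<n> p \<le> 0"
proof -
  have "closure \<Omega> \<subseteq> {w. (w - p) \<bullet> \<n> p \<le> 0}"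
    using normal_supporting[OF assms(1)]
    by (intro closure_minimal closed_Collect_le continuous_intros) (auto intro: less_imp_le)
  then show ?thesis using assms(2) by blast
qed

text \<open>Take for \<open>q\<close> the metric projection of \<open>z\<close> to the closure,
  which is \<open>z\<close> itself on the frontier. Projection does not increase the distance to
  \<open>p\<close>; the normal at \<open>q\<close> points towards \<open>z\<close>, and
  \<open>p\<close> lies behind the tangent plane at \<open>q\<close>, so both parts of
  \<open>(z - q) + (q - p)\<close> have nonnegative product with it.\<close>

lemma ex_frontier_normal_outside:
  assumes "z \<notin> \<Omega>" "p \<in> frontier \<Omega>"
  obtains q where "q \<in> frontier \<Omega>" "dist q p \<le> dist z p" "0 \<le> (z - p) \<bullet> \<n> q"
proof (cases "z \<in> closure \<Omega>")
  case True
  then have "z \<in> frontier \<Omega>" using assms op by (simp add: frontier_def interior_open)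
  moreover have "(p - z) \<bullet> \<n> z \<le> 0"
    using calculation assms(2) by (intro normal_supporting_closure) (auto simp: frontier_def)
  ultimately show ?thesis using that[of z] by (simp add: inner_diff_left)
next
  case False
  define q where "q = closest_point (closure \<Omega>) z"
  have cl: "closure \<Omega> \<noteq> {}" "convex (closure \<Omega>)" "p \<in> closure \<Omega>"
    using ne cv assms(2) by (auto simp: convex_closure frontier_def)
  have q: "q \<in> closure \<Omega>" unfolding q_def using cl by (intro closest_point_in_set) auto
  have dot: "(z - q) \<bullet> (w - q) \<le> 0" if "w \<in> closure \<Omega>" for w
    unfolding q_def using cl that by (intro closest_point_dot) auto
  have nz: "z \<noteq> q" using False q by blast
  have "q \<notin> \<Omega>"
  proof
    assume "q \<in> \<Omega>"
    then obtain e where e: "e > 0" "ball q e \<subseteq> \<Omega>" using op openE by blast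
    define w where "w = q + (e / 2) *\<^sub>R sgn (z - q)"
    have "w \<in> \<Omega>" using e nz by (intro subsetD[OF e(2)]) (simp add: w_def dist_norm norm_sgn)
    then have "(z - q) \<bullet> (w - q) \<le> 0" using dot closure_subset by blast
    moreover have "(z - q) \<bullet> (w - q) = (e / 2) * norm (z - q)"
      using nz by (simp add: w_def sgn_div_norm dot_square_norm power2_eq_square)
    ultimately show False using e nz by (simp add: mult_le_0_iff)
  qed
  then have qf: "q \<in> frontier \<Omega>" using q op by (simp add: frontier_def interior_open)
  \<comment> \<open>The projection makes \<open>z - q\<close> an outward supporting direction, and a
    smooth point has only one.\<close>
  have nq: "\<n> q = sgn (z - q)"
  proof (rule outer_unit_normal_unique[OF C1_smooth_point_frontier[OF qf]])
    show "norm (sgn (z - q)) = 1" using nz by (simp add: norm_sgn)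
    fix w assume "w \<in> \<Omega>"
    then have "(z - q) \<bullet> (w - q) \<le> 0" using dot closure_subset by blast
    then show "(w - q) \<bullet> sgn (z - q) \<le> 0"
      by (simp add: sgn_div_norm inner_commute mult_le_0_iff)
  qed
  have "(z - q) \<bullet> \<n> q = norm (z - q)"
    using nz by (simp add: nq sgn_div_norm dot_square_norm power2_eq_square)
  then have "0 \<le> (z - q) \<bullet> \<n> q" by simp
  moreover have "(p - q) \<bullet> \<n> q \<le> 0" by (rule normal_supporting_closure[OF qf cl(3)])
  moreover have "dist q p \<le> dist z p"
    using closest_point_lipschitz[OF cl(2) closed_closure cl(1), of z p] closest_point_self[OF cl(3)]
    by (simp add: q_def)
  ultimately show ?thesis using that[OF qf] by (simp add: inner_diff_left)
qed

text \<open>The complement reaches below the tangent plane at \<open>p\<close> only as far as the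
  normal turns: since \<open>(z - p) \<bullet> \<n> q\<close> is nonnegative, the depth is paid for
  by \<open>\<n> q - \<n> p\<close>. This takes the place of a local graph representation of the
  boundary.\<close>

lemma depth_outside_le:
  assumes "z \<notin> \<Omega>" "p \<in> frontier \<Omega>"
  obtains q where "q \<in> frontier \<Omega>" "dist q p \<le> norm (z - p)"
    "(p - z) \<bullet> \<n> p \<le> norm (z - p) * norm (\<n> q - \<n> p)"
proof -
  obtain q where q: "q \<in> frontier \<Omega>" "dist q p \<le> dist z p" "0 \<le> (z - p) \<bullet> \<n> q"
    using ex_frontier_normal_outside[OF assms] .
  have "(p - z) \<bullet> \<n> p \<le> (z - p) \<bullet> (\<n> q - \<n> p)"
    using q(3) by (simp add: inner_diff)
  also have "\<dots> \<le> norm (z - p) * norm (\<n> q - \<n> p)" by (rule norm_cauchy_schwarz)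
  finally show ?thesis using that q by (simp add: dist_norm)
qed

text \<open>Compactness turns the local moduli into one global sequence: finitely many
  neighbourhoods cover the frontier, and below their Lebesgue number any two points share one of
  them.\<close>

lemma dyadic_normal_modulus:
  obtains e :: "nat \<Rightarrow> real" where "summable e" "\<And>k. 0 \<le> e k" "e 0 = 2"
    "\<And>k x y. x \<in> frontier \<Omega> \<Longrightarrow> y \<in> frontier \<Omega> \<Longrightarrow> dist x y < (1/2) ^ k \<Longrightarrow> norm (\<n> x - \<n> y) \<le> e k"
proof -
  have "\<forall>p\<in>frontier \<Omega>. \<exists>U. open U \<and> p \<in> U \<and>
      (\<integral>\<^sup>+t\<in>{0<..<1}. ennreal (normal_modulus \<Omega> U t / t) \<partial>lborel) < \<infinity>"
    using dini unfolding dini_smooth_boundary_def dini_smooth_point_def by blast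
  from bchoice[OF this] obtain U where
     U: "\<And>p. p \<in> frontier \<Omega> \<Longrightarrow> open (U p)" "\<And>p. p \<in> frontier \<Omega> \<Longrightarrow> p \<in> U p"
     "\<And>p. p \<in> frontier \<Omega> \<Longrightarrow> (\<integral>\<^sup>+t\<in>{0<..<1}. ennreal (normal_modulus \<Omega> (U p) t / t) \<partial>lborel) < \<infinity>"
    by blast
  have cpt: "compact (frontier \<Omega>)" using bd by (simp add: compact_frontier_bounded)
  then obtain P where P: "P \<subseteq> frontier \<Omega>" "finite P" "frontier \<Omega> \<subseteq> (\<Union>p\<in>P. U p)"
    using compactE_image[OF cpt, of "frontier \<Omega>" U] U(1,2) by (metis UN_I subsetI)
  obtain \<epsilon> where \<epsilon>: "0 < \<epsilon>" "\<And>x. x \<in> frontier \<Omega> \<Longrightarrow> \<exists>G\<in>U ` P. ball x \<epsilon> \<subseteq> G"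
    using Heine_Borel_lemma[OF cpt, of "U ` P"] P U(1) by blast
  obtain k0 where k0: "(1/2::real) ^ k0 < \<epsilon>" using real_arch_pow_inv[OF \<epsilon>(1), of "1/2"] by auto
  let ?w = "\<lambda>p k. normal_modulus \<Omega> (U p) ((1/2) ^ k)"
  \<comment> \<open>Above the Lebesgue scale the trivial bound 2 for unit vectors is used. Only
    finitely many terms are affected, and \<open>e 0 = 2\<close> keeps the later majorant
    positive.\<close>
  define e where "e = (\<lambda>k. if k \<le> k0 then 2 else \<Sum>p\<in>P. ?w p k)"
  have nonempty: "frontier \<Omega> \<inter> U p \<noteq> {}" if "p \<in> P" for p using that P U by blast
  have w0: "0 \<le> ?w p k" if "p \<in> P" for p k
    using normal_modulus_nonneg[OF _ nonempty[OF that]] C1_smooth_point_frontier by simp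
  show ?thesis
  proof (rule that)
    have "summable (\<lambda>k. \<Sum>p\<in>P. ?w p k)"
      using P U(3) nonempty C1_smooth_point_frontier
      by (intro summable_sum summable_normal_modulus) auto
    then show "summable e"
      by (rule summable_comparison_test_ev[rotated])
         (auto simp: e_def eventually_sequentially sum_nonneg w0 intro!: exI[of _ "Suc k0"])
    show "0 \<le> e k" for k by (auto simp: e_def sum_nonneg w0)
    show "e 0 = 2" by (simp add: e_def)
    fix k x y assume xy: "x \<in> frontier \<Omega>" "y \<in> frontier \<Omega>" "dist x y < (1/2) ^ k"
    show "norm (\<n> x - \<n> y) \<le> e k"
    proof (cases "k \<le> k0")
      case True
      then show ?thesis
        using norm_triangle_ineq4[of "\<n> x" "\<n> y"] norm_normal xy by (simp add: e_def)
    next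
      case False
      then have "(1/2::real) ^ k \<le> (1/2) ^ k0" by (intro power_decreasing) auto
      then have "dist x y < \<epsilon>" using xy(3) k0 by linarith
      obtain p where p: "p \<in> P" "ball x \<epsilon> \<subseteq> U p" using \<epsilon>(2)[OF xy(1)] by blast
      have "norm (\<n> x - \<n> y) \<le> ?w p k"
        using p(2) \<open>dist x y < \<epsilon>\<close> \<epsilon>(1) xy C1_smooth_point_frontier
        by (intro normal_modulus_ge) (auto simp: dist_norm norm_minus_commute)
      also have "\<dots> \<le> (\<Sum>p\<in>P. ?w p k)"
        using P(2) p(1) w0 by (intro member_le_sum) auto
      finally show ?thesis using False by (simp add: e_def)
    qed
  qed
qed

end

text \<open>The Poincare density of the flat disc of radius \<open>R\<close> about \<open>c\<close>,
  recentred by a Moebius map. For \<open>\<rho> = R - \<tau>\<close> with small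
  \<open>\<tau>\<close> it is about \<open>1 / (2 * \<tau>)\<close>, whereas the affine disc of
  \<open>kobayashi_metric_le_ball\<close> would give \<open>1 / \<tau>\<close> and lose the
  coefficient 1/2.\<close>

lemma kobayashi_metric_le_disc:
  assumes "ball c R \<subseteq> \<Omega>" "norm v = 1" "\<bar>\<rho>\<bar> < R"
  shows "kobayashi_metric \<Omega> (c + \<rho> *\<^sub>R v) v \<le> R / (R\<^sup>2 - \<rho>\<^sup>2)"
proof -
  have R: "0 < R" using assms(3) by simp
  define r where "r = \<rho> / R"
  have r: "\<bar>r\<bar> < 1" using assms(3) R by (simp add: r_def)
  then have r2: "r\<^sup>2 < 1" by (simp add: abs_square_less_1)
  define M where "M = Moebius_function 0 (of_real (- r))"
  have nrm: "norm (c *s v) = cmod c" for c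
    using assms(2) by (simp add: norm_smult)
  have M: "M holomorphic_on ball 0 1"
    unfolding M_def using r by (intro Moebius_function_holomorphic) simp
  have M1: "cmod (M z) < 1" if "cmod z < 1" for z
    unfolding M_def using r that by (intro Moebius_function_norm_lt_1) auto
  have D: "(M has_field_derivative of_real (1 - r\<^sup>2)) (at 0)"
    unfolding M_def Moebius_function_simple[abs_def]
    by (auto intro!: derivative_eq_intros simp: power2_eq_square)
  let ?f = "\<lambda>z. c + (of_real R * M z) *s v"
  have "kobayashi_disc \<Omega> (c + \<rho> *\<^sub>R v) v (of_real (1 / (R * (1 - r\<^sup>2)))) ?f"
  proof (rule kobayashi_discI)
    show "(\<lambda>z. ?f z $ i) holomorphic_on ball 0 1" for i
      using M by (auto intro!: holomorphic_intros)
    show "?f ` ball 0 1 \<subseteq> \<Omega>"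
      using M1 R by (intro image_subsetI subsetD[OF assms(1)]) (auto simp: dist_norm nrm norm_mult)
    show "?f 0 = c + \<rho> *\<^sub>R v"
      using R by (simp add: M_def Moebius_function_of_zero vec_eq_iff vec_scaleR_of_real r_def
          del: vector_scaleR_component)
    show "((\<lambda>z. ?f z $ i) has_field_derivative of_real (R * (1 - r\<^sup>2)) * v $ i) (at 0)" for i
      using D by (auto intro!: derivative_eq_intros)
    have "R * (1 - r\<^sup>2) * (1 / (R * (1 - r\<^sup>2))) = 1" using R r2 by simp
    then have "of_real (R * (1 - r\<^sup>2)) * complex_of_real (1 / (R * (1 - r\<^sup>2))) = 1"
      by (metis of_real_mult of_real_1)
    then show "of_real (R * (1 - r\<^sup>2)) * v $ i * complex_of_real (1 / (R * (1 - r\<^sup>2))) = v $ i" for i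
      by (metis mult.commute mult.left_commute mult_1)
  qed
  from kobayashi_metric_le[OF this]
  have "kobayashi_metric \<Omega> (c + \<rho> *\<^sub>R v) v \<le> 1 / (R * (1 - r\<^sup>2))"
    using R r2 by (simp only: norm_of_real) simp
  also have "R * (1 - r\<^sup>2) = (R\<^sup>2 - \<rho>\<^sup>2) / R"
    using R by (simp add: r_def field_simps power2_eq_square)
  finally show ?thesis by simp
qed

section \<open>Upper bounds for the distance from inscribed balls\<close>

context bounded_convex_domain
begin

text \<open>By convexity the two balls sweep out a tube of radius \<open>r\<close> around the
  segment.\<close>

lemma kobayashi_dist_le_balls:
  assumes x: "ball x r \<subseteq> \<Omega>" and y: "ball y r \<subseteq> \<Omega>" and r: "0 < r"
  shows "kobayashi_dist \<Omega> x y \<le> dist x y / r"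
proof (cases "x = y")
  case True
  moreover have "x \<in> \<Omega>" using x r by auto
  ultimately show ?thesis using kobayashi_dist_self[of x] by simp
next
  case False
  have B: "ball (linepath x y t) r \<subseteq> \<Omega>" if t: "t \<in> {0..1}" for t
  proof
    fix w assume w: "w \<in> ball (linepath x y t) r"
    define u where "u = w - linepath x y t"
    have "norm u < r" using w by (simp add: u_def dist_norm norm_minus_commute)
    then have "x + u \<in> \<Omega>" "y + u \<in> \<Omega>" using x y by (auto simp: dist_norm)
    then have "(1 - t) *\<^sub>R (x + u) + t *\<^sub>R (y + u) \<in> \<Omega>"
      using t by (intro convexD[OF cv]) auto
    also have "(1 - t) *\<^sub>R (x + u) + t *\<^sub>R (y + u) = w"
      by (simp add: u_def linepath_def algebra_simps)
    finally show "w \<in> \<Omega>" .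
  qed
  show ?thesis
  proof (rule kobayashi_dist_linepath_le)
    show "x \<in> \<Omega>" "y \<in> \<Omega>" using x y r by auto
    show "((\<lambda>_. dist x y / r) has_integral dist x y / r) {0..1::real}"
      using has_integral_const_real[of "dist x y / r" 0 1] by simp
    show "kobayashi_metric \<Omega> (linepath x y t) (y - x) \<le> dist x y / r" if "t \<in> {0..1}" for t
      using kobayashi_metric_le_ball[OF B[OF that] r, of "y - x"] False
      by (simp add: dist_norm norm_minus_commute)
  qed
qed

lemma kobayashi_dist_near:
  assumes "x \<in> \<Omega>" "dist x y \<le> bdist \<Omega> x / 2"
  shows "kobayashi_dist \<Omega> x y \<le> 2 * dist x y / bdist \<Omega> x"
proof -
  have b: "0 < bdist \<Omega> x" using bdist_pos assms by simp
  have "ball y (bdist \<Omega> x / 2) \<subseteq> ball x (bdist \<Omega> x)" "ball x (bdist \<Omega> x / 2) \<subseteq> ball x (bdist \<Omega> x)"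
    using assms(2) b by (auto simp: ball_subset_ball_iff dist_commute)
  then have "ball y (bdist \<Omega> x / 2) \<subseteq> \<Omega>" "ball x (bdist \<Omega> x / 2) \<subseteq> \<Omega>"
    using ball_bdist[OF assms(1)] by auto
  then show ?thesis
    using kobayashi_dist_le_balls[of x "bdist \<Omega> x / 2" y] b by (simp add: mult.commute)
qed

end

text \<open>With \<open>e i\<close> bounding the oscillation of the normal at scale \<open>2\<^sup>-\<^sup>i\<close>, the quantity \<open>E k\<close> below
  is comparable to \<open>\<epsilon> \<integral>\<^sub>\<epsilon>\<^sup>1 \<omega>(t)/t\<^sup>2 dt\<close> for \<open>\<epsilon> = 2\<^sup>-\<^sup>k\<close>: this majorant of the modulus of continuity
  decays at most linearly in \<open>\<epsilon>\<close> and inherits the Dini condition.\<close>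

locale dini_modulus = dini_convex_domain \<Omega> for \<Omega> :: "(complex^'n) set" +
  fixes e :: "nat \<Rightarrow> real"
  assumes sum_e: "summable e" and e_nonneg: "\<And>k. 0 \<le> e k" and e0: "e 0 = 2"
    and e_normal: "\<And>k x y. x \<in> frontier \<Omega> \<Longrightarrow> y \<in> frontier \<Omega> \<Longrightarrow> dist x y < (1/2) ^ k \<Longrightarrow>
       norm (outer_unit_normal \<Omega> x - outer_unit_normal \<Omega> y) \<le> e k"
begin

definition E :: "nat \<Rightarrow> real" where
  "E k = (\<Sum>i\<le>k. e i * (1/2) ^ (k - i))"

lemma summable_E: "summable E"
  unfolding E_def[abs_def]
  by (rule summable_Cauchy_product) (use sum_e e_nonneg in auto)

lemma E_ge: "i \<le> k \<Longrightarrow> e i * (1/2) ^ (k - i) \<le> E k"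
  unfolding E_def by (rule member_le_sum[of i "{..k}"]) (auto simp: e_nonneg)

lemma E_pos: "0 < E k"
  using E_ge[of 0 k] e0 by (simp add: less_le_trans[rotated])

text \<open>A ball of radius \<open>R\<close> much larger than \<open>\<epsilon> = 2\<^sup>-\<^sup>k\<close> that misses the boundary point \<open>p\<close> only by
  a distance \<open>s\<close> much smaller than \<open>\<epsilon>\<close>.\<close>

lemma interior_ball:
  assumes p: "p \<in> frontier \<Omega>" and E: "E k \<le> 1/16"
  defines "\<epsilon> \<equiv> (1/2::real) ^ k"
  defines "s \<equiv> 2 * \<epsilon> * E k" and "R \<equiv> \<epsilon> / (8 * E k)"
  shows "ball (p - (R + s) *\<^sub>R \<n> p) R \<subseteq> \<Omega>"
proof (rule ccontr)
  assume "\<not> ?thesis"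
  then obtain z where z: "z \<in> ball (p - (R + s) *\<^sub>R \<n> p) R" "z \<notin> \<Omega>" by blast
  have \<epsilon>: "0 < \<epsilon>" by (simp add: \<epsilon>_def)
  have s: "0 < s" and R: "0 < R" using \<epsilon> E_pos by (simp_all add: s_def R_def)
  define y where "y = norm (z - p)"
  define a where "a = (p - z) \<bullet> \<n> p"
  have y0: "0 \<le> y" by (simp add: y_def)
  obtain q where q: "q \<in> frontier \<Omega>" "dist q p \<le> y" "a \<le> y * norm (\<n> q - \<n> p)"
    using depth_outside_le[OF z(2) p] unfolding y_def a_def by blast
  have nn: "\<n> p \<bullet> \<n> p = 1" using norm_normal[OF p] by (simp add: dot_square_norm)
  \<comment> \<open>Expanding this square forces the depth \<open>a\<close> to be large; the slow
    turning of the normal will force it to be small.\<close>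
  have "(norm (z - (p - (R + s) *\<^sub>R \<n> p)))\<^sup>2 < R\<^sup>2"
    using z(1) R by (intro power_strict_mono) (auto simp: dist_norm norm_minus_commute)
  also have "(norm (z - (p - (R + s) *\<^sub>R \<n> p)))\<^sup>2 = y\<^sup>2 - 2 * (R + s) * a + (R + s)\<^sup>2"
    using nn unfolding y_def a_def power2_norm_eq_inner
    by (simp add: inner_diff inner_add inner_commute algebra_simps power2_eq_square)
  finally have ball: "y\<^sup>2 + 2 * R * s + s\<^sup>2 < 2 * (R + s) * a"
    by (simp add: power2_eq_square algebra_simps)
  \<comment> \<open>Three ranges of \<open>y\<close>: below \<open>\<epsilon>\<close> the term
    \<open>e k\<close> suffices; between \<open>\<epsilon>\<close> and 1 the term \<open>e j\<close>
    of the matching scale occurs in \<open>E k\<close> with weight \<open>(1/2) ^ (k - j)\<close>;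
    beyond 1 the trivial bound 2 is the term \<open>e 0\<close> of \<open>E k\<close>.\<close>
  have "y * norm (\<n> q - \<n> p) \<le> 2 * E k * y\<^sup>2 / \<epsilon> + \<epsilon> * E k"
  proof -
    consider "y < \<epsilon>" | "\<epsilon> \<le> y" "y < 1" | "1 \<le> y" by linarith
    then show ?thesis
    proof cases
      case 1
      then have "norm (\<n> q - \<n> p) \<le> e k" using e_normal q p by (simp add: \<epsilon>_def)
      also have "\<dots> \<le> E k" using E_ge[of k k] by simp
      finally have "y * norm (\<n> q - \<n> p) \<le> \<epsilon> * E k" using 1 \<epsilon> by (intro mult_mono) auto
      moreover have "0 \<le> 2 * E k * y\<^sup>2 / \<epsilon>" using E_pos[of k] \<epsilon> by simp
      ultimately show ?thesis by linarith
    next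
      case 2
      then have "0 < y" using \<epsilon> by simp
      then obtain j where j: "(1/2) ^ Suc j \<le> y" "y < (1/2) ^ j" using ex_dyadic'[of y 0] 2 by auto
      have jk: "j \<le> k"
      proof (rule ccontr)
        assume "\<not> j \<le> k"
        then have "(1/2::real) ^ j \<le> (1/2) ^ k" by (intro power_decreasing) auto
        then show False using j 2 unfolding \<epsilon>_def by linarith
      qed
      have "norm (\<n> q - \<n> p) \<le> e j" using e_normal q p j by force
      have "e j * \<epsilon> = e j * (1/2) ^ (k - j) * (1/2) ^ j"
        using jk by (simp add: \<epsilon>_def flip: power_add)
      also have "\<dots> \<le> E k * (2 * y)"
        using E_ge[OF jk] j E_pos[of k] by (intro mult_mono) auto
      finally have "e j \<le> 2 * E k * y / \<epsilon>" using \<epsilon> by (simp add: field_simps)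
      then have "norm (\<n> q - \<n> p) \<le> 2 * E k * y / \<epsilon>" using \<open>norm (\<n> q - \<n> p) \<le> e j\<close> by linarith
      then have "y * norm (\<n> q - \<n> p) \<le> y * (2 * E k * y / \<epsilon>)" using y0 by (rule mult_left_mono)
      also have "\<dots> = 2 * E k * y\<^sup>2 / \<epsilon>" by (simp add: power2_eq_square)
      finally show ?thesis using mult_pos_pos[OF \<epsilon> E_pos[of k]] by linarith
    next
      case 3
      have "norm (\<n> q - \<n> p) \<le> 2"
        using norm_triangle_ineq4[of "\<n> q" "\<n> p"] norm_normal q p by simp
      moreover have "2 * \<epsilon> \<le> E k" using E_ge[of 0 k] e0 by (simp add: \<epsilon>_def)
      then have "2 \<le> 2 * E k * 1 / \<epsilon>" using \<epsilon> by (simp add: field_simps)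
      moreover have "2 * E k * 1 / \<epsilon> \<le> 2 * E k * y / \<epsilon>"
        using 3 \<epsilon> E_pos[of k] by (intro divide_right_mono mult_left_mono) auto
      ultimately have "norm (\<n> q - \<n> p) \<le> 2 * E k * y / \<epsilon>" by linarith
      then have "y * norm (\<n> q - \<n> p) \<le> y * (2 * E k * y / \<epsilon>)" using y0 by (rule mult_left_mono)
      also have "\<dots> = 2 * E k * y\<^sup>2 / \<epsilon>" by (simp add: power2_eq_square)
      finally show ?thesis using mult_pos_pos[OF \<epsilon> E_pos[of k]] by linarith
    qed
  qed
  \<comment> \<open>\<open>R\<close> and \<open>s\<close> are chosen to give these two terms. With
    \<open>s \<le> R\<close> they yield
    \<open>2 * (R + s) * a \<le> y\<^sup>2 + R * s + s\<^sup>2\<close>, short by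
    \<open>R * s\<close> of what membership in the ball requires.\<close>
  also have "2 * E k * y\<^sup>2 / \<epsilon> + \<epsilon> * E k = y\<^sup>2 / (4 * R) + s / 2"
    using \<epsilon> E_pos[of k] by (simp add: R_def s_def)
  finally have a: "a \<le> y\<^sup>2 / (4 * R) + s / 2" using q(3) by linarith
  have "E k * E k \<le> 1/16 * (1/16)" using E E_pos[of k] by (intro mult_mono) auto
  then have "s \<le> R"
    using \<epsilon> E_pos[of k] by (simp add: s_def R_def field_simps power2_eq_square)
  have "2 * (R + s) * a \<le> 2 * (R + s) * (y\<^sup>2 / (4 * R) + s / 2)"
    using a R s by (intro mult_left_mono) auto
  also have "\<dots> = 2 * (R + s) / (4 * R) * y\<^sup>2 + (R * s + s\<^sup>2)"
    using R by (simp add: field_simps power2_eq_square)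
  also have "2 * (R + s) / (4 * R) \<le> 1" using \<open>s \<le> R\<close> R by simp
  then have "2 * (R + s) / (4 * R) * y\<^sup>2 \<le> 1 * y\<^sup>2" by (rule mult_right_mono) simp
  finally have "2 * (R + s) * a \<le> y\<^sup>2 + (R * s + s\<^sup>2)" by simp
  then show False using ball mult_pos_pos[OF R s] by linarith
qed

text \<open>The point at depth \<open>t\<close> below \<open>p\<close> is at depth
  \<open>t - s\<close> in the ball of \<open>interior_ball\<close>. Both the shift \<open>s\<close>
  and the curvature of the ball change the half-plane value \<open>1 / (2 * t)\<close> by at most a
  multiple of \<open>E k / \<epsilon>\<close>.\<close>

lemma near_normal_bounds:
  assumes p: "p \<in> frontier \<Omega>" and E: "E k \<le> 1/16"
  defines "\<epsilon> \<equiv> (1/2::real) ^ k"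
  assumes t: "\<epsilon> \<le> t" "t \<le> 2 * \<epsilon>"
  shows "ball (p - t *\<^sub>R \<n> p) (t / 2) \<subseteq> \<Omega>"
    and "kobayashi_metric \<Omega> (p - t *\<^sub>R \<n> p) (\<n> p) \<le> 1 / (2 * t) + 6 * E k / \<epsilon>"
proof -
  define s where "s = 2 * \<epsilon> * E k"
  define R where "R = \<epsilon> / (8 * E k)"
  define c where "c = p - (R + s) *\<^sub>R \<n> p"
  define \<tau> where "\<tau> = t - s"
  note Ek = E_pos[of k]
  have \<epsilon>: "0 < \<epsilon>" by (simp add: \<epsilon>_def)
  have B: "ball c R \<subseteq> \<Omega>"
    unfolding c_def s_def R_def \<epsilon>_def by (rule interior_ball[OF p E])
  have s: "0 < s" "s \<le> \<epsilon> / 8"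
    using \<epsilon> Ek E mult_left_mono[OF E, of "2 * \<epsilon>"] by (simp_all add: s_def)
  have R: "2 * \<epsilon> \<le> R" using \<epsilon> Ek E by (simp add: R_def field_simps)
  have \<tau>: "t / 2 \<le> \<tau>" "7 / 8 * \<epsilon> \<le> \<tau>" "\<tau> \<le> R" "0 < \<tau>" "\<tau> \<le> t" using s t \<epsilon> R by (simp_all add: \<tau>_def)
  have n: "norm (\<n> p) = 1" by (rule norm_normal[OF p])
  have z: "p - t *\<^sub>R \<n> p = c + (R - \<tau>) *\<^sub>R \<n> p" by (simp add: c_def \<tau>_def algebra_simps)
  have "ball (p - t *\<^sub>R \<n> p) (t / 2) \<subseteq> ball c R"
    unfolding z using \<tau> n R \<epsilon> by (simp add: ball_subset_ball_iff dist_norm)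
  then show "ball (p - t *\<^sub>R \<n> p) (t / 2) \<subseteq> \<Omega>" using B by blast
  have "kobayashi_metric \<Omega> (p - t *\<^sub>R \<n> p) (\<n> p) \<le> R / (R\<^sup>2 - (R - \<tau>)\<^sup>2)"
    unfolding z using \<tau> R \<epsilon> by (intro kobayashi_metric_le_disc[OF B n]) auto
  also have "R\<^sup>2 - (R - \<tau>)\<^sup>2 = \<tau> * (2 * R - \<tau>)" by (simp add: power2_eq_square algebra_simps)
  \<comment> \<open>Partial fractions separate the near side of the ball, which carries the main
    term, from the far side, which is an error of order \<open>1 / R\<close>.\<close>
  also have "R / (\<tau> * (2 * R - \<tau>)) = 1/2 * (1 / \<tau> + 1 / (2 * R - \<tau>))"
    using \<tau> R \<epsilon> by (simp add: field_simps)
  also have "1 / \<tau> \<le> 1 / t + 4 * E k / \<epsilon>"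
  proof -
    have "\<epsilon> * (7 / 8 * \<epsilon>) \<le> t * \<tau>" using \<tau> t \<epsilon> by (intro mult_mono) auto
    then have "s / (t * \<tau>) \<le> s / (\<epsilon> * (7 / 8 * \<epsilon>))"
      using s \<epsilon> t \<tau> by (intro divide_left_mono mult_pos_pos) auto
    also have "\<dots> \<le> 4 * E k / \<epsilon>" using \<epsilon> Ek by (simp add: s_def field_simps)
    finally have "s / (t * \<tau>) \<le> 4 * E k / \<epsilon>" .
    moreover have "1 / \<tau> = 1 / t + s / (t * \<tau>)" using \<tau> t \<epsilon> by (simp add: \<tau>_def field_simps)
    ultimately show ?thesis by simp
  qed
  also have "1 / (2 * R - \<tau>) \<le> 8 * E k / \<epsilon>"
  proof -
    have "1 / (2 * R - \<tau>) \<le> 1 / R" using \<tau> R \<epsilon> by (intro divide_left_mono mult_pos_pos) auto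
    then show ?thesis by (simp add: R_def)
  qed
  also have "1 / 2 * (1 / t + 4 * E k / \<epsilon> + 8 * E k / \<epsilon>) = 1 / (2 * t) + 6 * E k / \<epsilon>"
    by (simp add: field_simps)
  finally show "kobayashi_metric \<Omega> (p - t *\<^sub>R \<n> p) (\<n> p) \<le> 1 / (2 * t) + 6 * E k / \<epsilon>"
    by simp
qed

lemma has_integral_half_ln2: "((\<lambda>t. 1 / (2 * (2 - t))) has_integral ln 2 / 2) {0..1::real}"
proof -
  have "((\<lambda>t. 1 / (2 * (2 - t))) has_integral (- ln (2 - 1) / 2 - - ln (2 - 0) / 2)) {0..1::real}"
    by (rule fundamental_theorem_of_calculus)
       (auto intro!: derivative_eq_intros simp: divide_simps
         has_real_derivative_iff_has_vector_derivative[symmetric])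
  then show ?thesis by simp
qed

text \<open>The main term integrates to exactly half the logarithm of the ratio of the two heights;
  the error no longer depends on the scale except through the summable \<open>E\<close>.\<close>

lemma kobayashi_dist_dyadic_step:
  assumes p: "p \<in> frontier \<Omega>" and E: "E (Suc k) \<le> 1/16"
  shows "kobayashi_dist \<Omega> (p - (1/2) ^ Suc k *\<^sub>R \<n> p) (p - (1/2) ^ k *\<^sub>R \<n> p) \<le> ln 2 / 2 + 6 * E (Suc k)"
proof -
  define \<epsilon> :: real where "\<epsilon> = (1/2) ^ Suc k"
  have \<epsilon>: "0 < \<epsilon>" "(1/2) ^ k = 2 * \<epsilon>" by (simp_all add: \<epsilon>_def)
  note B = near_normal_bounds[OF p E, folded \<epsilon>_def]
  have in\<Omega>: "p - t *\<^sub>R \<n> p \<in> \<Omega>" if "\<epsilon> \<le> t" "t \<le> 2 * \<epsilon>" for t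
    using B(1)[OF that] that \<epsilon> by (intro subsetD[OF B(1)[OF that]]) simp
  have "kobayashi_dist \<Omega> (p - (2 * \<epsilon>) *\<^sub>R \<n> p) (p - \<epsilon> *\<^sub>R \<n> p) \<le> ln 2 / 2 + 6 * E (Suc k)"
  proof (rule kobayashi_dist_linepath_le)
    show "p - (2 * \<epsilon>) *\<^sub>R \<n> p \<in> \<Omega>" "p - \<epsilon> *\<^sub>R \<n> p \<in> \<Omega>" using in\<Omega> \<epsilon> by auto
    show "((\<lambda>t. 1 / (2 * (2 - t)) + 6 * E (Suc k)) has_integral ln 2 / 2 + 6 * E (Suc k)) {0..1}"
      using has_integral_add[OF has_integral_half_ln2 has_integral_const_real[of "6 * E (Suc k)" 0 1]] by simp
    fix t :: real assume t: "t \<in> {0..1}"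
    have "(1 - t) *\<^sub>R (p - a *\<^sub>R w) + t *\<^sub>R (p - b *\<^sub>R w) = p - ((1 - t) * a + t * b) *\<^sub>R w" for a b w
      by (simp add: algebra_simps)
    moreover have "(1 - t) * (2 * \<epsilon>) + t * \<epsilon> = (2 - t) * \<epsilon>" by (simp add: algebra_simps)
    ultimately have l: "linepath (p - (2 * \<epsilon>) *\<^sub>R \<n> p) (p - \<epsilon> *\<^sub>R \<n> p) t = p - ((2 - t) * \<epsilon>) *\<^sub>R \<n> p"
      unfolding linepath_def by metis
    have "p - a *\<^sub>R w - (p - b *\<^sub>R w) = (b - a) *\<^sub>R w" for a b w by (simp add: algebra_simps)
    from this[of \<epsilon> "\<n> p" "2 * \<epsilon>"]
    have v: "p - \<epsilon> *\<^sub>R \<n> p - (p - (2 * \<epsilon>) *\<^sub>R \<n> p) = \<epsilon> *\<^sub>R \<n> p" by simp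
    have t': "\<epsilon> \<le> (2 - t) * \<epsilon>" "(2 - t) * \<epsilon> \<le> 2 * \<epsilon>" using t \<epsilon> by auto
    have "kobayashi_metric \<Omega> (p - ((2 - t) * \<epsilon>) *\<^sub>R \<n> p) (\<epsilon> *\<^sub>R \<n> p)
        = \<epsilon> * kobayashi_metric \<Omega> (p - ((2 - t) * \<epsilon>) *\<^sub>R \<n> p) (\<n> p)"
      using kobayashi_metric_scale[OF op in\<Omega>[OF t']] \<epsilon> by simp
    also have "\<dots> \<le> \<epsilon> * (1 / (2 * ((2 - t) * \<epsilon>)) + 6 * E (Suc k) / \<epsilon>)"
      using B(2)[OF t'] \<epsilon> by (intro mult_left_mono) auto
    also have "\<dots> = 1 / (2 * (2 - t)) + 6 * E (Suc k)" using \<epsilon> t by (simp add: field_simps)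
    finally show "kobayashi_metric \<Omega> (linepath (p - (2 * \<epsilon>) *\<^sub>R \<n> p) (p - \<epsilon> *\<^sub>R \<n> p) t)
       (p - \<epsilon> *\<^sub>R \<n> p - (p - (2 * \<epsilon>) *\<^sub>R \<n> p)) \<le> 1 / (2 * (2 - t)) + 6 * E (Suc k)"
      unfolding l v .
  qed
  then show ?thesis
    using kobayashi_dist_commute[OF in\<Omega> in\<Omega>, of "2 * \<epsilon>" \<epsilon>] \<epsilon> by (simp only: \<epsilon>_def[symmetric] \<epsilon>(2))
qed

text \<open>Equality case of Cauchy-Schwarz: \<open>p - x\<close> has length
  \<open>bdist \<Omega> x\<close> and its product with the unit normal is at least that
  large.\<close>

lemma nearest_point_normal:
  assumes "x \<in> \<Omega>"
  obtains p where "p \<in> frontier \<Omega>" "x = p - bdist \<Omega> x *\<^sub>R \<n> p"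
proof -
  obtain p where p: "p \<in> frontier \<Omega>" "dist x p = bdist \<Omega> x" using bdist_attained .
  have le: "bdist \<Omega> x \<le> (p - x) \<bullet> \<n> p"
    by (rule bdist_le_supporting[OF assms norm_normal[OF p(1)] normal_supporting[OF p(1)]])
  define b where "b = bdist \<Omega> x"
  have b: "0 < b" unfolding b_def by (rule bdist_pos[OF assms])
  define d where "d = p - x"
  have "norm d = b" using p(2) by (simp add: b_def d_def dist_norm norm_minus_commute)
  then have "d \<bullet> d = b\<^sup>2" by (simp add: dot_square_norm)
  moreover have "\<n> p \<bullet> \<n> p = 1" using norm_normal[OF p(1)] by (simp add: dot_square_norm)
  ultimately have "(d - b *\<^sub>R \<n> p) \<bullet> (d - b *\<^sub>R \<n> p) = 2 * b\<^sup>2 - 2 * b * (d \<bullet> \<n> p)"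
    by (simp add: inner_diff inner_commute power2_eq_square algebra_simps)
  also have "\<dots> = 2 * b * (b - d \<bullet> \<n> p)" by (simp add: power2_eq_square algebra_simps)
  also have "\<dots> \<le> 0" using le b by (simp add: b_def d_def mult_le_0_iff)
  finally have "d = b *\<^sub>R \<n> p" by (metis inner_eq_zero_iff inner_ge_zero order_antisym right_minus_eq)
  then have "x = p - bdist \<Omega> x *\<^sub>R \<n> p" by (simp add: d_def b_def algebra_simps)
  then show ?thesis using that p(1) by blast
qed

text \<open>Climb from \<open>x\<close> along the normal at its nearest boundary point, one dyadic
  height at a time. The main terms add up to half the logarithm of the ratio of heights and the
  errors to a constant.\<close>

lemma ascend_dyadic:
  "\<exists>k C. \<forall>x\<in>\<Omega>. \<forall>j\<ge>k. bdist \<Omega> x \<le> (1/2) ^ j \<longrightarrow>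
     (\<exists>x'. ball x' ((1/2) ^ j / 2) \<subseteq> \<Omega> \<and> dist x x' \<le> (1/2) ^ j \<and>
        kobayashi_dist \<Omega> x x' \<le> ln ((1/2) ^ j / bdist \<Omega> x) / 2 + C)"
proof -
  have "E \<longlonglongrightarrow> 0" by (rule summable_LIMSEQ_zero[OF summable_E])
  then have "\<forall>\<^sub>F k in sequentially. E k < 1/16" by (rule order_tendstoD) simp
  then obtain k1 where k1: "\<And>k. k1 \<le> k \<Longrightarrow> E k \<le> 1/16"
    by (auto simp: eventually_sequentially intro: less_imp_le)
  \<comment> \<open>The 1 pays for the incomplete first step from \<open>x\<close> to the next
    dyadic height, the series for all later steps.\<close>
  let ?C = "1 + 6 * suminf E"
  show ?thesis
  proof (intro exI[of _ k1] exI[of _ ?C] ballI allI impI)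
    fix x j assume x: "x \<in> \<Omega>" and j: "k1 \<le> j" and le: "bdist \<Omega> x \<le> (1/2) ^ j"
    define b where "b = bdist \<Omega> x"
    have b: "0 < b" unfolding b_def by (rule bdist_pos[OF x])
    obtain p where p: "p \<in> frontier \<Omega>" "x = p - b *\<^sub>R \<n> p"
      using nearest_point_normal[OF x] unfolding b_def by blast
    obtain k where k: "j \<le> k" "(1/2) ^ Suc k < b" "b \<le> (1/2) ^ k"
      using ex_dyadic[OF b] le b_def by blast
    let ?h = "\<lambda>i::nat. (1/2::real) ^ i"
    define X where "X = (\<lambda>i. p - ?h i *\<^sub>R \<n> p)"
    have ball: "ball (X i) (?h i / 2) \<subseteq> \<Omega>" if "j \<le> i" for i
      unfolding X_def using near_normal_bounds(1)[OF p(1) k1, of i "?h i"] that j by simp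
    have X: "X i \<in> \<Omega>" if "j \<le> i" for i
      using ball[OF that] by (rule subsetD) simp
    have dX: "dist x (X i) = \<bar>?h i - b\<bar>" for i
    proof -
      have "x - X i = (?h i - b) *\<^sub>R \<n> p" by (simp add: p(2)[symmetric] X_def) (simp add: p(2) algebra_simps)
      then show ?thesis using norm_normal[OF p(1)] by (simp add: dist_norm)
    qed
    have "kobayashi_dist \<Omega> x (X k) \<le> dist x (X k) / (?h k / 2)"
    proof (rule kobayashi_dist_le_balls[OF _ ball[OF k(1)]])
      have "ball x (?h k / 2) \<subseteq> ball x b" using k(2) by (simp add: subset_ball)
      then show "ball x (?h k / 2) \<subseteq> \<Omega>" using ball_bdist[OF x] unfolding b_def by blast
    qed simp
    also have "\<dots> \<le> 1" using dX[of k] k by simp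
    finally have 1: "kobayashi_dist \<Omega> x (X k) \<le> 1" .
    have "kobayashi_dist \<Omega> (X i) (X j) \<le> (real i - real j) * ln 2 / 2 + 6 * sum E {..i}" if "j \<le> i" for i
      using that
    proof (induction rule: dec_induct)
      case base
      then show ?case using kobayashi_dist_self[OF X[of j]] by (simp add: sum_nonneg less_imp_le[OF E_pos])
    next
      case (step i)
      have "kobayashi_dist \<Omega> (X (Suc i)) (X i) \<le> ln 2 / 2 + 6 * E (Suc i)"
        unfolding X_def using step j by (intro kobayashi_dist_dyadic_step p k1) simp
      moreover have "kobayashi_dist \<Omega> (X (Suc i)) (X j) \<le> kobayashi_dist \<Omega> (X (Suc i)) (X i) + kobayashi_dist \<Omega> (X i) (X j)"
        using step by (intro kobayashi_dist_triangle X) auto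
      moreover have "(real (Suc i) - real j) * ln 2 / 2 = (real i - real j) * ln 2 / 2 + ln 2 / 2"
        by (simp add: field_simps)
      moreover have "a \<le> n + 6 * (s + r)" if "b \<le> l + 6 * r" "a \<le> b + c" "n = m + l" "c \<le> m + 6 * s"
        for a b c l m n r s :: real using that by simp
      ultimately show ?case using step.IH unfolding sum.atMost_Suc by blast
    qed
    from this[OF k(1)] have "kobayashi_dist \<Omega> (X k) (X j) \<le> real (k - j) * ln 2 / 2 + 6 * sum E {..k}"
      using k(1) by (simp add: of_nat_diff)
    moreover have "sum E {..k} \<le> suminf E"
      by (rule sum_le_suminf[OF summable_E]) (auto intro: less_imp_le[OF E_pos])
    moreover have "real (k - j) * ln 2 \<le> ln (?h j / b)"
    proof -
      have "real (k - j) * ln 2 = ln (2 ^ (k - j))" by (simp add: ln_realpow)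
      also have "(2::real) ^ (k - j) = ?h j / ?h k" using k(1) by (simp add: power_diff power_one_over)
      also have "ln (?h j / ?h k) \<le> ln (?h j / b)"
        using b k(3) by (intro ln_mono divide_left_mono) (auto intro: divide_pos_pos)
      finally show ?thesis .
    qed
    moreover have "kobayashi_dist \<Omega> x (X j) \<le> kobayashi_dist \<Omega> x (X k) + kobayashi_dist \<Omega> (X k) (X j)"
      using k by (intro kobayashi_dist_triangle X x) auto
    ultimately have "kobayashi_dist \<Omega> x (X j) \<le> ln (?h j / b) / 2 + ?C" using 1 by (simp add: algebra_simps)
    moreover have "dist x (X j) \<le> ?h j" using dX[of j] le b by (simp add: b_def)
    ultimately show "\<exists>x'. ball x' (?h j / 2) \<subseteq> \<Omega> \<and> dist x x' \<le> ?h j \<and>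
        kobayashi_dist \<Omega> x x' \<le> ln (?h j / bdist \<Omega> x) / 2 + ?C"
      using ball[of j] unfolding b_def by blast
  qed
qed

end

section \<open>Climbing to a prescribed height and crossing there\<close>

context dini_convex_domain
begin

text \<open>\<open>ascend_dyadic\<close> freed from dyadic heights and from the smallness of the
  height, at the price of a constant depending on \<open>H\<close>.\<close>

lemma ascend:
  fixes H :: real
  obtains C where "1 \<le> C" "\<And>x h. x \<in> \<Omega> \<Longrightarrow> bdist \<Omega> x \<le> h \<Longrightarrow> h \<le> H \<Longrightarrow>
     \<exists>x'. ball x' (h / C) \<subseteq> \<Omega> \<and> dist x x' \<le> C * h \<and> kobayashi_dist \<Omega> x x' \<le> ln (h / bdist \<Omega> x) / 2 + C"
proof -
  obtain e :: "nat \<Rightarrow> real" where e: "summable e" "\<And>k. 0 \<le> e k" "e 0 = 2"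
    "\<And>k x y. x \<in> frontier \<Omega> \<Longrightarrow> y \<in> frontier \<Omega> \<Longrightarrow> dist x y < (1/2) ^ k \<Longrightarrow> norm (\<n> x - \<n> y) \<le> e k"
    using dyadic_normal_modulus by blast
  interpret dini_modulus \<Omega> e by unfold_locales (use e in auto)
  obtain k1 C1 where C1: "\<And>x j. x \<in> \<Omega> \<Longrightarrow> k1 \<le> j \<Longrightarrow> bdist \<Omega> x \<le> (1/2) ^ j \<Longrightarrow>
     \<exists>x'. ball x' ((1/2) ^ j / 2) \<subseteq> \<Omega> \<and> dist x x' \<le> (1/2) ^ j \<and>
        kobayashi_dist \<Omega> x x' \<le> ln ((1/2) ^ j / bdist \<Omega> x) / 2 + C1"
    using ascend_dyadic by blast
  define h0 :: real where "h0 = (1/2) ^ k1"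
  have h0: "0 < h0" by (simp add: h0_def)
  \<comment> \<open>The entry 2 absorbs the rounding to a dyadic height,
    \<open>\<bar>C1\<bar> + 1\<close> its logarithm, and \<open>2 * H / h0\<close> makes balls of
    radius \<open>h / C\<close> fit at height \<open>h0\<close> even for
    \<open>h = H\<close>.\<close>
  define C where "C = max 2 (max (\<bar>C1\<bar> + 1) (2 * H / h0))"
  have C: "2 \<le> C" "\<bar>C1\<bar> + 1 \<le> C" "2 * H / h0 \<le> C" by (simp_all add: C_def)
  show ?thesis
  proof (rule that)
    show "1 \<le> C" using C by simp
    fix x h assume x: "x \<in> \<Omega>" and h: "bdist \<Omega> x \<le> h" "h \<le> H"
    have b: "0 < bdist \<Omega> x" by (rule bdist_pos[OF x])
    then have h_pos: "0 < h" using h by linarith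
    show "\<exists>x'. ball x' (h / C) \<subseteq> \<Omega> \<and> dist x x' \<le> C * h \<and> kobayashi_dist \<Omega> x x' \<le> ln (h / bdist \<Omega> x) / 2 + C"
    proof (cases "h \<le> h0")
      case True
      then obtain j where j: "k1 \<le> j" "(1/2) ^ Suc j < h" "h \<le> (1/2) ^ j"
        using ex_dyadic[OF h_pos] unfolding h0_def by blast
      then obtain x' where x': "ball x' ((1/2) ^ j / 2) \<subseteq> \<Omega>" "dist x x' \<le> (1/2) ^ j"
        "kobayashi_dist \<Omega> x x' \<le> ln ((1/2) ^ j / bdist \<Omega> x) / 2 + C1"
        using C1[OF x j(1)] h by auto
      have "h / C \<le> h / 2" using C h_pos by (intro divide_left_mono) auto
      also have "\<dots> \<le> (1/2) ^ j / 2" using j by simp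
      finally have B: "ball x' (h / C) \<subseteq> \<Omega>" using x'(1) subset_ball by blast
      have d: "dist x x' \<le> C * h"
        using x'(2) j(2) mult_right_mono[OF C(1) less_imp_le[OF h_pos]] unfolding power_Suc by linarith
      have "ln ((1/2) ^ j / bdist \<Omega> x) \<le> ln (2 * (h / bdist \<Omega> x))"
        using j b h_pos by (intro ln_mono) (auto simp: divide_right_mono intro!: divide_pos_pos)
      moreover have "ln (2 * (h / bdist \<Omega> x)) = ln 2 + ln (h / bdist \<Omega> x)"
        using b h_pos by (intro ln_mult_pos divide_pos_pos) auto
      ultimately have "kobayashi_dist \<Omega> x x' \<le> ln (h / bdist \<Omega> x) / 2 + C"
        using x'(3) C(2) ln_2_less_1 by linarith
      then show ?thesis using B d by blast
    next
      case False
      have "h / C \<le> H / C" using h C by (intro divide_right_mono) auto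
      also have "\<dots> \<le> h0 / 2" using C h0 by (simp add: field_simps)
      finally have hC: "h / C \<le> h0 / 2" .
      have Ch: "h \<le> C * h" using mult_right_mono[of 1 C h] C h_pos by simp
      show ?thesis
      \<comment> \<open>Heights between \<open>h0\<close> and \<open>H\<close> are comparable: it
        suffices to climb to \<open>h0\<close>, or to stay at \<open>x\<close> if it is already
        higher.\<close>
      proof (cases "bdist \<Omega> x \<le> h0")
        case True
        then obtain x' where x': "ball x' (h0 / 2) \<subseteq> \<Omega>" "dist x x' \<le> h0"
          "kobayashi_dist \<Omega> x x' \<le> ln (h0 / bdist \<Omega> x) / 2 + C1"
          using C1[OF x order_refl] unfolding h0_def by blast
        have "ln (h0 / bdist \<Omega> x) \<le> ln (h / bdist \<Omega> x)"
          using False b h0 by (intro ln_mono) (auto simp: divide_right_mono intro!: divide_pos_pos)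
        moreover have "ball x' (h / C) \<subseteq> \<Omega>" using x'(1) hC subset_ball by blast
        ultimately show ?thesis using x' False C Ch by (intro exI[of _ x']) auto
      next
        case far: False
        have "ball x (h / C) \<subseteq> ball x (bdist \<Omega> x)" using hC far h0 by (intro subset_ball) linarith
        then have "ball x (h / C) \<subseteq> \<Omega>" using ball_bdist[OF x] by blast
        moreover have "0 \<le> ln (h / bdist \<Omega> x)" using h b by simp
        ultimately show ?thesis
          using kobayashi_dist_self[OF x] C h_pos by (intro exI[of _ x]) auto
      qed
    qed
  qed
qed

text \<open>Raise both points to height twice their distance; there the balls have radius comparable
  to the gap, so crossing has bounded cost.\<close>

lemma kobayashi_dist_far:
  obtains C where "0 < C" "\<And>x y. x \<in> \<Omega> \<Longrightarrow> y \<in> \<Omega> \<Longrightarrow>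
    bdist \<Omega> x \<le> 2 * dist x y \<Longrightarrow> bdist \<Omega> y \<le> 2 * dist x y \<Longrightarrow>
    sqrt (bdist \<Omega> x * bdist \<Omega> y) * exp (kobayashi_dist \<Omega> x y) \<le> C * dist x y"
proof -
  obtain C where C: "1 \<le> C" "\<And>x h. x \<in> \<Omega> \<Longrightarrow> bdist \<Omega> x \<le> h \<Longrightarrow> h \<le> 2 * diameter \<Omega> \<Longrightarrow>
     \<exists>x'. ball x' (h / C) \<subseteq> \<Omega> \<and> dist x x' \<le> C * h \<and> kobayashi_dist \<Omega> x x' \<le> ln (h / bdist \<Omega> x) / 2 + C"
    using ascend[of "2 * diameter \<Omega>"] by blast
  \<comment> \<open>Two climbing constants, plus the crossing: a gap of at most
    \<open>(2 * C + 1) * h\<close> between balls of radius \<open>h / C\<close>.\<close>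
  define K where "K = 2 * C + C * (2 * C + 1)"
  show ?thesis
  proof (rule that)
    show "0 < 2 * exp K" by simp
    fix x y assume xy: "x \<in> \<Omega>" "y \<in> \<Omega>" "bdist \<Omega> x \<le> 2 * dist x y" "bdist \<Omega> y \<le> 2 * dist x y"
    define h where "h = 2 * dist x y"
    have b: "0 < bdist \<Omega> x" "0 < bdist \<Omega> y" using bdist_pos xy by auto
    have h: "0 < h" "h \<le> 2 * diameter \<Omega>"
      using b xy diameter_bounded_bound[OF bd xy(1,2)] by (auto simp: h_def)
    obtain x' where x': "ball x' (h / C) \<subseteq> \<Omega>" "dist x x' \<le> C * h"
      "kobayashi_dist \<Omega> x x' \<le> ln (h / bdist \<Omega> x) / 2 + C"
      using C(2)[OF xy(1) _ h(2)] xy(3) unfolding h_def by blast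
    obtain y' where y': "ball y' (h / C) \<subseteq> \<Omega>" "dist y y' \<le> C * h"
      "kobayashi_dist \<Omega> y y' \<le> ln (h / bdist \<Omega> y) / 2 + C"
      using C(2)[OF xy(2) _ h(2)] xy(4) unfolding h_def by blast
    have hC: "0 < h / C" using h C by simp
    have in': "x' \<in> \<Omega>" "y' \<in> \<Omega>" using x'(1) y'(1) hC by auto
    have "dist x' y' \<le> dist x x' + dist x y + dist y y'"
      using dist_triangle[of x' y' x] dist_triangle[of x y' y] by (simp add: dist_commute)
    also have "\<dots> \<le> C * h + h + C * h" using x'(2) y'(2) h(1) h_def by linarith
    also have "\<dots> = (2 * C + 1) * h" by (simp add: algebra_simps)
    finally have "kobayashi_dist \<Omega> x' y' \<le> (2 * C + 1) * h / (h / C)"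
      using kobayashi_dist_le_balls[OF x'(1) y'(1) hC] hC by (meson divide_right_mono less_imp_le order_trans)
    also have "\<dots> = C * (2 * C + 1)" using h C by simp
    finally have "kobayashi_dist \<Omega> x' y' \<le> C * (2 * C + 1)" .
    moreover have "kobayashi_dist \<Omega> x y \<le> kobayashi_dist \<Omega> x x' + kobayashi_dist \<Omega> x' y' + kobayashi_dist \<Omega> y y'"
      using kobayashi_dist_triangle[OF xy(1) in'(1) xy(2)] kobayashi_dist_triangle[OF in'(1,2) xy(2)]
        kobayashi_dist_commute[OF xy(2) in'(2)] by simp
    ultimately have "kobayashi_dist \<Omega> x y \<le> ln (h / bdist \<Omega> x) / 2 + ln (h / bdist \<Omega> y) / 2 + K"
      using x'(3) y'(3) by (simp add: K_def)
    also have "\<dots> = ln (h / sqrt (bdist \<Omega> x * bdist \<Omega> y)) + K"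
      using b h by (simp add: ln_div ln_sqrt ln_mult field_simps)
    finally have "exp (kobayashi_dist \<Omega> x y) \<le> exp (ln (h / sqrt (bdist \<Omega> x * bdist \<Omega> y)) + K)" by simp
    also have "\<dots> = h / sqrt (bdist \<Omega> x * bdist \<Omega> y) * exp K" using b h by (simp add: exp_add)
    finally show "sqrt (bdist \<Omega> x * bdist \<Omega> y) * exp (kobayashi_dist \<Omega> x y) \<le> 2 * exp K * dist x y"
      using b by (simp add: h_def field_simps)
  qed
qed

end

section \<open>The Morse lemma\<close>

text \<open>A discrete stand-in for a geodesic, obtained later by sampling a nearly shortest path.
  The slack 1 in the last clause is for the whole chain and does not accumulate over its
  steps.\<close>

definition rough_chain :: "'a set \<Rightarrow> ('a \<Rightarrow> 'a \<Rightarrow> real) \<Rightarrow> nat \<Rightarrow> (nat \<Rightarrow> 'a) \<Rightarrow> bool" where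
  "rough_chain X d N c \<longleftrightarrow> (\<forall>i\<le>N. c i \<in> X) \<and> (\<forall>i<N. d (c i) (c (Suc i)) \<le> 1) \<and>
     (\<forall>i j k. i \<le> j \<longrightarrow> j \<le> k \<longrightarrow> k \<le> N \<longrightarrow> d (c i) (c j) + d (c j) (c k) \<le> d (c i) (c k) + 1)"

locale roughly_geodesic_hyperbolic =
  fixes X :: "'a set" and d :: "'a \<Rightarrow> 'a \<Rightarrow> real" and \<delta> :: real
  assumes nonneg: "\<And>x y. x \<in> X \<Longrightarrow> y \<in> X \<Longrightarrow> 0 \<le> d x y"
    and self: "\<And>x. x \<in> X \<Longrightarrow> d x x = 0"
    and commute: "\<And>x y. x \<in> X \<Longrightarrow> y \<in> X \<Longrightarrow> d x y = d y x"
    and triangle: "\<And>x y z. x \<in> X \<Longrightarrow> y \<in> X \<Longrightarrow> z \<in> X \<Longrightarrow> d x z \<le> d x y + d y z"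
    and rough_geodesic: "\<And>x y. x \<in> X \<Longrightarrow> y \<in> X \<Longrightarrow>
      \<exists>N c. c 0 = x \<and> c N = y \<and> rough_chain X d N c"
    and \<delta>: "0 \<le> \<delta>"
    and hyp: "\<And>x y z w. x \<in> X \<Longrightarrow> y \<in> X \<Longrightarrow> z \<in> X \<Longrightarrow> w \<in> X \<Longrightarrow>
      min (gromov_product d w x z) (gromov_product d w z y) - \<delta> \<le> gromov_product d w x y"
begin

abbreviation gp :: "'a \<Rightarrow> 'a \<Rightarrow> 'a \<Rightarrow> real" where "gp \<equiv> gromov_product d"

definition quasi_geodesic :: "real \<Rightarrow> real \<Rightarrow> real \<Rightarrow> (real \<Rightarrow> 'a) \<Rightarrow> bool" where
  "quasi_geodesic \<Lambda> a b \<gamma> \<longleftrightarrow> a \<le> b \<and> \<gamma> ` {a..b} \<subseteq> X \<and>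
     (\<forall>s\<in>{a..b}. \<forall>t\<in>{a..b}. \<bar>s - t\<bar> / \<Lambda> \<le> d (\<gamma> s) (\<gamma> t) \<and> d (\<gamma> s) (\<gamma> t) \<le> \<Lambda> * \<bar>s - t\<bar>)"

text \<open>Bisection: a chain of \<open>2\<^sup>k\<close> unit steps costs only \<open>k \<delta>\<close> in the Gromov product of its ends.\<close>

lemma gromov_product_chain:
  assumes "N \<le> 2 ^ k" "w \<in> X" "\<And>i. i \<le> N \<Longrightarrow> z i \<in> X" "\<And>i. i \<le> N \<Longrightarrow> B \<le> d (z i) w"
    and "\<And>i. i < N \<Longrightarrow> d (z i) (z (Suc i)) \<le> 1"
  shows "B - 1/2 - real k * \<delta> \<le> gp w (z 0) (z N)"
  using assms
proof (induction k arbitrary: N z)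
  case 0
  consider "N = 0" | "N = 1" using 0(1) by fastforce
  then show ?case
  proof cases
    case 1
    then show ?thesis using 0(3)[of 0] 0(4)[of 0] self[of "z 0"] by (simp add: gromov_product_def)
  next
    case 2
    then show ?thesis using 0(4)[of 0] 0(4)[of 1] 0(5)[of 0] by (simp add: gromov_product_def)
  qed
next
  case (Suc k)
  define M where "M = N div 2"
  have M: "M \<le> 2 ^ k" "M \<le> N" "N - M \<le> 2 ^ k" using Suc.prems(1) by (auto simp: M_def)
  have "B - 1/2 - real k * \<delta> \<le> gp w (z 0) (z M)"
    using M Suc.prems by (intro Suc.IH) auto
  moreover have "B - 1/2 - real k * \<delta> \<le> gp w (z (M + 0)) (z (M + (N - M)))"
    using M Suc.prems by (intro Suc.IH[where z = "\<lambda>i. z (M + i)"]) auto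
  moreover have "min (gp w (z 0) (z M)) (gp w (z M) (z N)) - \<delta> \<le> gp w (z 0) (z N)"
    using M Suc.prems by (intro hyp) auto
  ultimately show ?case using M by (simp add: algebra_simps min_def split: if_splits)
qed

text \<open>From the chain point \<open>c i\<close>, at distance at least \<open>D\<close> from the
  curve, go back along the chain to a point about \<open>2 * D\<close> away, or to its start if that
  is nearer, and from there jump to the curve. The jump is invisible from \<open>c i\<close>, in
  that its ends have a large Gromov product. Stopping at distance \<open>2 * D\<close> keeps the
  detour linear in \<open>D\<close>, whatever the length of the chain.\<close>

lemma ex_chain_anchor:
  assumes X: "\<And>j. j \<le> i \<Longrightarrow> c j \<in> X" "\<gamma> ` {a..b} \<subseteq> X"
    and step: "\<And>j. j < i \<Longrightarrow> d (c j) (c (Suc j)) \<le> 1"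
    and near: "\<And>j. j \<le> i \<Longrightarrow> \<exists>t\<in>{a..b}. d (c j) (\<gamma> t) \<le> D + 1"
    and far: "\<And>t. t \<in> {a..b} \<Longrightarrow> D \<le> d (c i) (\<gamma> t)"
    and start: "c 0 = \<gamma> t0" "t0 \<in> {a..b}" and D: "0 < D"
  shows "\<exists>j\<le>i. \<exists>t\<in>{a..b}. d (c j) (\<gamma> t) \<le> D + 1 \<and> D - 1/2 \<le> gp (c i) (c j) (\<gamma> t) \<and> d (c j) (c i) \<le> 2 * D + 1"
proof (cases "d (c 0) (c i) < 2 * D")
  case True
  have c0: "c 0 \<in> X" "c i \<in> X" using X(1) by auto
  have "d (c 0) (\<gamma> t0) = 0" using start(1) self[OF c0(1)] by simp
  moreover have "D \<le> d (c 0) (c i)" using far[OF start(2)] start(1) commute[OF c0] by simp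
  ultimately show ?thesis
    using start D True c0 self by (intro exI[of _ 0] conjI bexI[of _ t0]) (auto simp: gromov_product_def)
next
  case False
  \<comment> \<open>The last index at distance at least \<open>2 * D\<close>: the next one is
    nearer, and a unit step then gives the upper bound \<open>2 * D + 1\<close>.\<close>
  define j where "j = (GREATEST j. j \<le> i \<and> 2 * D \<le> d (c j) (c i))"
  have j: "j \<le> i" "2 * D \<le> d (c j) (c i)"
    using GreatestI_nat[of "\<lambda>j. j \<le> i \<and> 2 * D \<le> d (c j) (c i)" 0 i] False unfolding j_def by auto
  have ci: "c i \<in> X" "c j \<in> X" using X(1) j by auto
  have "j \<noteq> i" using j self[OF ci(1)] D by auto
  then have ji: "Suc j \<le> i" using j by simp
  then have cj: "c (Suc j) \<in> X" using X(1) by simp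
  have "\<not> 2 * D \<le> d (c (Suc j)) (c i)"
  proof
    assume "2 * D \<le> d (c (Suc j)) (c i)"
    with ji have "Suc j \<le> i \<and> 2 * D \<le> d (c (Suc j)) (c i)" by simp
    then have "Suc j \<le> (GREATEST j. j \<le> i \<and> 2 * D \<le> d (c j) (c i))"
      by (rule Greatest_le_nat[where b = i]) simp
    then show False by (simp add: j_def)
  qed
  then have up: "d (c j) (c i) \<le> 2 * D + 1"
    using triangle[OF ci(2) cj ci(1)] step[of j] ji by simp
  obtain t where t: "t \<in> {a..b}" "d (c j) (\<gamma> t) \<le> D + 1" using near[OF j(1)] by blast
  have "\<gamma> t \<in> X" using X(2) t by blast
  then have "D \<le> d (\<gamma> t) (c i)" using far[OF t(1)] commute[OF ci(1)] by simp
  then have "D - 1/2 \<le> gp (c i) (c j) (\<gamma> t)"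
    using j(2) t(2) by (simp add: gromov_product_def)
  then show ?thesis using j t up by blast
qed

text \<open>The number of sampling steps is linear in \<open>D\<close>, but bisection costs only its
  logarithm, which is eventually beaten by \<open>D\<close> itself. Bounding the logarithm by a
  square root is enough for this.\<close>

lemma ex_morse_scale:
  assumes L: "1 \<le> L"
  shows "\<exists>D0\<ge>0. \<forall>D>D0. \<exists>k. L\<^sup>2 * (6 * D + 4) + 1 \<le> 2 ^ k \<and> 1 + (real k + 2) * \<delta> < D"
proof -
  define A where "A = 10 * L\<^sup>2 + 1"
  have A: "0 < A" by (simp add: A_def add_nonneg_pos)
  \<comment> \<open>The second entry makes \<open>4 * \<delta> * sqrt (A * D)\<close> at most
    \<open>D / 2\<close>, the third makes \<open>1 + 3 * \<delta>\<close> less than the other half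
    of any larger \<open>D\<close>.\<close>
  define D0 where "D0 = max 1 (max (64 * \<delta>\<^sup>2 * A) (2 + 6 * \<delta>))"
  have D0: "1 \<le> D0" "64 * \<delta>\<^sup>2 * A \<le> D0" "2 + 6 * \<delta> \<le> D0" by (simp_all add: D0_def)
  show ?thesis
  proof (intro exI[of _ D0] conjI allI impI)
    fix D assume D: "D0 < D"
    define y where "y = L\<^sup>2 * (6 * D + 4) + 1"
    have "L\<^sup>2 * 4 \<le> L\<^sup>2 * (4 * D)" using D D0 by (intro mult_left_mono) auto
    then have yA: "y \<le> A * D" using D D0 by (simp add: y_def A_def algebra_simps)
    have y1: "1 \<le> y" using D D0 by (simp add: y_def)
    define k where "k = nat \<lceil>log 2 y\<rceil>"
    have log0: "0 \<le> log 2 y" using y1 by simp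
    have "y = 2 powr (log 2 y)" using y1 by simp
    also have "\<dots> \<le> 2 powr real k" unfolding k_def using log0 by (intro powr_mono real_nat_ceiling_ge) auto
    also have "\<dots> = 2 ^ k" by (simp add: powr_realpow)
    finally have "y \<le> 2 ^ k" .
    have "real k \<le> log 2 y + 1" unfolding k_def using log0 by linarith
    moreover have "log 2 y \<le> 4 * sqrt y"
    proof -
      have "ln y = 2 * ln (sqrt y)" using y1 by (simp add: ln_sqrt)
      also have "ln (sqrt y) \<le> sqrt y" using ln_le_minus_one[of "sqrt y"] y1 by simp
      finally have "ln y \<le> 2 * sqrt y" by simp
      also have "\<dots> \<le> 4 * sqrt y * ln 2"
      proof -
        have "1/2 \<le> ln (2::real)" using ln_le_minus_one[of "1/2"] by (simp add: ln_div)
        then have "4 * sqrt y * (1/2) \<le> 4 * sqrt y * ln 2" using y1 by (intro mult_left_mono) auto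
        then show ?thesis by simp
      qed
      finally show ?thesis by (simp add: log_def field_simps)
    qed
    moreover have "sqrt y \<le> sqrt (A * D)" using yA by simp
    ultimately have "real k + 2 \<le> 4 * sqrt (A * D) + 3" by linarith
    then have "(real k + 2) * \<delta> \<le> (4 * sqrt (A * D) + 3) * \<delta>" using \<delta> by (rule mult_right_mono)
    also have "\<dots> = 4 * \<delta> * sqrt A * sqrt D + 3 * \<delta>" by (simp add: real_sqrt_mult algebra_simps)
    also have "4 * \<delta> * sqrt A \<le> sqrt D / 2"
    proof -
      have "8 * \<delta> * sqrt A = sqrt (64 * \<delta>\<^sup>2 * A)" using \<delta> by (simp add: real_sqrt_mult)
      also have "\<dots> \<le> sqrt D" using D D0 by simp
      finally show ?thesis by simp
    qed
    then have "4 * \<delta> * sqrt A * sqrt D \<le> sqrt D / 2 * sqrt D" using D D0 by (intro mult_right_mono) auto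
    also have "\<dots> = D / 2" using D D0 by simp
    finally have "1 + (real k + 2) * \<delta> < D" using D D0 by simp
    then show "\<exists>k. L\<^sup>2 * (6 * D + 4) + 1 \<le> 2 ^ k \<and> 1 + (real k + 2) * \<delta> < D"
      using \<open>y \<le> 2 ^ k\<close> unfolding y_def by blast
  qed (use D0 in simp)
qed

text \<open>At the chain point \<open>c i\<close> farthest from the curve, leave the chain on both
  sides and connect the two exits along the curve. This detour avoids the ball of radius
  \<open>D\<close> about \<open>c i\<close> and has length linear in \<open>D\<close>, so bisection
  gives its ends a large Gromov product at \<open>c i\<close>; but \<open>c i\<close> lies roughly
  between them on the chain, where the product is nearly 0.\<close>

lemma rough_geodesic_near_quasi_geodesic:
  assumes L: "1 \<le> L"
  shows "\<exists>D\<ge>0. \<forall>a b \<gamma> N c. quasi_geodesic L a b \<gamma> \<longrightarrow> c 0 = \<gamma> a \<longrightarrow> c N = \<gamma> b \<longrightarrow>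
     rough_chain X d N c \<longrightarrow> (\<forall>i\<le>N. \<exists>t\<in>{a..b}. d (c i) (\<gamma> t) \<le> D)"
proof -
  obtain D0 where D0: "0 \<le> D0"
    "\<And>D. D0 < D \<Longrightarrow> \<exists>k. L\<^sup>2 * (6 * D + 4) + 1 \<le> 2 ^ k \<and> 1 + (real k + 2) * \<delta> < D"
    using ex_morse_scale[OF L] by blast
  show ?thesis
  proof (intro exI[of _ "D0 + 1"] conjI allI impI)
    show "0 \<le> D0 + 1" using D0 by simp
    fix a b \<gamma> N c i0
    assume qg: "quasi_geodesic L a b \<gamma>" and ends: "c 0 = \<gamma> a" "c N = \<gamma> b"
      and chain: "rough_chain X d N c" and i0: "i0 \<le> N"
    have c: "c 0 = \<gamma> a" "c N = \<gamma> b" "\<forall>i\<le>N. c i \<in> X" "\<forall>i<N. d (c i) (c (Suc i)) \<le> 1"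
      and geo: "\<forall>i j k. i \<le> j \<longrightarrow> j \<le> k \<longrightarrow> k \<le> N \<longrightarrow> d (c i) (c j) + d (c j) (c k) \<le> d (c i) (c k) + 1"
      using ends chain by (simp_all add: rough_chain_def)
    have ab: "a \<in> {a..b}" "b \<in> {a..b}" and \<gamma>X: "\<gamma> ` {a..b} \<subseteq> X"
      and lip: "\<And>s t. s \<in> {a..b} \<Longrightarrow> t \<in> {a..b} \<Longrightarrow> d (\<gamma> s) (\<gamma> t) \<le> L * \<bar>s - t\<bar>"
      and colip: "\<And>s t. s \<in> {a..b} \<Longrightarrow> t \<in> {a..b} \<Longrightarrow> \<bar>s - t\<bar> \<le> L * d (\<gamma> s) (\<gamma> t)"
      using qg L by (auto simp: quasi_geodesic_def field_simps)
    \<comment> \<open>Distance to the curve. The infimum is only approximated, which accounts for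
      the \<open>D + 1\<close> below and for the final \<open>D0 + 1\<close>.\<close>
    define f where "f = (\<lambda>i. Inf ((\<lambda>t. d (c i) (\<gamma> t)) ` {a..b}))"
    have bdd: "bdd_below ((\<lambda>t. d (c i) (\<gamma> t)) ` {a..b})" if "i \<le> N" for i
      using c(3) that \<gamma>X nonneg by (intro bdd_belowI[of _ 0]) auto
    have f_le: "f i \<le> d (c i) (\<gamma> t)" if "i \<le> N" "t \<in> {a..b}" for i t
      unfolding f_def using bdd[OF that(1)] that(2) by (intro cInf_lower) auto
    have f_approx: "\<exists>t\<in>{a..b}. d (c i) (\<gamma> t) < f i + 1" if "i \<le> N" for i
    proof -
      have "(\<lambda>t. d (c i) (\<gamma> t)) ` {a..b} \<noteq> {}" using ab by blast
      from cInf_lessD[OF this, of "f i + 1"] show ?thesis unfolding f_def by auto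
    qed
    define D where "D = Max (f ` {..N})"
    have D_ge: "f i \<le> D" if "i \<le> N" for i unfolding D_def using that by (intro Max_ge) auto
    have "D \<le> D0"
    proof (rule ccontr)
      assume "\<not> D \<le> D0"
      then have D: "D0 < D" "0 < D" using D0(1) by auto
      then obtain k where k: "L\<^sup>2 * (6 * D + 4) + 1 \<le> 2 ^ k" "1 + (real k + 2) * \<delta> < D"
        using D0(2) by blast
      have "D \<in> f ` {..N}" unfolding D_def by (intro Max_in) auto
      then obtain i where i: "i \<le> N" "f i = D" by auto
      have near: "\<exists>t\<in>{a..b}. d (c j) (\<gamma> t) \<le> D + 1" if "j \<le> N" for j
        using f_approx[OF that] D_ge[OF that] by (meson add_mono_thms_linordered_semiring(3) less_imp_le order_trans)
      have far: "D \<le> d (c i) (\<gamma> t)" if "t \<in> {a..b}" for t using f_le[OF i(1) that] i(2) by simp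
      obtain j t where j: "j \<le> i" "t \<in> {a..b}" "d (c j) (\<gamma> t) \<le> D + 1" "D - 1/2 \<le> gp (c i) (c j) (\<gamma> t)"
        "d (c j) (c i) \<le> 2 * D + 1"
        using ex_chain_anchor[of i c \<gamma> a b D a] c i near far ab \<gamma>X D(2) by auto
      \<comment> \<open>The exit on the other side is found on the reversed chain.\<close>
      have "\<exists>j\<le>N - i. \<exists>t\<in>{a..b}. d (c (N - j)) (\<gamma> t) \<le> D + 1 \<and>
          D - 1/2 \<le> gp (c (N - (N - i))) (c (N - j)) (\<gamma> t) \<and> d (c (N - j)) (c (N - (N - i))) \<le> 2 * D + 1"
      proof (rule ex_chain_anchor[of "N - i" "\<lambda>j. c (N - j)" \<gamma> a b D b])
        fix j assume j: "j < N - i"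
        then have "N - j = Suc (N - Suc j)" by simp
        then show "d (c (N - j)) (c (N - Suc j)) \<le> 1"
          using c(3,4) commute[of "c (N - j)" "c (N - Suc j)"] j by simp
      qed (use c i near far ab \<gamma>X D(2) in auto)
      then obtain j'' t' where j'': "j'' \<le> N - i" "t' \<in> {a..b}" "d (c (N - j'')) (\<gamma> t') \<le> D + 1"
        "D - 1/2 \<le> gp (c i) (c (N - j'')) (\<gamma> t')" "d (c (N - j'')) (c i) \<le> 2 * D + 1"
        using i by auto
      define j' where "j' = N - j''"
      have j': "i \<le> j'" "j' \<le> N" using j'' i by (auto simp: j'_def)
      note j't' = j''(2-5)[folded j'_def]
      have X: "c i \<in> X" "c j \<in> X" "c j' \<in> X" "\<gamma> t \<in> X" "\<gamma> t' \<in> X"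
        using c(3) i j j' j't' \<gamma>X by auto
      have "d (\<gamma> t) (\<gamma> t') \<le> d (\<gamma> t) (c j) + d (c j) (c i) + d (c i) (c j') + d (c j') (\<gamma> t')"
        using triangle[OF X(4,2,5)] triangle[OF X(2,1,5)] triangle[OF X(1,3,5)] by linarith
      also have "\<dots> \<le> 6 * D + 4"
        using j j't' commute[OF X(4,2)] commute[OF X(1,3)] by simp
      finally have "L * d (\<gamma> t) (\<gamma> t') \<le> L * (6 * D + 4)" using L by (intro mult_left_mono) auto
      then have tt': "\<bar>t - t'\<bar> \<le> L * (6 * D + 4)" using colip[OF j(2) j't'(1)] by linarith
      \<comment> \<open>Enough samples for consecutive points of the curve to be at distance at most
        1; \<open>Suc\<close> keeps \<open>n\<close> positive when \<open>t = t'\<close>.\<close>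
      define n where "n = Suc (nat \<lfloor>L * \<bar>t - t'\<bar>\<rfloor>)"
      have n: "0 < n" "L * \<bar>t - t'\<bar> \<le> real n" "real n \<le> L * \<bar>t - t'\<bar> + 1"
      proof -
        have "0 \<le> L * \<bar>t - t'\<bar>" using L by simp
        then show "0 < n" "L * \<bar>t - t'\<bar> \<le> real n" "real n \<le> L * \<bar>t - t'\<bar> + 1"
          unfolding n_def by (auto simp: of_nat_nat) linarith+
      qed
      have "real n \<le> L * (L * (6 * D + 4)) + 1"
        using n(3) mult_left_mono[OF tt', of L] L by linarith
      also have "\<dots> \<le> 2 ^ k" using k(1) by (simp add: power2_eq_square mult.assoc)
      finally have "real n \<le> real (2 ^ k)" by simp
      then have nk: "n \<le> 2 ^ k" by (simp only: of_nat_le_iff)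
      define \<tau> where "\<tau> = (\<lambda>m::nat. t + real m / real n * (t' - t))"
      have \<tau>: "\<tau> m \<in> {a..b}" if "m \<le> n" for m
      proof -
        have "real m / real n \<in> {0..1}" using that n(1) by simp
        then have "(1 - real m / real n) *\<^sub>R t + (real m / real n) *\<^sub>R t' \<in> {a..b}"
          using j(2) j't'(1) by (intro convexD) auto
        moreover have "(1 - r) *\<^sub>R t + r *\<^sub>R t' = t + r * (t' - t)" for r
          by (simp add: algebra_simps)
        ultimately show ?thesis by (simp only: \<tau>_def)
      qed
      have "D - 1/2 - real k * \<delta> \<le> gp (c i) (\<gamma> (\<tau> 0)) (\<gamma> (\<tau> n))"
      proof (rule gromov_product_chain[OF nk X(1), of "\<lambda>m. \<gamma> (\<tau> m)"])
        show "\<gamma> (\<tau> m) \<in> X" if "m \<le> n" for m using \<tau>[OF that] \<gamma>X by blast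
        then show "D \<le> d (\<gamma> (\<tau> m)) (c i)" if "m \<le> n" for m
          using far[OF \<tau>[OF that]] commute[OF X(1)] that by simp
        fix m assume m: "m < n"
        have "real (Suc m) / real n = real m / real n + 1 / real n" by (simp add: add_divide_distrib)
        then have "\<tau> (Suc m) - \<tau> m = (t' - t) / real n" unfolding \<tau>_def by (simp add: ring_distribs diff_divide_distrib)
        then have "\<bar>\<tau> m - \<tau> (Suc m)\<bar> = \<bar>t - t'\<bar> / real n"
          by (metis abs_divide abs_minus_commute abs_of_nat)
        then have "d (\<gamma> (\<tau> m)) (\<gamma> (\<tau> (Suc m))) \<le> L * (\<bar>t - t'\<bar> / real n)"
          using lip[OF \<tau> \<tau>, of m "Suc m"] m by simp
        also have "\<dots> \<le> 1" using n by simp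
        finally show "d (\<gamma> (\<tau> m)) (\<gamma> (\<tau> (Suc m))) \<le> 1" .
      qed
      then have 1: "D - 1/2 - real k * \<delta> \<le> gp (c i) (\<gamma> t) (\<gamma> t')" using n(1) by (simp add: \<tau>_def)
      have 2: "D - 1/2 - real k * \<delta> \<le> gp (c i) (\<gamma> t') (c j')"
      proof -
        have "D - 1/2 \<le> gp (c i) (\<gamma> t') (c j')"
          using j't'(3) commute[OF X(5,3)] by (simp add: gromov_product_def)
        then show ?thesis using mult_nonneg_nonneg[OF of_nat_0_le_iff \<delta>, of k] by linarith
      qed
      have 3: "D - 1/2 - real k * \<delta> \<le> gp (c i) (c j) (\<gamma> t)"
        using j(4) \<delta> mult_nonneg_nonneg[of "real k" \<delta>] by linarith
      have "D - 1/2 - real k * \<delta> - \<delta> \<le> gp (c i) (\<gamma> t) (c j')"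
        using hyp[OF X(4,3,5,1)] 1 2 by linarith
      then have "D - 1/2 - real k * \<delta> - \<delta> - \<delta> \<le> gp (c i) (c j) (c j')"
        using hyp[OF X(2,3,4,1)] 3 \<delta> by linarith
      \<comment> \<open>Rough additivity of the chain at \<open>c i\<close>, against the lower bound
        just obtained from the detour.\<close>
      moreover have "gp (c i) (c j) (c j') \<le> 1/2"
        using geo[rule_format, of j i j'] j(1) j' commute[OF X(3,1)] by (simp add: gromov_product_def)
      ultimately show False using k(2) by (simp add: algebra_simps)
    qed
    then show "\<exists>t\<in>{a..b}. d (c i0) (\<gamma> t) \<le> D0 + 1"
      using f_approx[OF i0] D_ge[OF i0] by (meson add_mono_thms_linordered_semiring(3) less_imp_le order_trans)
  qed
qed

text \<open>A discrete connectedness argument: every chain point is near the curve, so where the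
  chain passes from the part before \<open>t\<close> to the part after it, some \<open>c i\<close>
  is near both. The two parameters are then close to each other and to \<open>t\<close>, so
  \<open>\<gamma> t\<close> is near \<open>c i\<close>, which is roughly between the ends.\<close>

lemma quasi_geodesic_roughly_additive:
  assumes L: "1 \<le> L"
  shows "\<exists>K\<ge>0. \<forall>a b \<gamma>. quasi_geodesic L a b \<gamma> \<longrightarrow>
     (\<forall>t\<in>{a..b}. d (\<gamma> a) (\<gamma> t) + d (\<gamma> t) (\<gamma> b) \<le> d (\<gamma> a) (\<gamma> b) + K)"
proof -
  obtain D where D: "0 \<le> D" "\<And>a b \<gamma> N c. quasi_geodesic L a b \<gamma> \<Longrightarrow> c 0 = \<gamma> a \<Longrightarrow> c N = \<gamma> b \<Longrightarrow>
     rough_chain X d N c \<Longrightarrow> (\<forall>i\<le>N. \<exists>t\<in>{a..b}. d (c i) (\<gamma> t) \<le> D)"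
    using rough_geodesic_near_quasi_geodesic[OF L] by (elim exE conjE) (rule that, assumption, simp)
  \<comment> \<open>The two nearby curve points are within \<open>2 * D + 1\<close>, their
    parameters within \<open>L\<close> times that, and moving on to \<open>\<gamma> t\<close> costs
    another factor \<open>L\<close>; \<open>D\<close> is the distance from \<open>c i\<close> to the
    curve.\<close>
  define Q where "Q = L * (L * (2 * D + 1)) + D"
  have Q: "0 \<le> Q" using D(1) L by (simp add: Q_def)
  show ?thesis
  proof (intro exI[of _ "2 * Q + 3"] conjI allI impI ballI)
    show "0 \<le> 2 * Q + 3" using Q by simp
    fix a b \<gamma> t assume qg: "quasi_geodesic L a b \<gamma>" and t: "t \<in> {a..b}"
    have ab: "a \<in> {a..b}" "b \<in> {a..b}" and \<gamma>X: "\<gamma> ` {a..b} \<subseteq> X"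
      and lip: "\<And>s t. s \<in> {a..b} \<Longrightarrow> t \<in> {a..b} \<Longrightarrow> d (\<gamma> s) (\<gamma> t) \<le> L * \<bar>s - t\<bar>"
      and colip: "\<And>s t. s \<in> {a..b} \<Longrightarrow> t \<in> {a..b} \<Longrightarrow> \<bar>s - t\<bar> \<le> L * d (\<gamma> s) (\<gamma> t)"
      using qg L by (auto simp: quasi_geodesic_def field_simps)
    have X: "\<gamma> a \<in> X" "\<gamma> b \<in> X" "\<gamma> t \<in> X" using ab t \<gamma>X by auto
    obtain N c where ends: "c 0 = \<gamma> a" "c N = \<gamma> b" and chain: "rough_chain X d N c"
      using rough_geodesic[OF X(1,2)] by blast
    then have c: "c 0 = \<gamma> a" "c N = \<gamma> b" "\<forall>i\<le>N. c i \<in> X" "\<forall>i<N. d (c i) (c (Suc i)) \<le> 1"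
      "\<forall>i j k. i \<le> j \<longrightarrow> j \<le> k \<longrightarrow> k \<le> N \<longrightarrow> d (c i) (c j) + d (c j) (c k) \<le> d (c i) (c k) + 1"
      by (simp_all add: rough_chain_def)
    have near: "\<And>i. i \<le> N \<Longrightarrow> \<exists>t\<in>{a..b}. d (c i) (\<gamma> t) \<le> D" using D(2)[OF qg ends chain] by blast
    \<comment> \<open>The greatest such index is the place of passage: its successor can only be
      near a later part of the curve.\<close>
    define P where "P = (\<lambda>i. i \<le> N \<and> (\<exists>s\<in>{a..t}. d (c i) (\<gamma> s) \<le> D))"
    have P0: "P 0"
      using c(1) self[OF X(1)] D(1) t unfolding P_def by (intro conjI bexI[of _ a]) auto
    define i where "i = (GREATEST i. P i)"
    have Pi: "P i" unfolding i_def by (rule GreatestI_nat[of P 0 N]) (use P0 in \<open>auto simp: P_def\<close>)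
    then obtain s where s: "s \<in> {a..t}" "d (c i) (\<gamma> s) \<le> D" and iN: "i \<le> N" unfolding P_def by blast
    have "\<exists>u\<in>{t..b}. d (c i) (\<gamma> u) \<le> D + 1"
    proof (cases "i = N")
      case True
      then show ?thesis using c(2) self[OF X(2)] D(1) t by (intro bexI[of _ b]) auto
    next
      case False
      then have i': "Suc i \<le> N" using iN by simp
      obtain u where u: "u \<in> {a..b}" "d (c (Suc i)) (\<gamma> u) \<le> D" using near[OF i'] by blast
      have "\<not> P (Suc i)"
      proof
        assume "P (Suc i)"
        then have "Suc i \<le> (GREATEST i. P i)" by (rule Greatest_le_nat[where b = N]) (simp add: P_def)
        then show False by (simp add: i_def)
      qed
      then have "t \<le> u" using u i' unfolding P_def by (metis atLeastAtMost_iff linear)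
      moreover have "d (c i) (\<gamma> u) \<le> d (c i) (c (Suc i)) + d (c (Suc i)) (\<gamma> u)"
        using c(3) i' iN u \<gamma>X by (intro triangle) auto
      then have "d (c i) (\<gamma> u) \<le> D + 1" using c(4)[rule_format, of i] i' u(2) by simp
      ultimately show ?thesis using u by (intro bexI[of _ u]) auto
    qed
    then obtain u where u: "u \<in> {t..b}" "d (c i) (\<gamma> u) \<le> D + 1" by blast
    have su: "s \<in> {a..b}" "u \<in> {a..b}" using s u t by auto
    have XX: "c i \<in> X" "\<gamma> s \<in> X" "\<gamma> u \<in> X" using c(3) iN \<gamma>X su by auto
    have "d (\<gamma> s) (\<gamma> u) \<le> 2 * D + 1"
      using triangle[OF XX(2,1,3)] commute[OF XX(2,1)] s u by simp
    then have "L * d (\<gamma> s) (\<gamma> u) \<le> L * (2 * D + 1)" using L by (intro mult_left_mono) auto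
    then have "\<bar>s - u\<bar> \<le> L * (2 * D + 1)" using colip[OF su] by linarith
    then have "\<bar>s - t\<bar> \<le> L * (2 * D + 1)" using s(1) u(1) by auto
    then have "L * \<bar>s - t\<bar> \<le> L * (L * (2 * D + 1))" using L by (intro mult_left_mono) auto
    then have "d (c i) (\<gamma> t) \<le> Q"
      using triangle[OF XX(1,2) X(3)] lip[OF su(1) t] s(2) by (simp add: Q_def)
    moreover have "d (\<gamma> a) (c i) + d (c i) (\<gamma> b) \<le> d (\<gamma> a) (\<gamma> b) + 1"
      using c(5)[rule_format, of 0 i N] iN c(1,2) by simp
    moreover have "d (\<gamma> a) (\<gamma> t) \<le> d (\<gamma> a) (c i) + d (c i) (\<gamma> t)" "d (\<gamma> t) (\<gamma> b) \<le> d (c i) (\<gamma> t) + d (c i) (\<gamma> b)"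
      using triangle[OF X(1) XX(1) X(3)] triangle[OF X(3) XX(1) X(2)] commute[OF X(3) XX(1)] by auto
    ultimately show "d (\<gamma> a) (\<gamma> t) + d (\<gamma> t) (\<gamma> b) \<le> d (\<gamma> a) (\<gamma> b) + (2 * Q + 3)" by linarith
  qed
qed

end

section \<open>Euclidean length of quasi-geodesics\<close>

context bounded_convex_domain
begin

text \<open>Sample a path of length less than the distance plus 1. Uniform continuity of its length
  function \<open>F\<close> bounds the steps.\<close>

lemma ex_rough_chain:
  assumes xy: "x \<in> \<Omega>" "y \<in> \<Omega>"
  shows "\<exists>N c. c 0 = x \<and> c N = y \<and> rough_chain \<Omega> (kobayashi_dist \<Omega>) N c"
proof -
  let ?d = "kobayashi_dist \<Omega>"
  obtain \<gamma> l where \<gamma>: "has_kobayashi_length \<Omega> \<gamma> l" "pathstart \<gamma> = x" "pathfinish \<gamma> = y" "l < ?d x y + 1"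
    using kobayashi_dist_approx[OF xy, of "?d x y + 1"] by auto
  have int: "kobayashi_speed \<Omega> \<gamma> integrable_on {0..1}" and l: "integral {0..1} (kobayashi_speed \<Omega> \<gamma>) = l"
    using \<gamma>(1) by (auto simp: has_kobayashi_length_def dest: has_integral_integrable integral_unique)
  have \<gamma>in: "\<gamma> t \<in> \<Omega>" if "t \<in> {0..1}" for t
    using \<gamma>(1) that by (auto simp: has_kobayashi_length_def path_image_def)
  define F where "F = (\<lambda>t. integral {0..t} (kobayashi_speed \<Omega> \<gamma>))"
  have dF: "?d (\<gamma> s) (\<gamma> t) \<le> F t - F s" if "0 \<le> s" "s \<le> t" "t \<le> 1" for s t
  proof -
    have "kobayashi_speed \<Omega> \<gamma> integrable_on {0..t}"
      using int that by (intro integrable_subinterval_real[OF int]) auto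
    then have "F s + integral {s..t} (kobayashi_speed \<Omega> \<gamma>) = F t"
      unfolding F_def using that(1,2) by (intro Henstock_Kurzweil_Integration.integral_combine)
    then show ?thesis using kobayashi_dist_along_path[OF \<gamma>(1) that] by simp
  qed
  have "uniformly_continuous_on {0..1} F"
    unfolding F_def by (intro compact_uniformly_continuous indefinite_integral_continuous_1[OF int]) auto
  then obtain e where e: "0 < e" "\<And>s t. s \<in> {0..1} \<Longrightarrow> t \<in> {0..1} \<Longrightarrow> dist s t < e \<Longrightarrow> dist (F s) (F t) < 1"
    unfolding uniformly_continuous_on_def by (metis zero_less_one)
  obtain n where n: "inverse (real (Suc n)) < e" using reals_Archimedean[OF e(1)] by blast
  define N where "N = Suc n"
  define \<tau> where "\<tau> = (\<lambda>i::nat. real i / real N)"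
  have \<tau>: "0 \<le> \<tau> i" "\<tau> i \<le> 1" if "i \<le> N" for i using that by (simp_all add: \<tau>_def N_def)
  have \<tau>_mono: "\<tau> i \<le> \<tau> j" if "i \<le> j" for i j using that by (simp add: \<tau>_def divide_right_mono)
  have ends: "\<tau> 0 = 0" "\<tau> N = 1" by (simp_all add: \<tau>_def N_def)
  have F: "F 0 = 0" "F 1 = l" by (simp_all add: F_def l)
  have "rough_chain \<Omega> ?d N (\<lambda>i. \<gamma> (\<tau> i))"
    unfolding rough_chain_def
  proof (intro conjI allI impI)
    show "\<gamma> (\<tau> i) \<in> \<Omega>" if "i \<le> N" for i using \<gamma>in \<tau>[OF that] by simp
    fix i assume i: "i < N"
    have "\<tau> (Suc i) - \<tau> i = inverse (real (Suc n))"
      by (simp add: \<tau>_def N_def diff_divide_distrib[symmetric] inverse_eq_divide)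
    then have "dist (\<tau> (Suc i)) (\<tau> i) < e" using n by (simp add: dist_real_def)
    then have "dist (F (\<tau> (Suc i))) (F (\<tau> i)) < 1" using e(2) \<tau>[of i] \<tau>[of "Suc i"] i by simp
    moreover have "?d (\<gamma> (\<tau> i)) (\<gamma> (\<tau> (Suc i))) \<le> F (\<tau> (Suc i)) - F (\<tau> i)"
      using \<tau>[of i] \<tau>[of "Suc i"] \<tau>_mono[of i "Suc i"] i by (intro dF) auto
    ultimately show "?d (\<gamma> (\<tau> i)) (\<gamma> (\<tau> (Suc i))) \<le> 1" by (simp add: dist_real_def)
  next
    fix i j k assume ijk: "i \<le> j" "j \<le> k" "k \<le> N"
    have in\<Omega>: "\<gamma> (\<tau> i) \<in> \<Omega>" "\<gamma> (\<tau> k) \<in> \<Omega>" using \<gamma>in \<tau> ijk by auto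
    have "?d (\<gamma> (\<tau> i)) (\<gamma> (\<tau> j)) \<le> F (\<tau> j) - F (\<tau> i)" "?d (\<gamma> (\<tau> j)) (\<gamma> (\<tau> k)) \<le> F (\<tau> k) - F (\<tau> j)"
      "?d (\<gamma> 0) (\<gamma> (\<tau> i)) \<le> F (\<tau> i) - F 0" "?d (\<gamma> (\<tau> k)) (\<gamma> 1) \<le> F 1 - F (\<tau> k)"
      using ijk \<tau>[of i] \<tau>[of j] \<tau>[of k] \<tau>_mono by (auto intro!: dF)
    \<comment> \<open>The excess on a part of the path is at most the excess of the whole path,
      since the remaining pieces are at least as long as the distances of their ends.\<close>
    moreover have "?d x y \<le> ?d x (\<gamma> (\<tau> i)) + ?d (\<gamma> (\<tau> i)) (\<gamma> (\<tau> k)) + ?d (\<gamma> (\<tau> k)) y"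
      using kobayashi_dist_triangle[OF xy(1) in\<Omega>(1) xy(2)] kobayashi_dist_triangle[OF in\<Omega> xy(2)] by linarith
    ultimately show "?d (\<gamma> (\<tau> i)) (\<gamma> (\<tau> j)) + ?d (\<gamma> (\<tau> j)) (\<gamma> (\<tau> k)) \<le> ?d (\<gamma> (\<tau> i)) (\<gamma> (\<tau> k)) + 1"
      using \<gamma>(2-4) F by (simp add: pathstart_def pathfinish_def)
  qed
  then show ?thesis
    using \<gamma>(2,3) ends by (intro exI[of _ N] exI[of _ "\<lambda>i. \<gamma> (\<tau> i)"]) (simp add: pathstart_def pathfinish_def)
qed

lemma roughly_geodesic_hyperbolic:
  assumes "gromov_hyperbolic \<Omega> (kobayashi_dist \<Omega>)"
  obtains \<delta> where "roughly_geodesic_hyperbolic \<Omega> (kobayashi_dist \<Omega>) \<delta>"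
proof -
  obtain \<delta> where \<delta>: "0 \<le> \<delta>" "\<And>x y z w. x \<in> \<Omega> \<Longrightarrow> y \<in> \<Omega> \<Longrightarrow> z \<in> \<Omega> \<Longrightarrow> w \<in> \<Omega> \<Longrightarrow>
     min (gromov_product (kobayashi_dist \<Omega>) w x z) (gromov_product (kobayashi_dist \<Omega>) w z y) - \<delta>
       \<le> gromov_product (kobayashi_dist \<Omega>) w x y"
    using assms unfolding gromov_hyperbolic_def by blast
  have "roughly_geodesic_hyperbolic \<Omega> (kobayashi_dist \<Omega>) \<delta>"
    by unfold_locales
      (simp_all add: kobayashi_dist_nonneg kobayashi_dist_self kobayashi_dist_commute kobayashi_dist_triangle
        ex_rough_chain \<delta>)
  then show ?thesis by (rule that)
qed

text \<open>A path of length less than the distance plus 1 stays that close to \<open>x\<close>,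
  which bounds its depth and, by \<open>norm_le_kobayashi_metric\<close>, its Euclidean speed.
  Letting the length tend to the distance leaves the last factor without the extra 1, so that the
  estimate is linear on short steps.\<close>

lemma dist_le_kobayashi_dist:
  assumes m: "0 < m" and M: "0 \<le> M" "\<And>z v. z \<in> \<Omega> \<Longrightarrow> v \<noteq> 0 \<Longrightarrow> bdist_dir \<Omega> z v \<le> M * bdist \<Omega> z powr (1 / m)"
    and xy: "x \<in> \<Omega>" "y \<in> \<Omega>"
  shows "dist x y \<le> 2 * M * (bdist \<Omega> x * exp (2 * (kobayashi_dist \<Omega> x y + 1))) powr (1 / m) * kobayashi_dist \<Omega> x y"
proof -
  define D where "D = kobayashi_dist \<Omega> x y"
  define A where "A = 2 * M * (bdist \<Omega> x * exp (2 * (D + 1))) powr (1 / m)"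
  have A: "0 \<le> A" using M by (simp add: A_def)
  have le: "dist x y \<le> A * l" if \<gamma>: "has_kobayashi_length \<Omega> \<gamma> l" "pathstart \<gamma> = x" "pathfinish \<gamma> = y" "l < D + 1" for \<gamma> l
    unfolding \<gamma>(2,3)[symmetric]
  proof (rule has_kobayashi_length_norm_le[OF op \<gamma>(1)])
    fix t :: real and v :: "complex^'n" assume t: "t \<in> {0..1}"
    have \<gamma>in: "\<gamma> t \<in> \<Omega>" using \<gamma>(1) t by (auto simp: has_kobayashi_length_def path_image_def)
    have int: "(kobayashi_speed \<Omega> \<gamma> has_integral l) {0..1}" using \<gamma>(1) by (simp add: has_kobayashi_length_def)
    have "kobayashi_dist \<Omega> (\<gamma> 0) (\<gamma> t) \<le> integral {0..t} (kobayashi_speed \<Omega> \<gamma>)"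
      using t by (intro kobayashi_dist_along_path[OF \<gamma>(1)]) auto
    also have "\<dots> \<le> integral {0..1} (kobayashi_speed \<Omega> \<gamma>)"
    proof (rule integral_subset_le)
      show "kobayashi_speed \<Omega> \<gamma> integrable_on {0..1}" using int by (rule has_integral_integrable)
      then show "kobayashi_speed \<Omega> \<gamma> integrable_on {0..t}"
        by (rule integrable_subinterval_real) (use t in auto)
      show "\<forall>s\<in>{0..1}. 0 \<le> kobayashi_speed \<Omega> \<gamma> s"
        using \<gamma>(1) by (intro ballI kobayashi_speed_nonneg[OF op]) (auto simp: has_kobayashi_length_def)
    qed (use t in auto)
    also have "\<dots> = l" using int by (rule integral_unique)
    finally have dl: "kobayashi_dist \<Omega> x (\<gamma> t) \<le> D + 1" using \<gamma>(2,4) by (simp add: pathstart_def)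
    have k: "0 \<le> kobayashi_metric \<Omega> (\<gamma> t) v" by (rule kobayashi_metric_nonneg[OF op \<gamma>in])
    show "norm v \<le> A * kobayashi_metric \<Omega> (\<gamma> t) v"
    proof (cases "v = 0")
      case True
      then show ?thesis using k A by simp
    next
      case False
      have "bdist \<Omega> (\<gamma> t) \<le> bdist \<Omega> x * exp (2 * kobayashi_dist \<Omega> x (\<gamma> t))"
        by (rule bdist_exp_kobayashi_dist[OF xy(1) \<gamma>in])
      also have "\<dots> \<le> bdist \<Omega> x * exp (2 * (D + 1))"
        using dl bdist_pos[OF xy(1)] by (intro mult_left_mono) auto
      finally have "bdist \<Omega> (\<gamma> t) powr (1 / m) \<le> (bdist \<Omega> x * exp (2 * (D + 1))) powr (1 / m)"
        using bdist_pos[OF \<gamma>in] m by (intro powr_mono2) auto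
      then have "M * bdist \<Omega> (\<gamma> t) powr (1 / m) \<le> M * (bdist \<Omega> x * exp (2 * (D + 1))) powr (1 / m)"
        using M(1) by (rule mult_left_mono)
      with M(2)[OF \<gamma>in False] have "2 * bdist_dir \<Omega> (\<gamma> t) v \<le> A" by (simp add: A_def)
      then have "2 * bdist_dir \<Omega> (\<gamma> t) v * kobayashi_metric \<Omega> (\<gamma> t) v \<le> A * kobayashi_metric \<Omega> (\<gamma> t) v"
        using k by (rule mult_right_mono)
      then show ?thesis using norm_le_kobayashi_metric[OF \<gamma>in False] by linarith
    qed
  qed
  show ?thesis
  proof (cases "A = 0")
    case True
    obtain \<gamma> l where "has_kobayashi_length \<Omega> \<gamma> l" "pathstart \<gamma> = x" "pathfinish \<gamma> = y" "l < D + 1"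
      using kobayashi_dist_approx[OF xy, of "D + 1"] by (auto simp: D_def)
    from le[OF this] True have "dist x y \<le> A * D" by simp
    then show ?thesis by (simp only: A_def D_def)
  next
    case False
    then have A: "0 < A" using A by simp
    have "dist x y / A \<le> D"
    proof (rule ccontr)
      assume "\<not> ?thesis"
      then have "D < min (D + 1) (dist x y / A)" by simp
      then obtain \<gamma> l where \<gamma>: "has_kobayashi_length \<Omega> \<gamma> l" "pathstart \<gamma> = x" "pathfinish \<gamma> = y"
        "l < min (D + 1) (dist x y / A)"
        using kobayashi_dist_approx[OF xy] unfolding D_def by metis
      have "dist x y \<le> A * l" using le[OF \<gamma>(1-3)] \<gamma>(4) by simp
      then show False using \<gamma>(4) A by (simp add: field_simps)
    qed
    then show ?thesis using A by (simp add: field_simps A_def D_def)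
  qed
qed

end

text \<open>\<open>\<Phi>\<close> is a potential whose increments dominate the chords, so each
  polygonal sum telescopes.\<close>

lemma curve_length_le:
  assumes "a \<le> b" "\<And>s t. a \<le> s \<Longrightarrow> s \<le> t \<Longrightarrow> t \<le> b \<Longrightarrow> dist (\<gamma> s) (\<gamma> t) \<le> \<Phi> t - \<Phi> s"
  shows "curve_length \<gamma> a b \<le> ennreal (\<Phi> b - \<Phi> a)"
  unfolding curve_length_def
proof (rule SUP_least)
  fix ts assume "ts \<in> {ts. sorted ts \<and> set ts \<subseteq> {a..b}}"
  then have ts: "sorted ts" "set ts \<subseteq> {a..b}" by auto
  have mem: "a \<le> ts ! i" "ts ! i \<le> b" if "i < length ts" for i
    using ts(2) nth_mem[OF that] by auto
  \<comment> \<open>Keeps the increments nonnegative, where \<open>ennreal\<close> does not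
    truncate.\<close>
  have mono: "\<Phi> s \<le> \<Phi> t" if "a \<le> s" "s \<le> t" "t \<le> b" for s t
    using assms(2)[OF that] zero_le_dist[of "\<gamma> s" "\<gamma> t"] by linarith
  let ?n = "length ts - 1"
  have "(\<Sum>i<?n. ennreal (dist (\<gamma> (ts ! i)) (\<gamma> (ts ! Suc i))))
      \<le> (\<Sum>i<?n. ennreal (\<Phi> (ts ! Suc i) - \<Phi> (ts ! i)))"
    using mem ts(1) by (intro sum_mono ennreal_leI assms(2)) (auto simp: sorted_iff_nth_Suc)
  also have "\<dots> = ennreal (\<Sum>i<?n. \<Phi> (ts ! Suc i) - \<Phi> (ts ! i))"
    using mem ts(1) by (intro sum_ennreal) (auto simp: sorted_iff_nth_Suc intro!: mono)
  also have "(\<Sum>i<?n. \<Phi> (ts ! Suc i) - \<Phi> (ts ! i)) = \<Phi> (ts ! ?n) - \<Phi> (ts ! 0)"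
    by (rule sum_lessThan_telescope)
  also have "ennreal \<dots> \<le> ennreal (\<Phi> b - \<Phi> a)"
  \<comment> \<open>For the empty subdivision \<open>length ts - 1\<close> is 0, and the unspecified
    \<open>ts ! 0\<close> cancels.\<close>
  proof (cases "ts = []")
    case True
    then show ?thesis by simp
  next
    case False
    then show ?thesis
      using mem[of ?n] mem[of 0] mono[of a "ts ! 0"] mono[of "ts ! ?n" b] by (intro ennreal_leI) auto
  qed
  finally show "(\<Sum>i<?n. ennreal (dist (\<gamma> (ts ! i)) (\<gamma> (ts ! Suc i)))) \<le> ennreal (\<Phi> b - \<Phi> a)" .
qed

text \<open>Longer chords are split into unit parameter steps. Only short steps are available
  because the depth is controlled at the start of a step.\<close>

lemma curve_length_le_local:
  assumes "a \<le> b" and loc: "\<And>s t. a \<le> s \<Longrightarrow> s \<le> t \<Longrightarrow> t \<le> b \<Longrightarrow> t \<le> s + 1 \<Longrightarrow> dist (\<gamma> s) (\<gamma> t) \<le> \<Phi> t - \<Phi> s"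
  shows "curve_length \<gamma> a b \<le> ennreal (\<Phi> b - \<Phi> a)"
proof (rule curve_length_le[OF assms(1)])
  fix s t assume st: "a \<le> s" "s \<le> t" "t \<le> b"
  have "dist (\<gamma> s) (\<gamma> t) \<le> \<Phi> t - \<Phi> s" if "a \<le> s" "s \<le> t" "t \<le> b" "t \<le> s + real n" for n s t
    using that
  proof (induction n arbitrary: s)
    case 0
    then show ?case using loc[of s t] by simp
  next
    case (Suc n)
    show ?case
    proof (cases "t \<le> s + 1")
      case True
      then show ?thesis using loc Suc.prems by simp
    next
      case False
      then have "dist (\<gamma> (s + 1)) (\<gamma> t) \<le> \<Phi> t - \<Phi> (s + 1)" using Suc.prems by (intro Suc.IH) auto
      moreover have "dist (\<gamma> s) (\<gamma> (s + 1)) \<le> \<Phi> (s + 1) - \<Phi> s" using False Suc.prems by (intro loc) auto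
      ultimately show ?thesis using dist_triangle[of "\<gamma> s" "\<gamma> t" "\<gamma> (s + 1)"] by linarith
    qed
  qed
  moreover obtain n where "t - s \<le> real n" using real_arch_simple by blast
  then have "t \<le> s + real n" by simp
  ultimately show "dist (\<gamma> s) (\<gamma> t) \<le> \<Phi> t - \<Phi> s" using st by blast
qed

text \<open>The logistic function is a smooth primitive, up to constants, of
  \<open>exp (- (\<kappa> * \<bar>u - \<tau>\<bar>))\<close>: no case distinction at
  \<open>\<tau>\<close> arises, and its total increase is at most 1. The factor
  \<open>exp \<kappa>\<close> compares \<open>s\<close> with the intermediate point of a step of
  length at most 1.\<close>

lemma exp_abs_le_logistic_increment:
  fixes s t \<kappa> \<tau> :: real
  assumes \<kappa>: "0 < \<kappa>" and st: "s \<le> t" "t \<le> s + 1"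
  defines "\<sigma> \<equiv> \<lambda>u. 1 / (1 + exp (- (\<kappa> * (u - \<tau>))))"
  shows "exp (- (\<kappa> * \<bar>s - \<tau>\<bar>)) * (t - s) \<le> 4 * exp \<kappa> / \<kappa> * (\<sigma> t - \<sigma> s)"
proof (cases "s = t")
  case False
  then have "s < t" using st by simp
  define \<sigma>' where "\<sigma>' = (\<lambda>u. \<kappa> * exp (- (\<kappa> * (u - \<tau>))) / (1 + exp (- (\<kappa> * (u - \<tau>))))\<^sup>2)"
  have "1 + exp w \<noteq> 0" for w :: real using exp_gt_zero[of w] by linarith
  then have "(\<sigma> has_real_derivative \<sigma>' u) (at u)" for u
    unfolding \<sigma>_def \<sigma>'_def by (auto intro!: derivative_eq_intros simp: power2_eq_square)
  then obtain u where u: "s < u" "u < t" "\<sigma> t - \<sigma> s = (t - s) * \<sigma>' u"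
    using MVT2[OF \<open>s < t\<close>, of \<sigma> \<sigma>'] by blast
  \<comment> \<open>For nonnegative \<open>w\<close> the denominator is at most 4; the right-hand
    side is even in \<open>w\<close>, which settles the other case.\<close>
  have quarter: "exp (- \<bar>w\<bar>) / 4 \<le> exp (- w) / (1 + exp (- w))\<^sup>2" for w :: real
  proof (cases "0 \<le> w")
    case True
    then have "(1 + exp (- w))\<^sup>2 \<le> 2\<^sup>2" by (intro power_mono) (auto intro: add_nonneg_nonneg)
    then have "exp (- w) / 2\<^sup>2 \<le> exp (- w) / (1 + exp (- w))\<^sup>2"
      using add_pos_pos[OF zero_less_one exp_gt_zero[of "- w"]] by (intro divide_left_mono) auto
    then show ?thesis using True by simp
  next
    case False
    have "1 + exp (- w) = exp (- w) * (1 + exp w)" by (simp add: algebra_simps flip: exp_add)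
    then have "exp (- w) / (1 + exp (- w))\<^sup>2 = exp (- w) / (exp (- w) * exp (- w)) / (1 + exp w)\<^sup>2"
      by (simp add: power_mult_distrib power2_eq_square)
    also have "exp (- w) / (exp (- w) * exp (- w)) = exp w" by (simp add: exp_minus field_simps)
    finally have "exp (- w) / (1 + exp (- w))\<^sup>2 = exp w / (1 + exp w)\<^sup>2" .
    moreover have "(1 + exp w)\<^sup>2 \<le> 2\<^sup>2" using False by (intro power_mono) (auto intro: add_nonneg_nonneg)
    then have "exp w / 2\<^sup>2 \<le> exp w / (1 + exp w)\<^sup>2"
      using add_pos_pos[OF zero_less_one exp_gt_zero[of w]] by (intro divide_left_mono) auto
    ultimately show ?thesis using False by simp
  qed
  have "exp (- (\<kappa> * \<bar>s - \<tau>\<bar>)) \<le> exp (\<kappa> + - \<bar>\<kappa> * (u - \<tau>)\<bar>)"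
  proof -
    have "\<bar>u - \<tau>\<bar> \<le> \<bar>s - \<tau>\<bar> + 1" using u st by linarith
    then have "\<kappa> * \<bar>u - \<tau>\<bar> \<le> \<kappa> * (\<bar>s - \<tau>\<bar> + 1)" using \<kappa> by (intro mult_left_mono) auto
    moreover have "\<bar>\<kappa> * (u - \<tau>)\<bar> = \<kappa> * \<bar>u - \<tau>\<bar>" using \<kappa> by (simp add: abs_mult)
    ultimately show ?thesis unfolding exp_le_cancel_iff distrib_left by linarith
  qed
  also have "\<dots> = 4 * exp \<kappa> * (exp (- \<bar>\<kappa> * (u - \<tau>)\<bar>) / 4)" unfolding exp_add by simp
  also have "\<dots> \<le> 4 * exp \<kappa> * (exp (- (\<kappa> * (u - \<tau>))) / (1 + exp (- (\<kappa> * (u - \<tau>))))\<^sup>2)"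
    by (intro mult_left_mono quarter) auto
  also have "\<dots> = 4 * exp \<kappa> / \<kappa> * \<sigma>' u" using \<kappa> by (simp add: \<sigma>'_def)
  finally have "exp (- (\<kappa> * \<bar>s - \<tau>\<bar>)) * (t - s) \<le> 4 * exp \<kappa> / \<kappa> * \<sigma>' u * (t - s)"
    using st by (intro mult_right_mono) auto
  then show ?thesis by (simp add: u(3) mult_ac)
qed simp

section \<open>Depth and length of quasi-geodesics that are additive up to a bounded error\<close>

locale rough_quasi_geodesic = dini_convex_domain \<Omega> for \<Omega> :: "(complex^'n) set" +
  fixes m M L K a b :: real and \<gamma> :: "real \<Rightarrow> complex^'n"
  assumes m: "1 < m" and M: "0 \<le> M" "\<And>z v. z \<in> \<Omega> \<Longrightarrow> v \<noteq> 0 \<Longrightarrow> bdist_dir \<Omega> z v \<le> M * bdist \<Omega> z powr (1 / m)"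
    and L: "1 \<le> L" and K: "0 \<le> K"
    and ab: "a \<le> b" and \<gamma>in: "\<And>t. t \<in> {a..b} \<Longrightarrow> \<gamma> t \<in> \<Omega>"
    and lip: "\<And>s t. s \<in> {a..b} \<Longrightarrow> t \<in> {a..b} \<Longrightarrow> kobayashi_dist \<Omega> (\<gamma> s) (\<gamma> t) \<le> L * \<bar>s - t\<bar>"
    and colip: "\<And>s t. s \<in> {a..b} \<Longrightarrow> t \<in> {a..b} \<Longrightarrow> \<bar>s - t\<bar> / L \<le> kobayashi_dist \<Omega> (\<gamma> s) (\<gamma> t)"
    and additive: "\<And>s t u. a \<le> s \<Longrightarrow> s \<le> t \<Longrightarrow> t \<le> u \<Longrightarrow> u \<le> b \<Longrightarrow>
      kobayashi_dist \<Omega> (\<gamma> s) (\<gamma> t) + kobayashi_dist \<Omega> (\<gamma> t) (\<gamma> u) \<le> kobayashi_dist \<Omega> (\<gamma> s) (\<gamma> u) + K"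
begin

abbreviation d :: "complex^'n \<Rightarrow> complex^'n \<Rightarrow> real" where "d \<equiv> kobayashi_dist \<Omega>"

text \<open>The constant of \<open>dist_le_kobayashi_dist\<close> for a unit parameter step, over
  which the Kobayashi distance is at most \<open>L\<close>; the remaining \<open>L\<close> converts
  distance to parameter.\<close>

definition speed_bound :: real where "speed_bound = 2 * M * L * exp (2 * (L + 1)) powr (1 / m)"

lemma speed_bound_nonneg: "0 \<le> speed_bound"
  using M L by (simp add: speed_bound_def)

lemma dist_le_local:
  assumes st: "a \<le> s" "s \<le> t" "t \<le> b" "t \<le> s + 1"
  shows "dist (\<gamma> s) (\<gamma> t) \<le> speed_bound * bdist \<Omega> (\<gamma> s) powr (1 / m) * (t - s)"
proof -
  have in\<Omega>: "\<gamma> s \<in> \<Omega>" "\<gamma> t \<in> \<Omega>" using \<gamma>in st by auto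
  note \<beta> = bdist_pos[OF in\<Omega>(1)]
  have dL: "d (\<gamma> s) (\<gamma> t) \<le> L * (t - s)" using lip[of s t] st by simp
  also have "\<dots> \<le> L * 1" using st L by (intro mult_left_mono) auto
  finally have "bdist \<Omega> (\<gamma> s) * exp (2 * (d (\<gamma> s) (\<gamma> t) + 1)) \<le> bdist \<Omega> (\<gamma> s) * exp (2 * (L + 1))"
    using \<beta> by (intro mult_left_mono) auto
  then have "(bdist \<Omega> (\<gamma> s) * exp (2 * (d (\<gamma> s) (\<gamma> t) + 1))) powr (1 / m)
      \<le> (bdist \<Omega> (\<gamma> s) * exp (2 * (L + 1))) powr (1 / m)"
    using \<beta> m by (intro powr_mono2) auto
  moreover have "0 \<le> d (\<gamma> s) (\<gamma> t)" by (rule kobayashi_dist_nonneg[OF in\<Omega>])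
  ultimately have "2 * M * (bdist \<Omega> (\<gamma> s) * exp (2 * (d (\<gamma> s) (\<gamma> t) + 1))) powr (1 / m) * d (\<gamma> s) (\<gamma> t)
      \<le> 2 * M * (bdist \<Omega> (\<gamma> s) * exp (2 * (L + 1))) powr (1 / m) * (L * (t - s))"
    using M(1) dL by (intro mult_mono) auto
  also have "\<dots> = speed_bound * bdist \<Omega> (\<gamma> s) powr (1 / m) * (t - s)"
    using \<beta> by (simp add: speed_bound_def powr_mult)
  finally show ?thesis
    using dist_le_kobayashi_dist[OF _ M in\<Omega>] m by fastforce
qed

lemma ends_in: "\<gamma> a \<in> \<Omega>" "\<gamma> b \<in> \<Omega>"
  using \<gamma>in ab by auto

text \<open>With \<open>q\<close> the larger depth of the ends and \<open>r\<close> their distance,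
  the ends are within Kobayashi distance \<open>2 * r / q\<close>. So the whole curve has depth at
  most a multiple of \<open>q\<close> and its parameter interval has length at most a multiple of
  \<open>r / q\<close>.\<close>

lemma curve_length_near:
  assumes near: "dist (\<gamma> a) (\<gamma> b) \<le> max (bdist \<Omega> (\<gamma> a)) (bdist \<Omega> (\<gamma> b)) / 2"
  shows "curve_length \<gamma> a b \<le> ennreal (speed_bound * exp (2 * (K + 1)) powr (1 / m) * (2 * L) * dist (\<gamma> a) (\<gamma> b) powr (1 / m))"
proof -
  define q where "q = max (bdist \<Omega> (\<gamma> a)) (bdist \<Omega> (\<gamma> b))"
  define r where "r = dist (\<gamma> a) (\<gamma> b)"
  have q: "0 < q" using bdist_pos[OF ends_in(1)] by (simp add: q_def)
  have rq: "0 \<le> r" "r \<le> q / 2" using near by (simp_all add: r_def q_def)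
  define D where "D = d (\<gamma> a) (\<gamma> b)"
  have D: "D \<le> 2 * r / q"
  proof (cases "bdist \<Omega> (\<gamma> b) \<le> bdist \<Omega> (\<gamma> a)")
    case True
    then have "q = bdist \<Omega> (\<gamma> a)" by (simp add: q_def)
    then show ?thesis using kobayashi_dist_near[OF ends_in(1), of "\<gamma> b"] rq by (simp add: D_def r_def)
  next
    case False
    then have "q = bdist \<Omega> (\<gamma> b)" by (simp add: q_def)
    then show ?thesis
      using kobayashi_dist_near[OF ends_in(2), of "\<gamma> a"] rq kobayashi_dist_commute[OF ends_in]
      by (simp add: D_def r_def dist_commute)
  qed
  have "2 * r / q \<le> 1" using rq q by simp
  then have D1: "D \<le> 1" using D by linarith
  have depth: "bdist \<Omega> (\<gamma> t) \<le> q * exp (2 * (K + 1))" if t: "a \<le> t" "t \<le> b" for t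
  proof -
    have t': "\<gamma> t \<in> \<Omega>" using \<gamma>in t by simp
    have "d (\<gamma> a) (\<gamma> t) + d (\<gamma> t) (\<gamma> b) \<le> D + K" unfolding D_def using additive[of a t b] t by simp
    then have "d (\<gamma> a) (\<gamma> t) \<le> K + 1"
      using D1 kobayashi_dist_nonneg[OF t' ends_in(2)] by linarith
    then have "exp (2 * d (\<gamma> a) (\<gamma> t)) \<le> exp (2 * (K + 1))" by simp
    moreover have "bdist \<Omega> (\<gamma> a) \<le> q" by (simp add: q_def)
    ultimately have "bdist \<Omega> (\<gamma> a) * exp (2 * d (\<gamma> a) (\<gamma> t)) \<le> q * exp (2 * (K + 1))"
      using q by (intro mult_mono) auto
    then show ?thesis using bdist_exp_kobayashi_dist[OF ends_in(1) t'] by linarith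
  qed
  define B where "B = speed_bound * exp (2 * (K + 1)) powr (1 / m) * q powr (1 / m)"
  have B: "0 \<le> B" using speed_bound_nonneg by (simp add: B_def)
  have "curve_length \<gamma> a b \<le> ennreal (B * b - B * a)"
  proof (rule curve_length_le_local[OF ab])
    fix s t assume st: "a \<le> s" "s \<le> t" "t \<le> b" "t \<le> s + 1"
    have "\<gamma> s \<in> \<Omega>" using \<gamma>in st by simp
    then have "bdist \<Omega> (\<gamma> s) powr (1 / m) \<le> (q * exp (2 * (K + 1))) powr (1 / m)"
      using depth[of s] st m bdist_pos by (intro powr_mono2) (auto intro: less_imp_le)
    also have "\<dots> = exp (2 * (K + 1)) powr (1 / m) * q powr (1 / m)" using q by (simp add: powr_mult)
    finally have "speed_bound * bdist \<Omega> (\<gamma> s) powr (1 / m) * (t - s) \<le> speed_bound * (exp (2 * (K + 1)) powr (1 / m) * q powr (1 / m)) * (t - s)"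
      using speed_bound_nonneg st by (intro mult_right_mono mult_left_mono) auto
    then show "dist (\<gamma> s) (\<gamma> t) \<le> B * t - B * s"
      using dist_le_local[OF st] by (simp add: B_def algebra_simps)
  qed
  also have "B * b - B * a \<le> speed_bound * exp (2 * (K + 1)) powr (1 / m) * (2 * L) * r powr (1 / m)"
  proof -
    have "(b - a) / L \<le> 2 * r / q" using colip[of a b] ab D by (simp add: D_def)
    then have ba: "b - a \<le> 2 * L * (r / q)" using L by (simp add: field_simps)
    \<comment> \<open>Since \<open>r / q \<le> 1\<close> and \<open>1 / m \<le> 1\<close>, passing
      to this power is an upper bound, and the depth \<open>q\<close> then cancels.\<close>
    have "r / q \<le> (r / q) powr (1 / m)"
    proof (cases "r = 0")
      case False
      then have "(r / q) powr 1 \<le> (r / q) powr (1 / m)"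
        using rq q m by (intro powr_mono') auto
      then show ?thesis using rq q by simp
    qed simp
    then have "2 * L * (r / q) \<le> 2 * L * (r / q) powr (1 / m)"
      using L by (intro mult_left_mono) auto
    then have "B * (b - a) \<le> B * (2 * L * (r / q) powr (1 / m))"
      using ba B by (intro mult_left_mono) auto
    also have "(r / q) powr (1 / m) = r powr (1 / m) / q powr (1 / m)" using rq q by (simp add: powr_divide)
    also have "B * (2 * L * (r powr (1 / m) / q powr (1 / m))) = speed_bound * exp (2 * (K + 1)) powr (1 / m) * (2 * L) * r powr (1 / m)"
      using q by (simp add: B_def)
    finally show ?thesis by (simp add: right_diff_distrib)
  qed
  finally show ?thesis by (simp add: r_def ennreal_leI)
qed

text \<open>The distance to the boundary grows at most like \<open>exp (2 d)\<close> along a curve leaving either end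
  point; the two bounds meet at height \<open>h\<close> and force exponential decay on both sides of the meeting
  parameter.\<close>

lemma depth_decay:
  defines "h \<equiv> sqrt (bdist \<Omega> (\<gamma> a) * bdist \<Omega> (\<gamma> b)) * exp (d (\<gamma> a) (\<gamma> b))"
  obtains \<tau> where "\<And>t. t \<in> {a..b} \<Longrightarrow> bdist \<Omega> (\<gamma> t) \<le> h * exp (4 * K) * exp (- (2 * \<bar>t - \<tau>\<bar> / L))"
proof -
  define \<alpha> where "\<alpha> = bdist \<Omega> (\<gamma> a)"
  define \<beta> where "\<beta> = bdist \<Omega> (\<gamma> b)"
  define D where "D = d (\<gamma> a) (\<gamma> b)"
  have pos: "0 < \<alpha>" "0 < \<beta>" using bdist_pos ends_in by (auto simp: \<alpha>_def \<beta>_def)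
  have h: "h = sqrt (\<alpha> * \<beta>) * exp D" by (simp add: h_def \<alpha>_def \<beta>_def D_def)
  have hp: "0 < h" using pos by (simp add: h)
  have h2: "h\<^sup>2 = \<alpha> * \<beta> * exp (2 * D)"
    using pos by (simp add: h power_mult_distrib exp_double)
  \<comment> \<open>The Kobayashi distance from \<open>\<gamma> a\<close> at which the growth bound
    starting from \<open>\<alpha>\<close> reaches \<open>h\<close>; by the choice of
    \<open>h\<close> the bound coming back from \<open>\<beta>\<close> has the value
    \<open>h\<close> there as well.\<close>
  define s0 where "s0 = ln (h / \<alpha>) / 2"
  have s0: "h = \<alpha> * exp (2 * s0)" using hp pos by (simp add: s0_def)
  have s0': "\<beta> * exp (2 * D) = h * exp (2 * s0)"
  proof -
    have "\<alpha> * (\<beta> * exp (2 * D)) = \<alpha> * (h * exp (2 * s0))"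
      using h2 s0 by (metis mult.assoc mult.left_commute power2_eq_square)
    then show ?thesis using pos by simp
  qed
  have ratio: "\<alpha> \<le> \<beta> * exp (2 * D)" "\<beta> \<le> \<alpha> * exp (2 * D)"
    using bdist_exp_kobayashi_dist[OF ends_in] bdist_exp_kobayashi_dist[OF ends_in(2,1)]
      kobayashi_dist_commute[OF ends_in] by (simp_all add: \<alpha>_def \<beta>_def D_def)
  have "0 \<le> s0"
  proof -
    have "\<alpha> \<le> \<alpha> * (exp (2 * s0) * exp (2 * s0))" using ratio(1) s0' s0 by (simp add: mult.assoc)
    then have "1 \<le> exp (2 * s0) * exp (2 * s0)" using pos by simp
    then have "1 \<le> exp (2 * s0 + 2 * s0)" by (simp only: exp_add)
    then have "0 \<le> 2 * s0 + 2 * s0" by (simp only: one_le_exp_iff)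
    then show ?thesis by simp
  qed
  moreover have "s0 \<le> D"
  proof -
    have "h * exp (2 * s0) \<le> \<alpha> * exp (2 * D) * exp (2 * D)"
      using mult_right_mono[OF ratio(2), of "exp (2 * D)"] s0' by simp
    then have "\<alpha> * exp (2 * s0 + 2 * s0) \<le> \<alpha> * exp (2 * D + 2 * D)"
      by (simp only: s0 exp_add mult.assoc)
    then have "2 * s0 + 2 * s0 \<le> 2 * D + 2 * D" using pos by simp
    then show ?thesis by simp
  qed
  \<comment> \<open>The distance from \<open>\<gamma> a\<close> is continuous in the parameter and
    runs from 0 to \<open>D\<close>, so it takes the value \<open>s0\<close> somewhere.\<close>
  moreover define \<sigma> where "\<sigma> = (\<lambda>t. d (\<gamma> a) (\<gamma> t))"
  have "continuous_on {a..b} \<sigma>"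
    unfolding continuous_on_iff
  proof (intro ballI allI impI)
    fix t and e :: real assume t: "t \<in> {a..b}" and e: "0 < e"
    show "\<exists>\<eta>>0. \<forall>u\<in>{a..b}. dist u t < \<eta> \<longrightarrow> dist (\<sigma> u) (\<sigma> t) < e"
    proof (intro exI[of _ "e / L"] conjI ballI impI)
      show "0 < e / L" using e L by simp
      fix u assume u: "u \<in> {a..b}" "dist u t < e / L"
      have "\<bar>\<sigma> u - \<sigma> t\<bar> \<le> d (\<gamma> u) (\<gamma> t)"
        using kobayashi_dist_triangle[OF ends_in(1) \<gamma>in[OF u(1)] \<gamma>in[OF t]]
          kobayashi_dist_triangle[OF ends_in(1) \<gamma>in[OF t] \<gamma>in[OF u(1)]]
          kobayashi_dist_commute[OF \<gamma>in[OF t] \<gamma>in[OF u(1)]] by (simp add: \<sigma>_def)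
      also have "\<dots> \<le> L * dist u t" using lip[OF u(1) t] by (simp add: dist_real_def)
      also have "\<dots> < e" using u(2) L by (simp add: field_simps)
      finally show "dist (\<sigma> u) (\<sigma> t) < e" by (simp add: dist_real_def)
    qed
  qed
  moreover have "\<sigma> a = 0" "\<sigma> b = D" using kobayashi_dist_self[OF ends_in(1)] by (simp_all add: \<sigma>_def D_def)
  ultimately obtain \<tau> where \<tau>: "a \<le> \<tau>" "\<tau> \<le> b" "\<sigma> \<tau> = s0"
    using IVT'[of \<sigma> a s0 b] ab by auto
  show ?thesis
  proof (rule that)
    fix t assume t: "t \<in> {a..b}"
    have t\<tau>: "\<tau> \<in> {a..b}" using \<tau> by simp
    have up: "bdist \<Omega> (\<gamma> t) \<le> h * exp (2 * (\<sigma> t - s0))"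
    proof -
      have "bdist \<Omega> (\<gamma> t) \<le> \<alpha> * exp (2 * \<sigma> t)"
        unfolding \<alpha>_def \<sigma>_def by (rule bdist_exp_kobayashi_dist[OF ends_in(1) \<gamma>in[OF t]])
      also have "\<dots> = h * exp (2 * (\<sigma> t - s0))" by (simp add: s0 mult.assoc flip: exp_add)
      finally show ?thesis .
    qed
    have down: "bdist \<Omega> (\<gamma> t) \<le> h * exp (2 * (s0 - \<sigma> t + K))"
    proof -
      have "bdist \<Omega> (\<gamma> t) \<le> \<beta> * exp (2 * d (\<gamma> b) (\<gamma> t))"
        unfolding \<beta>_def by (rule bdist_exp_kobayashi_dist[OF ends_in(2) \<gamma>in[OF t]])
      also have "d (\<gamma> b) (\<gamma> t) \<le> D + K - \<sigma> t"
        using additive[of a t b] t kobayashi_dist_commute[OF ends_in(2) \<gamma>in[OF t]] by (simp add: \<sigma>_def D_def)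
      then have "\<beta> * exp (2 * d (\<gamma> b) (\<gamma> t)) \<le> \<beta> * exp (2 * (D + K - \<sigma> t))" using pos by simp
      also have "2 * (D + K - \<sigma> t) = 2 * D + 2 * (K - \<sigma> t)" by simp
      also have "\<beta> * exp (2 * D + 2 * (K - \<sigma> t)) = h * exp (2 * s0) * exp (2 * (K - \<sigma> t))"
        by (simp only: exp_add mult.assoc[symmetric] s0')
      also have "\<dots> = h * exp (2 * (s0 - \<sigma> t + K))" by (simp add: mult.assoc flip: exp_add)
      finally show ?thesis .
    qed
    \<comment> \<open>Each use of additivity costs \<open>K\<close> and the factor 2 in the exponent
      doubles it. The side after \<open>\<tau>\<close> uses it twice, hence
      \<open>4 * K\<close>.\<close>
    have "bdist \<Omega> (\<gamma> t) \<le> h * exp (4 * K - 2 * (\<bar>t - \<tau>\<bar> / L))"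
    proof (cases "t \<le> \<tau>")
      case True
      have "\<sigma> t + d (\<gamma> t) (\<gamma> \<tau>) \<le> s0 + K" using additive[of a t \<tau>] t \<tau> True by (simp add: \<sigma>_def)
      then have "\<sigma> t - s0 \<le> K - \<bar>t - \<tau>\<bar> / L" using colip[OF t t\<tau>] by simp
      then have "exp (2 * (\<sigma> t - s0)) \<le> exp (4 * K - 2 * (\<bar>t - \<tau>\<bar> / L))" using K by simp
      then have "h * exp (2 * (\<sigma> t - s0)) \<le> h * exp (4 * K - 2 * (\<bar>t - \<tau>\<bar> / L))"
        using hp by (intro mult_left_mono) auto
      with up show ?thesis by linarith
    next
      case False
      have "s0 + d (\<gamma> \<tau>) (\<gamma> t) \<le> \<sigma> t + K" using additive[of a \<tau> t] t \<tau> False by (simp add: \<sigma>_def)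
      moreover have "\<bar>t - \<tau>\<bar> / L \<le> d (\<gamma> \<tau>) (\<gamma> t)" using colip[OF t\<tau> t] by (simp add: abs_minus_commute)
      ultimately have "exp (2 * (s0 - \<sigma> t + K)) \<le> exp (4 * K - 2 * (\<bar>t - \<tau>\<bar> / L))" by simp
      then have "h * exp (2 * (s0 - \<sigma> t + K)) \<le> h * exp (4 * K - 2 * (\<bar>t - \<tau>\<bar> / L))"
        using hp by (intro mult_left_mono) auto
      with down show ?thesis by linarith
    qed
    then show "bdist \<Omega> (\<gamma> t) \<le> h * exp (4 * K) * exp (- (2 * \<bar>t - \<tau>\<bar> / L))"
      by (simp add: mult.assoc flip: exp_add)
  qed
qed

text \<open>The depth decays like \<open>exp (- (2 * \<bar>t - \<tau>\<bar> / L))\<close>, so its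
  power \<open>1 / m\<close>, which bounds the speed, decays at rate \<open>\<kappa>\<close>. The
  logistic potential increases by at most 1 in total, leaving a multiple of
  \<open>h powr (1 / m)\<close>.\<close>

lemma curve_length_far:
  assumes far: "sqrt (bdist \<Omega> (\<gamma> a) * bdist \<Omega> (\<gamma> b)) * exp (d (\<gamma> a) (\<gamma> b)) \<le> C * dist (\<gamma> a) (\<gamma> b)" and C: "0 < C"
  defines "\<kappa> \<equiv> 2 / (L * m)"
  shows "curve_length \<gamma> a b \<le>
     ennreal (speed_bound * (4 * exp \<kappa> / \<kappa>) * (C * exp (4 * K)) powr (1 / m) * dist (\<gamma> a) (\<gamma> b) powr (1 / m))"
proof -
  define h where "h = sqrt (bdist \<Omega> (\<gamma> a) * bdist \<Omega> (\<gamma> b)) * exp (d (\<gamma> a) (\<gamma> b))"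
  obtain \<tau> where \<tau>: "\<And>t. t \<in> {a..b} \<Longrightarrow> bdist \<Omega> (\<gamma> t) \<le> h * exp (4 * K) * exp (- (2 * \<bar>t - \<tau>\<bar> / L))"
    using depth_decay unfolding h_def by blast
  have hp: "0 < h" using bdist_pos ends_in by (simp add: h_def)
  have \<kappa>: "0 < \<kappa>" using L m by (simp add: \<kappa>_def)
  define H where "H = (h * exp (4 * K)) powr (1 / m)"
  define B where "B = speed_bound * H * (4 * exp \<kappa> / \<kappa>)"
  have B: "0 \<le> B" using speed_bound_nonneg \<kappa> by (simp add: B_def H_def)
  define \<phi> where "\<phi> = (\<lambda>u. 1 / (1 + exp (- (\<kappa> * (u - \<tau>)))))"
  have "curve_length \<gamma> a b \<le> ennreal (B * \<phi> b - B * \<phi> a)"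
  proof (rule curve_length_le_local[OF ab])
    fix s t assume st: "a \<le> s" "s \<le> t" "t \<le> b" "t \<le> s + 1"
    have s: "s \<in> {a..b}" using st by simp
    have "bdist \<Omega> (\<gamma> s) powr (1 / m) \<le> (h * exp (4 * K) * exp (- (2 * \<bar>s - \<tau>\<bar> / L))) powr (1 / m)"
      using \<tau>[OF s] bdist_pos[OF \<gamma>in[OF s]] m by (intro powr_mono2) auto
    also have "\<dots> = H * exp (- (2 * \<bar>s - \<tau>\<bar> / L)) powr (1 / m)"
      unfolding H_def using hp by (intro powr_mult)
    also have "exp (- (2 * \<bar>s - \<tau>\<bar> / L)) powr (1 / m) = exp (- (\<kappa> * \<bar>s - \<tau>\<bar>))"
      by (simp add: powr_def \<kappa>_def field_simps)
    finally have "speed_bound * bdist \<Omega> (\<gamma> s) powr (1 / m) * (t - s) \<le> speed_bound * (H * exp (- (\<kappa> * \<bar>s - \<tau>\<bar>))) * (t - s)"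
      using speed_bound_nonneg st by (intro mult_right_mono mult_left_mono) auto
    also have "\<dots> = speed_bound * H * (exp (- (\<kappa> * \<bar>s - \<tau>\<bar>)) * (t - s))" by simp
    also have "\<dots> \<le> speed_bound * H * (4 * exp \<kappa> / \<kappa> * (\<phi> t - \<phi> s))"
      unfolding \<phi>_def using speed_bound_nonneg st by (intro mult_left_mono exp_abs_le_logistic_increment \<kappa>) (auto simp: H_def)
    also have "\<dots> = B * \<phi> t - B * \<phi> s" by (simp only: B_def right_diff_distrib mult.assoc)
    finally show "dist (\<gamma> s) (\<gamma> t) \<le> B * \<phi> t - B * \<phi> s" using dist_le_local[OF st] by linarith
  qed
  also have "B * \<phi> b - B * \<phi> a \<le> B * 1"
  proof -
    have "0 \<le> \<phi> a" "\<phi> b \<le> 1" by (simp_all add: \<phi>_def add_nonneg_nonneg add_pos_pos)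
    then have "\<phi> b - \<phi> a \<le> 1" by simp
    from mult_left_mono[OF this B] show ?thesis by (simp add: right_diff_distrib)
  qed
  also have "B * 1 \<le> speed_bound * (4 * exp \<kappa> / \<kappa>) * ((C * exp (4 * K)) powr (1 / m) * dist (\<gamma> a) (\<gamma> b) powr (1 / m))"
  proof -
    have "h * exp (4 * K) \<le> C * dist (\<gamma> a) (\<gamma> b) * exp (4 * K)"
      using far by (simp add: h_def)
    then have "H \<le> (C * exp (4 * K) * dist (\<gamma> a) (\<gamma> b)) powr (1 / m)"
      unfolding H_def using hp m by (intro powr_mono2) (auto simp: mult_ac)
    also have "\<dots> = (C * exp (4 * K)) powr (1 / m) * dist (\<gamma> a) (\<gamma> b) powr (1 / m)"
      using C by (intro powr_mult)
    finally have "speed_bound * (4 * exp \<kappa> / \<kappa>) * H \<le> speed_bound * (4 * exp \<kappa> / \<kappa>) * ((C * exp (4 * K)) powr (1 / m) * dist (\<gamma> a) (\<gamma> b) powr (1 / m))"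
      using speed_bound_nonneg \<kappa> by (intro mult_left_mono) auto
    then show ?thesis by (simp add: B_def mult_ac)
  qed
  finally show ?thesis by (simp add: mult.assoc ennreal_leI)
qed

end

text \<open>The common form of both assertions: geodesics have \<open>L = 1\<close> and
  \<open>K = 0\<close>, while under hyperbolicity \<open>K\<close> comes from the Morse
  lemma.\<close>

definition additive_quasi_geodesic ::
  "(complex^'n) set \<Rightarrow> real \<Rightarrow> real \<Rightarrow> real \<Rightarrow> real \<Rightarrow> (real \<Rightarrow> complex^'n) \<Rightarrow> bool" where
  "additive_quasi_geodesic \<Omega> L K a b \<gamma> \<longleftrightarrow> kobayashi_quasi_geodesic \<Omega> L (\<gamma> a) (\<gamma> b) a b \<gamma> \<and>
     (\<forall>s t u. a \<le> s \<longrightarrow> s \<le> t \<longrightarrow> t \<le> u \<longrightarrow> u \<le> b \<longrightarrow>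
        kobayashi_dist \<Omega> (\<gamma> s) (\<gamma> t) + kobayashi_dist \<Omega> (\<gamma> t) (\<gamma> u) \<le> kobayashi_dist \<Omega> (\<gamma> s) (\<gamma> u) + K)"

text \<open>All constants are fixed before the curve is chosen, which is why they are written out
  here instead of being taken from the locale of a single curve.\<close>

lemma (in dini_convex_domain) ex_curve_length_bound:
  assumes m: "1 < m" and mc: "m_convex m \<Omega>" and L: "1 \<le> L" and K: "0 \<le> K"
  shows "\<exists>C>0. \<forall>a b \<gamma>. additive_quasi_geodesic \<Omega> L K a b \<gamma> \<longrightarrow>
     curve_length \<gamma> a b \<le> ennreal (C * norm (\<gamma> a - \<gamma> b) powr (1 / m))"
proof -
  obtain M where M: "0 < M" "\<And>z v. z \<in> \<Omega> \<Longrightarrow> v \<noteq> 0 \<Longrightarrow> bdist_dir \<Omega> z v \<le> M * bdist \<Omega> z powr (1 / m)"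
    using mc unfolding m_convex_def by blast
  obtain F where F: "0 < F" "\<And>x y. x \<in> \<Omega> \<Longrightarrow> y \<in> \<Omega> \<Longrightarrow>
    bdist \<Omega> x \<le> 2 * dist x y \<Longrightarrow> bdist \<Omega> y \<le> 2 * dist x y \<Longrightarrow>
    sqrt (bdist \<Omega> x * bdist \<Omega> y) * exp (kobayashi_dist \<Omega> x y) \<le> F * dist x y"
    using kobayashi_dist_far by blast
  define \<kappa> where "\<kappa> = 2 / (L * m)"
  define A where "A = 2 * M * L * exp (2 * (L + 1)) powr (1 / m)"
  define C1 where "C1 = A * exp (2 * (K + 1)) powr (1 / m) * (2 * L)"
  define C2 where "C2 = A * (4 * exp \<kappa> / \<kappa>) * (F * exp (4 * K)) powr (1 / m)"
  have "0 < A" "0 < \<kappa>" using M L m by (simp_all add: A_def \<kappa>_def)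
  then have C: "0 < C1" "0 < C2" using L F by (simp_all add: C1_def C2_def)
  show ?thesis
  proof (intro exI[of _ "C1 + C2"] conjI allI impI)
    show "0 < C1 + C2" using C by simp
    fix a b \<gamma>
    assume "additive_quasi_geodesic \<Omega> L K a b \<gamma>"
    note * = this[unfolded additive_quasi_geodesic_def kobayashi_quasi_geodesic_def]
    interpret rough_quasi_geodesic \<Omega> m M L K a b \<gamma>
      by unfold_locales (use m M L K * in auto)
    let ?r = "dist (\<gamma> a) (\<gamma> b) powr (1 / m)"
    have "curve_length \<gamma> a b \<le> ennreal (C1 * ?r) \<or> curve_length \<gamma> a b \<le> ennreal (C2 * ?r)"
    \<comment> \<open>If the ends are not close compared with the larger depth, both depths satisfy
      the hypotheses of \<open>kobayashi_dist_far\<close>.\<close>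
    proof (cases "dist (\<gamma> a) (\<gamma> b) \<le> max (bdist \<Omega> (\<gamma> a)) (bdist \<Omega> (\<gamma> b)) / 2")
      case True
      from curve_length_near[OF this] show ?thesis by (simp only: C1_def A_def speed_bound_def simp_thms)
    next
      case False
      then have "bdist \<Omega> (\<gamma> a) \<le> 2 * dist (\<gamma> a) (\<gamma> b)" "bdist \<Omega> (\<gamma> b) \<le> 2 * dist (\<gamma> a) (\<gamma> b)" by auto
      from curve_length_far[OF F(2)[OF ends_in this] F(1)] show ?thesis
        by (simp only: C2_def A_def \<kappa>_def speed_bound_def simp_thms)
    qed
    moreover have "C1 * ?r \<le> (C1 + C2) * ?r" "C2 * ?r \<le> (C1 + C2) * ?r"
      using C by (auto intro!: mult_right_mono)
    ultimately show "curve_length \<gamma> a b \<le> ennreal ((C1 + C2) * norm (\<gamma> a - \<gamma> b) powr (1 / m))"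
      unfolding dist_norm by (meson ennreal_leI order_trans)
  qed
qed

theorem theorem1p7:
  fixes \<Omega> :: "(complex^'n) set" and m :: real
  assumes "CARD('n) \<ge> 2"
    and "open \<Omega>" and "\<Omega> \<noteq> {}" and "bounded \<Omega>" and "convex \<Omega>"
    and "m > 1" and "m_convex m \<Omega>"
    and "dini_smooth_boundary \<Omega>"
  shows "(\<exists>C>0. \<forall>x\<in>\<Omega>. \<forall>y\<in>\<Omega>. \<forall>\<sigma>. kobayashi_geodesic \<Omega> x y \<sigma> \<longrightarrow>
            curve_length \<sigma> 0 (kobayashi_dist \<Omega> x y) \<le> ennreal (C * norm (x - y) powr (1 / m))) \<and>
         (gromov_hyperbolic \<Omega> (kobayashi_dist \<Omega>) \<longrightarrow>
           (\<forall>\<Lambda>\<ge>1. \<exists>C'>0. \<forall>x\<in>\<Omega>. \<forall>y\<in>\<Omega>. \<forall>a b \<gamma>. kobayashi_quasi_geodesic \<Omega> \<Lambda> x y a b \<gamma> \<longrightarrow>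
              curve_length \<gamma> a b \<le> ennreal (C' * norm (x - y) powr (1 / m))))"
proof (intro conjI impI allI)
  interpret dini_convex_domain \<Omega> by unfold_locales (use assms in auto)
  note bound = ex_curve_length_bound[OF assms(6,7)]
  show "\<exists>C>0. \<forall>x\<in>\<Omega>. \<forall>y\<in>\<Omega>. \<forall>\<sigma>. kobayashi_geodesic \<Omega> x y \<sigma> \<longrightarrow>
            curve_length \<sigma> 0 (kobayashi_dist \<Omega> x y) \<le> ennreal (C * norm (x - y) powr (1 / m))"
  proof -
    \<comment> \<open>A geodesic is exactly additive, so no hyperbolicity enters here.\<close>
    obtain C where C: "0 < C" and le: "\<And>a b \<gamma>. additive_quasi_geodesic \<Omega> 1 0 a b \<gamma> \<Longrightarrow>
        curve_length \<gamma> a b \<le> ennreal (C * norm (\<gamma> a - \<gamma> b) powr (1 / m))"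
      using bound[of 1 0] by auto
    show ?thesis
    proof (intro exI[of _ C] conjI C ballI allI impI)
      fix x y \<sigma> assume xy: "x \<in> \<Omega>" "y \<in> \<Omega>" and geo: "kobayashi_geodesic \<Omega> x y \<sigma>"
      show "curve_length \<sigma> 0 (kobayashi_dist \<Omega> x y) \<le> ennreal (C * norm (x - y) powr (1 / m))"
        using le[of 0 "kobayashi_dist \<Omega> x y" \<sigma>] geo kobayashi_dist_nonneg[OF xy]
        by (simp add: kobayashi_geodesic_def additive_quasi_geodesic_def kobayashi_quasi_geodesic_def)
    qed
  qed
  fix \<Lambda> :: real assume hyp: "gromov_hyperbolic \<Omega> (kobayashi_dist \<Omega>)" and \<Lambda>: "1 \<le> \<Lambda>"
  obtain \<delta> where "roughly_geodesic_hyperbolic \<Omega> (kobayashi_dist \<Omega>) \<delta>"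
    using roughly_geodesic_hyperbolic[OF hyp] .
  then interpret H: roughly_geodesic_hyperbolic \<Omega> "kobayashi_dist \<Omega>" \<delta> .
  obtain K where K: "0 \<le> K" "\<And>a b \<gamma> t. H.quasi_geodesic \<Lambda> a b \<gamma> \<Longrightarrow> t \<in> {a..b} \<Longrightarrow>
    kobayashi_dist \<Omega> (\<gamma> a) (\<gamma> t) + kobayashi_dist \<Omega> (\<gamma> t) (\<gamma> b) \<le> kobayashi_dist \<Omega> (\<gamma> a) (\<gamma> b) + K"
    using H.quasi_geodesic_roughly_additive[OF \<Lambda>] by blast
  obtain C where C: "0 < C" and le: "\<And>a b \<gamma>. additive_quasi_geodesic \<Omega> \<Lambda> K a b \<gamma> \<Longrightarrow>
      curve_length \<gamma> a b \<le> ennreal (C * norm (\<gamma> a - \<gamma> b) powr (1 / m))"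
    using bound[OF \<Lambda> K(1)] by auto
  show "\<exists>C'>0. \<forall>x\<in>\<Omega>. \<forall>y\<in>\<Omega>. \<forall>a b \<gamma>. kobayashi_quasi_geodesic \<Omega> \<Lambda> x y a b \<gamma> \<longrightarrow>
              curve_length \<gamma> a b \<le> ennreal (C' * norm (x - y) powr (1 / m))"
  proof (intro exI[of _ C] conjI C ballI allI impI)
    fix x y a b \<gamma> assume kqg: "kobayashi_quasi_geodesic \<Omega> \<Lambda> x y a b \<gamma>"
    then have qg: "H.quasi_geodesic \<Lambda> a b \<gamma>" "\<gamma> a = x" "\<gamma> b = y"
      by (auto simp: kobayashi_quasi_geodesic_def H.quasi_geodesic_def)
    \<comment> \<open>The Morse bound concerns the ends of a curve; applied to every restriction it
      gives additivity for all triples with the same \<open>K\<close>.\<close>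
    have "H.quasi_geodesic \<Lambda> s u \<gamma>" if "a \<le> s" "s \<le> u" "u \<le> b" for s u
      using qg(1) that unfolding H.quasi_geodesic_def by (auto simp: image_subset_iff)
    then have "\<forall>s t u. a \<le> s \<longrightarrow> s \<le> t \<longrightarrow> t \<le> u \<longrightarrow> u \<le> b \<longrightarrow>
        kobayashi_dist \<Omega> (\<gamma> s) (\<gamma> t) + kobayashi_dist \<Omega> (\<gamma> t) (\<gamma> u) \<le> kobayashi_dist \<Omega> (\<gamma> s) (\<gamma> u) + K"
      using K(2) by (meson atLeastAtMost_iff order_trans)
    then show "curve_length \<gamma> a b \<le> ennreal (C * norm (x - y) powr (1 / m))"
      using le[of a b \<gamma>] qg(2,3) kqg unfolding additive_quasi_geodesic_def by blast
  qed
qed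

end
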